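(* Let $\Omega\subset\mathbb{R}^N$, $N\ge 2$, be a region satisfying (B2), let $\mathcal{B}=\{b_j:j\ge1\}$ be a sequence of $\Delta$-orthonormal DBS eigenfunctions constructed as in the context, let $h_j:=\Delta b_j$ and $\mathcal{B}_H:=\{h_j:j\ge 1\}$. Then $\mathcal{B}_H$ is a maximal orthonormal set in $L^2_H(\Omega)$. The orthogonal projection $\mathbb{P}_H$ of $L^2(\Omega)$ onto $L^2_H(\Omega)$ has the representation $$\mathbb{P}_Hf=\lim_{M\to\infty}\mathscr{H}_Mf=\sum_{j=1}^\infty\langle f,h_j\rangle\,h_j\qquad\text{for all } f\in L^2(\Omega),$$ with convergence in $L^2(\Omega)$, where $$\mathscr{H}_Mf(x):=\int_\Omega H_M(x,y)f(y)\,dy,\qquad H_M(x,y):=\sum_{j=1}^M h_j(x)h_j(y).$$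
   Context: A region is a nonempty connected open subset of $\mathbb{R}^N$. All functions are real valued and derivatives are weak. $\langle f,g\rangle=\int_\Omega fg\,dx$. (B1): $\Omega$ is bounded and $\partial\Omega$ is the union of a finite number of disjoint closed Lipschitz surfaces, each having finite surface area. $\sigma$ is $(N-1)$-dimensional Hausdorff measure on $\partial\Omega$, $\nu$ the outward unit normal, $\gamma$ the boundary trace on $H^1(\Omega)$. $H_0(\Delta,\Omega)=\{u\in H_0^1(\Omega):\Delta u\in L^2(\Omega)\}$ ($\Delta$ the weak Laplacian), a Hilbert space with inner product $[u,v]_\Delta:=a(u,v):=\int_\Omega\Delta u\,\Delta v\,dx$ and norm $\|u\|_\Delta$. "$\Delta$-orthonormal" refers to $[\cdot,\cdot]_\Delta$. For $u\in H_0(\Delta,\Omega)$, $D_\nu u\in L^2(\partial\Omega,d\sigma)$ is the normal derivative determined by $\int_{\partial\Omega}\gamma(v)D_\nu u\,d\sigma=\int_\Omega(\nabla u\cdot\nabla v+v\Delta u)\,dx$ for all $v\in H^1(\Omega)$. (B2): (B1) holds and $D_\nu$ is a compact mapping of $H_0(\Delta,\Omega)$ into $L^2(\partial\Omega,d\sigma)$. A DBS (Dirichlet Biharmonic Steklov) eigenvalue/eigenfunction is a pair $(q,b)\in\mathbb{R}\times H_0(\Delta,\Omega)$ with $b\ne 0$ and $\int_\Omega\Delta b\,\Delta v\,dx=q\int_{\partial\Omega}D_\nu b\,D_\nu v\,d\sigma$ for all $v\in H_0(\Delta,\Omega)$. Construction of $\mathcal{B}$: put $\mathcal{M}(u):=\int_{\partial\Omega}|D_\nu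 u|^2\,d\sigma$. For $k=1,2,\dots$, given $b_1,\dots,b_{k-1}$, let $C_k:=\{u\in H_0(\Delta,\Omega):\|u\|_\Delta\le 1,\ a(u,b_j)=0\text{ for }1\le j\le k-1\}$, $\beta_k:=\sup_{C_k}\mathcal{M}$, and let $b_k\in C_k$ be a maximizer of $\mathcal{M}$ on $C_k$. The $b_k$ are $\Delta$-orthonormal DBS eigenfunctions with eigenvalues $q_k=1/\beta_k$. $L^2_H(\Omega)$ (the harmonic Bergman space) is the space of all $u\in L^2(\Omega)$ with $\int_\Omega u\,\Delta v\,dx=0$ for all $v\in C_c^2(\Omega)$. The functions $h_j=\Delta b_j$ are harmonic on $\Omega$ and are represented by their $C^\infty$ versions. *)

theory Defs
  imports "HOL-Analysis.Analysis"
begin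

text \<open>
  Elements of \<open>L\<^sup>2\<close> and of the Sobolev spaces are represented by functions; two functions that agree
  almost everywhere represent the same element.  Operators defined by \<open>SOME\<close> pick a representative
  of a class that is determined up to null sets.
\<close>

definition L2 :: "'a measure \<Rightarrow> ('a \<Rightarrow> real) set" where
  "L2 M = {f \<in> borel_measurable M. integrable M (\<lambda>x. (f x)\<^sup>2)}"

definition L2_inner :: "'a measure \<Rightarrow> ('a \<Rightarrow> real) \<Rightarrow> ('a \<Rightarrow> real) \<Rightarrow> real" where
  "L2_inner M f g = (\<integral>x. f x * g x \<partial>M)"

definition L2_norm :: "'a measure \<Rightarrow> ('a \<Rightarrow> real) \<Rightarrow> real" where
  "L2_norm M f = sqrt (L2_inner M f f)"

(* The membership conditions are needed: the norm of a function outside L2 is 0 by convention. *)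
definition L2_tendsto :: "'a measure \<Rightarrow> (nat \<Rightarrow> 'a \<Rightarrow> real) \<Rightarrow> ('a \<Rightarrow> real) \<Rightarrow> bool" where
  "L2_tendsto M F f \<longleftrightarrow>
     (\<forall>n. F n \<in> L2 M) \<and> f \<in> L2 M \<and> (\<lambda>n. L2_norm M (\<lambda>x. F n x - f x)) \<longlonglongrightarrow> 0"

(* Distinct functions in an orthonormal set have inner product 0, so such a set contains at most
   one representative of each class. *)
definition orthonormal_set :: "'a measure \<Rightarrow> ('a \<Rightarrow> real) set \<Rightarrow> bool" where
  "orthonormal_set M B \<longleftrightarrow>
     B \<subseteq> L2 M \<and> (\<forall>f\<in>B. \<forall>g\<in>B. L2_inner M f g = (if f = g then 1 else 0))"

definition maximal_orthonormal_set ::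
    "'a measure \<Rightarrow> ('a \<Rightarrow> real) set \<Rightarrow> ('a \<Rightarrow> real) set \<Rightarrow> bool" where
  "maximal_orthonormal_set M V B \<longleftrightarrow>
     orthonormal_set M B \<and> B \<subseteq> V \<and> (\<forall>C. orthonormal_set M C \<and> B \<subseteq> C \<and> C \<subseteq> V \<longrightarrow> C = B)"

definition orth_proj ::
    "'a measure \<Rightarrow> ('a \<Rightarrow> real) set \<Rightarrow> ('a \<Rightarrow> real) \<Rightarrow> 'a \<Rightarrow> real" where
  "orth_proj M V f = (SOME p. p \<in> V \<and> (\<forall>v\<in>V. L2_inner M (\<lambda>x. f x - p x) v = 0))"

definition partial :: "'a::euclidean_space \<Rightarrow> ('a \<Rightarrow> real) \<Rightarrow> 'a \<Rightarrow> real" where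
  "partial i f x = frechet_derivative f (at x) i"

definition classical_lap :: "('a::euclidean_space \<Rightarrow> real) \<Rightarrow> 'a \<Rightarrow> real" where
  "classical_lap f x = (\<Sum>i\<in>Basis. partial i (partial i f) x)"

(* Intended for open S. *)
primrec Ck_on :: "nat \<Rightarrow> 'a::euclidean_space set \<Rightarrow> ('a \<Rightarrow> real) \<Rightarrow> bool" where
  "Ck_on 0 S f \<longleftrightarrow> continuous_on S f"
| "Ck_on (Suc k) S f \<longleftrightarrow>
     (\<forall>x\<in>S. f differentiable (at x)) \<and> (\<forall>i\<in>Basis. Ck_on k S (partial i f))"

definition smooth_on :: "'a::euclidean_space set \<Rightarrow> ('a \<Rightarrow> real) \<Rightarrow> bool" where
  "smooth_on S f \<longleftrightarrow> (\<forall>k. Ck_on k S f)"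

definition compact_support_in :: "'a::euclidean_space set \<Rightarrow> ('a \<Rightarrow> real) \<Rightarrow> bool" where
  "compact_support_in \<Omega> f \<longleftrightarrow>
     compact (closure {x. f x \<noteq> 0}) \<and> closure {x. f x \<noteq> 0} \<subseteq> \<Omega>"

definition Cck :: "nat \<Rightarrow> 'a::euclidean_space set \<Rightarrow> ('a \<Rightarrow> real) set" where
  "Cck k \<Omega> = {f. Ck_on k UNIV f \<and> compact_support_in \<Omega> f}"

definition Cc_inf :: "'a::euclidean_space set \<Rightarrow> ('a \<Rightarrow> real) set" where
  "Cc_inf \<Omega> = {f. smooth_on UNIV f \<and> compact_support_in \<Omega> f}"

definition is_weak_grad ::
    "'a::euclidean_space set \<Rightarrow> ('a \<Rightarrow> real) \<Rightarrow> ('a \<Rightarrow> 'a) \<Rightarrow> bool" where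
  "is_weak_grad \<Omega> u G \<longleftrightarrow>
     (\<forall>i\<in>Basis. (\<lambda>x. G x \<bullet> i) \<in> L2 (lebesgue_on \<Omega>) \<and>
        (\<forall>\<phi>\<in>Cc_inf \<Omega>. (\<integral>x. u x * partial i \<phi> x \<partial>lebesgue_on \<Omega>) =
                      - (\<integral>x. (G x \<bullet> i) * \<phi> x \<partial>lebesgue_on \<Omega>)))"

definition weak_grad :: "'a::euclidean_space set \<Rightarrow> ('a \<Rightarrow> real) \<Rightarrow> 'a \<Rightarrow> 'a" where
  "weak_grad \<Omega> u = (SOME G. is_weak_grad \<Omega> u G)"

definition is_weak_lap ::
    "'a::euclidean_space set \<Rightarrow> ('a \<Rightarrow> real) \<Rightarrow> ('a \<Rightarrow> real) \<Rightarrow> bool" where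
  "is_weak_lap \<Omega> u w \<longleftrightarrow> w \<in> L2 (lebesgue_on \<Omega>) \<and>
     (\<forall>\<phi>\<in>Cc_inf \<Omega>. (\<integral>x. u x * classical_lap \<phi> x \<partial>lebesgue_on \<Omega>) =
                   (\<integral>x. w x * \<phi> x \<partial>lebesgue_on \<Omega>))"

definition weak_lap :: "'a::euclidean_space set \<Rightarrow> ('a \<Rightarrow> real) \<Rightarrow> 'a \<Rightarrow> real" where
  "weak_lap \<Omega> u = (SOME w. is_weak_lap \<Omega> u w)"

definition H1 :: "'a::euclidean_space set \<Rightarrow> ('a \<Rightarrow> real) set" where
  "H1 \<Omega> = {u \<in> L2 (lebesgue_on \<Omega>). \<exists>G. is_weak_grad \<Omega> u G}"

definition H1_norm :: "'a::euclidean_space set \<Rightarrow> ('a \<Rightarrow> real) \<Rightarrow> real" where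
  "H1_norm \<Omega> u = sqrt (\<integral>x. (u x)\<^sup>2 + (norm (weak_grad \<Omega> u x))\<^sup>2 \<partial>lebesgue_on \<Omega>)"

definition H1_tendsto ::
    "'a::euclidean_space set \<Rightarrow> (nat \<Rightarrow> 'a \<Rightarrow> real) \<Rightarrow> ('a \<Rightarrow> real) \<Rightarrow> bool" where
  "H1_tendsto \<Omega> F f \<longleftrightarrow>
     (\<forall>n. F n \<in> H1 \<Omega>) \<and> f \<in> H1 \<Omega> \<and> (\<lambda>n. H1_norm \<Omega> (\<lambda>x. F n x - f x)) \<longlonglongrightarrow> 0"

definition H10 :: "'a::euclidean_space set \<Rightarrow> ('a \<Rightarrow> real) set" where
  "H10 \<Omega> = {u. \<exists>\<phi>. (\<forall>n. \<phi> n \<in> Cc_inf \<Omega>) \<and> H1_tendsto \<Omega> \<phi> u}"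

definition H0_lap :: "'a::euclidean_space set \<Rightarrow> ('a \<Rightarrow> real) set" where
  "H0_lap \<Omega> = {u \<in> H10 \<Omega>. \<exists>w. is_weak_lap \<Omega> u w}"

definition lap_inner :: "'a::euclidean_space set \<Rightarrow> ('a \<Rightarrow> real) \<Rightarrow> ('a \<Rightarrow> real) \<Rightarrow> real" where
  "lap_inner \<Omega> u v = (\<integral>x. weak_lap \<Omega> u x * weak_lap \<Omega> v x \<partial>lebesgue_on \<Omega>)"

definition lap_norm :: "'a::euclidean_space set \<Rightarrow> ('a \<Rightarrow> real) \<Rightarrow> real" where
  "lap_norm \<Omega> u = sqrt (lap_inner \<Omega> u u)"

text \<open>
  Hausdorff outer measure of dimension \<open>s > 0\<close>, normalised by the volume of the unit ball so that
  it agrees with surface area.  Covering sets are required to be bounded because \<^const>\<open>diameter\<close>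
  is unspecified on unbounded sets.
\<close>

definition hausdorff_outer :: "real \<Rightarrow> 'a::euclidean_space set \<Rightarrow> ennreal" where
  "hausdorff_outer s A =
     (SUP \<delta>\<in>{0<..}. INF C\<in>{C :: nat \<Rightarrow> 'a set.
          A \<subseteq> (\<Union>j. C j) \<and> (\<forall>j. bounded (C j) \<and> diameter (C j) \<le> \<delta>)}.
        \<Sum>j. ennreal (unit_ball_vol s * (diameter (C j) / 2) powr s))"

(* hausdorff_outer s is a metric outer measure, hence countably additive on the Borel sets, so the
   default case of measure_of does not arise. *)
definition hausdorff_measure :: "real \<Rightarrow> 'a::euclidean_space measure" where
  "hausdorff_measure s = measure_of UNIV (sets borel) (hausdorff_outer s)"

definition surface_measure :: "'a::euclidean_space set \<Rightarrow> 'a measure" where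
  "surface_measure \<Omega> =
     restrict_space (hausdorff_measure (real DIM('a) - 1)) (frontier \<Omega>)"

definition region :: "'a::euclidean_space set \<Rightarrow> bool" where
  "region \<Omega> \<longleftrightarrow> \<Omega> \<noteq> {} \<and> open \<Omega> \<and> connected \<Omega>"

text \<open>
  Near each of its points, a closed Lipschitz boundary surface \<open>S\<close> of \<open>\<Omega>\<close> is the graph, over the
  hyperplane orthogonal to a unit vector \<open>e\<close>, of a Lipschitz function \<open>g\<close>, and \<open>\<Omega>\<close> lies on the
  side above the graph (so \<open>-e\<close> points outwards).  Having such a description at every point of
  the closed set \<open>S\<close> means that \<open>S\<close> has no boundary as a surface.
\<close>

definition closed_lipschitz_surface :: "'a::euclidean_space set \<Rightarrow> 'a set \<Rightarrow> bool" where
  "closed_lipschitz_surface \<Omega> S \<longleftrightarrow> closed S \<and> connected S \<and>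
     (\<forall>x\<in>S. \<exists>e g L r. norm e = 1 \<and> L-lipschitz_on {z. z \<bullet> e = 0} (g :: 'a \<Rightarrow> real) \<and> 0 < r \<and>
        (\<forall>y\<in>ball x r.
           (y \<in> S \<longleftrightarrow> y \<bullet> e = g (y - (y \<bullet> e) *\<^sub>R e)) \<and>
           (y \<in> \<Omega> \<longleftrightarrow> g (y - (y \<bullet> e) *\<^sub>R e) < y \<bullet> e)))"

definition B1 :: "'a::euclidean_space set \<Rightarrow> bool" where
  "B1 \<Omega> \<longleftrightarrow> bounded \<Omega> \<and>
     (\<exists>\<S>. finite \<S> \<and> disjoint \<S> \<and> frontier \<Omega> = \<Union>\<S> \<and>
        (\<forall>S\<in>\<S>. closed_lipschitz_surface \<Omega> S \<and>
                emeasure (hausdorff_measure (real DIM('a) - 1)) S < \<infinity>))"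

text \<open>
  The trace on \<open>H\<^sup>1(\<Omega>)\<close> is the closure, in \<open>H\<^sup>1(\<Omega>) \<times> L\<^sup>2(\<partial>\<Omega>, d\<sigma>)\<close>, of the restriction to \<open>\<partial>\<Omega>\<close>
  of functions that are smooth on the whole space; \<open>is_trace \<Omega> u g\<close> says that \<open>g\<close> represents
  \<open>\<gamma>(u)\<close>.  When \<open>B1 \<Omega>\<close> holds, \<open>\<gamma>(u)\<close> exists and is unique for every \<open>u\<close> in \<open>H\<^sup>1(\<Omega>)\<close>.
\<close>

definition is_trace ::
    "'a::euclidean_space set \<Rightarrow> ('a \<Rightarrow> real) \<Rightarrow> ('a \<Rightarrow> real) \<Rightarrow> bool" where
  "is_trace \<Omega> u g \<longleftrightarrow>
     (\<exists>\<phi>. (\<forall>n. smooth_on UNIV (\<phi> n)) \<and> H1_tendsto \<Omega> \<phi> u \<and>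
          L2_tendsto (surface_measure \<Omega>) \<phi> g)"

definition is_normal_deriv ::
    "'a::euclidean_space set \<Rightarrow> ('a \<Rightarrow> real) \<Rightarrow> ('a \<Rightarrow> real) \<Rightarrow> bool" where
  "is_normal_deriv \<Omega> u w \<longleftrightarrow> w \<in> L2 (surface_measure \<Omega>) \<and>
     (\<forall>v\<in>H1 \<Omega>. \<forall>g. is_trace \<Omega> v g \<longrightarrow>
        (\<integral>x. g x * w x \<partial>surface_measure \<Omega>) =
        (\<integral>x. weak_grad \<Omega> u x \<bullet> weak_grad \<Omega> v x + v x * weak_lap \<Omega> u x \<partial>lebesgue_on \<Omega>))"

definition normal_deriv :: "'a::euclidean_space set \<Rightarrow> ('a \<Rightarrow> real) \<Rightarrow> 'a \<Rightarrow> real" where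
  "normal_deriv \<Omega> u = (SOME w. is_normal_deriv \<Omega> u w)"

(* The second conjunct says that the normal derivative is a mapping into L2 of the boundary, the
   third that this linear mapping is compact. *)
definition B2 :: "'a::euclidean_space set \<Rightarrow> bool" where
  "B2 \<Omega> \<longleftrightarrow> B1 \<Omega> \<and>
     (\<forall>u\<in>H0_lap \<Omega>. \<exists>w. is_normal_deriv \<Omega> u w) \<and>
     (\<forall>u :: nat \<Rightarrow> 'a \<Rightarrow> real. (\<forall>n. u n \<in> H0_lap \<Omega>) \<and> (\<exists>K. \<forall>n. lap_norm \<Omega> (u n) \<le> K) \<longrightarrow>
        (\<exists>r w. strict_mono (r :: nat \<Rightarrow> nat) \<and>
           L2_tendsto (surface_measure \<Omega>) (\<lambda>n. normal_deriv \<Omega> (u (r n))) w))"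

definition DBS_eigenpair :: "'a::euclidean_space set \<Rightarrow> real \<Rightarrow> ('a \<Rightarrow> real) \<Rightarrow> bool" where
  "DBS_eigenpair \<Omega> q b \<longleftrightarrow>
     b \<in> H0_lap \<Omega> \<and> \<not> (AE x in lebesgue_on \<Omega>. b x = 0) \<and>
     (\<forall>v\<in>H0_lap \<Omega>. (\<integral>x. weak_lap \<Omega> b x * weak_lap \<Omega> v x \<partial>lebesgue_on \<Omega>) =
        q * (\<integral>x. normal_deriv \<Omega> b x * normal_deriv \<Omega> v x \<partial>surface_measure \<Omega>))"

definition DBS_eigenfunction :: "'a::euclidean_space set \<Rightarrow> ('a \<Rightarrow> real) \<Rightarrow> bool" where
  "DBS_eigenfunction \<Omega> b \<longleftrightarrow> (\<exists>q. DBS_eigenpair \<Omega> q b)"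

definition boundary_energy :: "'a::euclidean_space set \<Rightarrow> ('a \<Rightarrow> real) \<Rightarrow> real" where
  "boundary_energy \<Omega> u = (\<integral>x. (normal_deriv \<Omega> u x)\<^sup>2 \<partial>surface_measure \<Omega>)"

definition constraint_set ::
    "'a::euclidean_space set \<Rightarrow> (nat \<Rightarrow> 'a \<Rightarrow> real) \<Rightarrow> nat \<Rightarrow> ('a \<Rightarrow> real) set" where
  "constraint_set \<Omega> b k =
     {u \<in> H0_lap \<Omega>. lap_norm \<Omega> u \<le> 1 \<and> (\<forall>j\<in>{1..<k}. lap_inner \<Omega> u (b j) = 0)}"

(* Sequences are indexed from 1; the value at index 0 is irrelevant. *)
definition DBS_construction :: "'a::euclidean_space set \<Rightarrow> (nat \<Rightarrow> 'a \<Rightarrow> real) \<Rightarrow> bool" where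
  "DBS_construction \<Omega> b \<longleftrightarrow>
     (\<forall>k\<ge>1. b k \<in> constraint_set \<Omega> b k \<and>
        (\<forall>u\<in>constraint_set \<Omega> b k. boundary_energy \<Omega> u \<le> boundary_energy \<Omega> (b k)))"

definition lap_orthonormal :: "'a::euclidean_space set \<Rightarrow> (nat \<Rightarrow> 'a \<Rightarrow> real) \<Rightarrow> bool" where
  "lap_orthonormal \<Omega> b \<longleftrightarrow>
     (\<forall>i\<ge>1. \<forall>j\<ge>1. lap_inner \<Omega> (b i) (b j) = (if i = j then 1 else 0))"

definition L2H :: "'a::euclidean_space set \<Rightarrow> ('a \<Rightarrow> real) set" where
  "L2H \<Omega> = {u \<in> L2 (lebesgue_on \<Omega>).
     \<forall>v\<in>Cck 2 \<Omega>. (\<integral>x. u x * classical_lap v x \<partial>lebesgue_on \<Omega>) = 0}"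

definition harmonic_proj :: "'a::euclidean_space set \<Rightarrow> ('a \<Rightarrow> real) \<Rightarrow> 'a \<Rightarrow> real" where
  "harmonic_proj \<Omega> = orth_proj (lebesgue_on \<Omega>) (L2H \<Omega>)"

definition H_kernel :: "(nat \<Rightarrow> 'a \<Rightarrow> real) \<Rightarrow> nat \<Rightarrow> 'a \<Rightarrow> 'a \<Rightarrow> real" where
  "H_kernel h M x y = (\<Sum>j=1..M. h j x * h j y)"

definition H_operator ::
    "'a::euclidean_space set \<Rightarrow> (nat \<Rightarrow> 'a \<Rightarrow> real) \<Rightarrow> nat \<Rightarrow> ('a \<Rightarrow> real) \<Rightarrow> 'a \<Rightarrow> real" where
  "H_operator \<Omega> h M f x = (\<integral>y. H_kernel h M x y * f y \<partial>lebesgue_on \<Omega>)"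

end

theory Submission
  imports Defs
begin

text \<open>
  Why the theorem holds.  Let \<open>h\<^sub>j = \<Delta>b\<^sub>j\<close>.  Orthonormality of the \<open>h\<^sub>j\<close> in \<open>L\<^sup>2\<close> is the
  \<open>\<Delta>\<close>-orthonormality of the \<open>b\<^sub>j\<close>, and \<open>h\<^sub>j\<close> is weakly harmonic because the boundary side of the
  eigenvalue equation vanishes on test functions (\<open>eigenfunction_lap_in_L2H\<close>).  Once it is known that
  an \<open>f\<close> in the harmonic Bergman space that is orthogonal to all \<open>h\<^sub>j\<close> vanishes
  (\<open>DBS_laplacians_complete\<close>), maximality is immediate and the expansion of the projection is the
  usual Hilbert space argument (\<open>orth_proj_expansion\<close>).

  For completeness, solve \<open>\<Delta>u = f\<close> with \<open>u \<in> H\<^sub>0\<^sup>1\<close> (\<open>Dirichlet_problem_solvable\<close>), where \<open>f\<close> has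
  norm \<open>1\<close>.  Then \<open>a(u, b\<^sub>j) = \<langle>f, h\<^sub>j\<rangle> = 0\<close> for all \<open>j\<close>, so \<open>u\<close> competes in each of the maximisation
  problems and \<open>\<M>(u) \<le> \<beta>\<^sub>k\<close> for all \<open>k\<close>.  Compactness of the normal derivative forces \<open>\<beta>\<^sub>k \<rightarrow> 0\<close>
  (\<open>boundary_energy_bound_nonpos\<close>), hence \<open>D\<^sub>\<nu>u = 0\<close>.  Thus both Cauchy data of \<open>u\<close> vanish and the
  extension of \<open>u\<close> by zero solves \<open>\<Delta>u = f\<close> on the whole space.  On a Lipschitz domain the localised
  pieces \<open>\<eta>u\<close> can be pushed into the domain by small translations and mollified, and the results
  are test functions whose Laplacians approximate \<open>\<Delta>(\<eta>u)\<close>.  A weakly harmonic \<open>f\<close> is orthogonal to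
  all of these, so summing over the pieces gives \<open>\<langle>f, f\<rangle> = \<langle>f, \<Delta>u\<rangle> = 0\<close>
  (\<open>harmonic_with_zero_Cauchy_data\<close>), a contradiction.

  Existence of \<open>u\<close> and density of the test functions both come from one fact: a bounded functional on
  an incomplete inner product space is represented by a Cauchy sequence that minimises a quadratic
  functional (\<open>Riesz_minimising_sequence\<close>).  Combined with the completeness of \<open>L\<^sup>2\<close> and the
  fundamental lemma of the calculus of variations, this yields the density statement, and with the
  Poincare inequality the solution of the Dirichlet problem.
\<close>

section \<open>Square-integrable functions\<close>

lemma L2_measurable: "f \<in> L2 M \<Longrightarrow> f \<in> borel_measurable M"
  by (simp add: L2_def)

lemma L2_square_integrable: "f \<in> L2 M \<Longrightarrow> integrable M (\<lambda>x. (f x)\<^sup>2)"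
  by (simp add: L2_def)

lemma L2_mult_integrable:
  assumes "f \<in> L2 M" "g \<in> L2 M"
  shows "integrable M (\<lambda>x. f x * g x)"
proof (rule Bochner_Integration.integrable_bound)
  show "integrable M (\<lambda>x. (f x)\<^sup>2 + (g x)\<^sup>2)"
    using assms by (auto simp: L2_def)
  show "(\<lambda>x. f x * g x) \<in> borel_measurable M"
    using assms by (auto simp: L2_def)
  have "\<bar>a * b\<bar> \<le> a\<^sup>2 + b\<^sup>2" for a b :: real
  proof -
    have "2 * (\<bar>a\<bar> * \<bar>b\<bar>) \<le> a\<^sup>2 + b\<^sup>2"
      using sum_squares_bound[of "\<bar>a\<bar>" "\<bar>b\<bar>"] by simp
    moreover have "0 \<le> \<bar>a\<bar> * \<bar>b\<bar>" by simp
    ultimately show ?thesis unfolding abs_mult by linarith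
  qed
  then show "AE x in M. norm (f x * g x) \<le> norm ((f x)\<^sup>2 + (g x)\<^sup>2)"
    by simp
qed

lemma L2_zero [simp]: "(\<lambda>x. 0) \<in> L2 M"
  by (simp add: L2_def)

lemma L2_axpy:
  assumes "f \<in> L2 M" "g \<in> L2 M"
  shows "(\<lambda>x. f x + c * g x) \<in> L2 M"
proof -
  have "(\<lambda>x. (f x + c * g x)\<^sup>2) = (\<lambda>x. (f x)\<^sup>2 + (2 * c * (f x * g x) + c\<^sup>2 * (g x)\<^sup>2))"
    by (rule ext) (simp add: power2_eq_square algebra_simps)
  moreover have "integrable M (\<lambda>x. (f x)\<^sup>2 + (2 * c * (f x * g x) + c\<^sup>2 * (g x)\<^sup>2))"
    using L2_square_integrable[OF assms(1)] L2_square_integrable[OF assms(2)] L2_mult_integrable[OF assms]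
    by (intro Bochner_Integration.integrable_add integrable_mult_right)
  moreover have "(\<lambda>x. f x + c * g x) \<in> borel_measurable M"
    using assms[THEN L2_measurable] by measurable
  ultimately show ?thesis unfolding L2_def mem_Collect_eq by metis
qed

lemma L2_add: "f \<in> L2 M \<Longrightarrow> g \<in> L2 M \<Longrightarrow> (\<lambda>x. f x + g x) \<in> L2 M"
  using L2_axpy[of f M g 1] by simp

lemma L2_diff: "f \<in> L2 M \<Longrightarrow> g \<in> L2 M \<Longrightarrow> (\<lambda>x. f x - g x) \<in> L2 M"
  using L2_axpy[of f M g "-1"] by simp

lemma L2_cmult: "g \<in> L2 M \<Longrightarrow> (\<lambda>x. c * g x) \<in> L2 M"
  using L2_axpy[of "\<lambda>x. 0" M g c] by simp

lemma L2_sum: "(\<And>i. i \<in> I \<Longrightarrow> f i \<in> L2 M) \<Longrightarrow> (\<lambda>x. \<Sum>i\<in>I. f i x) \<in> L2 M"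
proof (induction I rule: infinite_finite_induct)
  case (insert i I)
  then have "(\<lambda>x. f i x + (\<Sum>i\<in>I. f i x)) \<in> L2 M" by (intro L2_add) simp_all
  then show ?case using insert by simp
qed simp_all

lemma L2_bounded_mult:
  assumes "f \<in> L2 M" "g \<in> borel_measurable M" "\<And>x. x \<in> space M \<Longrightarrow> \<bar>g x\<bar> \<le> C"
  shows "(\<lambda>x. f x * g x) \<in> L2 M"
proof -
  have "integrable M (\<lambda>x. (f x * g x)\<^sup>2)"
  proof (rule Bochner_Integration.integrable_bound)
    show "integrable M (\<lambda>x. C\<^sup>2 * (f x)\<^sup>2)"
      using assms by (auto simp: L2_def)
    show "(\<lambda>x. (f x * g x)\<^sup>2) \<in> borel_measurable M"
      using assms by (auto simp: L2_def)
    show "AE x in M. norm ((f x * g x)\<^sup>2) \<le> norm (C\<^sup>2 * (f x)\<^sup>2)"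
    proof (rule AE_I2)
      fix x assume "x \<in> space M"
      then have "\<bar>g x\<bar> \<le> C" by (rule assms(3))
      then have "(g x)\<^sup>2 \<le> C\<^sup>2"
        by (metis abs_ge_zero power2_abs power_mono)
      then show "norm ((f x * g x)\<^sup>2) \<le> norm (C\<^sup>2 * (f x)\<^sup>2)"
        by (simp add: power_mult_distrib mult.commute[of "(f x)\<^sup>2"] mult_right_mono)
    qed
  qed
  then show ?thesis using assms by (auto simp: L2_def)
qed

lemma (in finite_measure) bounded_in_L2:
  assumes "g \<in> borel_measurable M" "\<And>x. x \<in> space M \<Longrightarrow> \<bar>g x\<bar> \<le> C"
  shows "g \<in> L2 M"
  using L2_bounded_mult[of "\<lambda>x. 1" M g C] assms by (simp add: L2_def)

lemma (in finite_measure) L2_integrable: "f \<in> L2 M \<Longrightarrow> integrable M f"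
  using L2_mult_integrable[of f M "\<lambda>x. 1"] by (simp add: L2_def)

lemma L2_inner_commute: "L2_inner M f g = L2_inner M g f"
  by (simp add: L2_inner_def mult.commute)

lemma L2_inner_axpy:
  assumes "f \<in> L2 M" "g \<in> L2 M" "k \<in> L2 M"
  shows "L2_inner M (\<lambda>x. f x + c * g x) k = L2_inner M f k + c * L2_inner M g k"
proof -
  have "(\<lambda>x. (f x + c * g x) * k x) = (\<lambda>x. f x * k x + c * (g x * k x))"
    by (auto simp: algebra_simps)
  then show ?thesis
    using L2_mult_integrable[OF assms(1,3)] L2_mult_integrable[OF assms(2,3)]
    by (simp add: L2_inner_def)
qed

lemma L2_inner_axpy_right:
  assumes "f \<in> L2 M" "g \<in> L2 M" "k \<in> L2 M"
  shows "L2_inner M k (\<lambda>x. f x + c * g x) = L2_inner M k f + c * L2_inner M k g"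
  using L2_inner_axpy[OF assms] by (simp add: L2_inner_commute[of M k])

lemma L2_inner_diff:
  assumes "f \<in> L2 M" "g \<in> L2 M" "k \<in> L2 M"
  shows "L2_inner M (\<lambda>x. f x - g x) k = L2_inner M f k - L2_inner M g k"
  using L2_inner_axpy[OF assms, of "-1"] by simp

lemma L2_inner_diff_right:
  assumes "f \<in> L2 M" "g \<in> L2 M" "k \<in> L2 M"
  shows "L2_inner M k (\<lambda>x. f x - g x) = L2_inner M k f - L2_inner M k g"
  using L2_inner_axpy_right[OF assms, of "-1"] by simp

lemma L2_inner_sum:
  assumes "\<And>i. i \<in> I \<Longrightarrow> f i \<in> L2 M" "k \<in> L2 M"
  shows "L2_inner M (\<lambda>x. \<Sum>i\<in>I. c i * f i x) k = (\<Sum>i\<in>I. c i * L2_inner M (f i) k)"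
proof -
  have "(\<lambda>x. (\<Sum>i\<in>I. c i * f i x) * k x) = (\<lambda>x. \<Sum>i\<in>I. c i * (f i x * k x))"
    by (simp add: sum_distrib_right mult.assoc)
  then show ?thesis
    using L2_mult_integrable[OF assms] by (simp add: L2_inner_def)
qed

lemma L2_inner_self_nonneg: "0 \<le> L2_inner M f f"
  by (simp add: L2_inner_def integral_nonneg_AE)

lemma L2_inner_self_eq_0:
  assumes "f \<in> L2 M" "L2_inner M f f = 0"
  shows "AE x in M. f x = 0"
  using assms integral_nonneg_eq_0_iff_AE[of M "\<lambda>x. (f x)\<^sup>2"]
  by (auto simp: L2_inner_def L2_def power2_eq_square)

lemma L2_inner_cong_AE:
  assumes "f \<in> borel_measurable M" "f' \<in> borel_measurable M"
    "g \<in> borel_measurable M" "g' \<in> borel_measurable M"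
    "AE x in M. f x = f' x" "AE x in M. g x = g' x"
  shows "L2_inner M f g = L2_inner M f' g'"
  unfolding L2_inner_def using assms by (intro integral_cong_AE) auto

lemma L2_cong_AE:
  assumes "f \<in> L2 M" "g \<in> borel_measurable M" "AE x in M. g x = f x"
  shows "g \<in> L2 M"
proof -
  have "integrable M (\<lambda>x. (g x)\<^sup>2) = integrable M (\<lambda>x. (f x)\<^sup>2)"
    using assms by (intro integrable_cong_AE) (auto simp: L2_def)
  then show ?thesis using assms by (simp add: L2_def)
qed

lemma L2_norm_power2: "(L2_norm M f)\<^sup>2 = L2_inner M f f"
  by (simp add: L2_norm_def L2_inner_self_nonneg)

text \<open>The discriminant of the nonnegative quadratic polynomial \<open>t \<mapsto> \<parallel>f + t g\<parallel>\<^sup>2\<close> is not positive.\<close>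

lemma L2_Cauchy_Schwarz:
  assumes "f \<in> L2 M" "g \<in> L2 M"
  shows "\<bar>L2_inner M f g\<bar> \<le> L2_norm M f * L2_norm M g"
proof -
  let ?a = "L2_inner M f f" and ?b = "L2_inner M f g" and ?c = "L2_inner M g g"
  have q: "0 \<le> ?a + 2 * t * ?b + t\<^sup>2 * ?c" for t
  proof -
    have "0 \<le> L2_inner M (\<lambda>x. f x + t * g x) (\<lambda>x. f x + t * g x)"
      by (rule L2_inner_self_nonneg)
    also have "\<dots> = ?a + t * ?b + t * (?b + t * ?c)"
      using assms by (simp add: L2_inner_axpy L2_inner_axpy_right L2_axpy L2_inner_commute[of M g f])
    finally show ?thesis by (simp add: power2_eq_square algebra_simps)
  qed
  have "?b\<^sup>2 \<le> ?a * ?c"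
  proof (cases "?c = 0")
    case True
    have "?b = 0"
    proof (rule ccontr)
      assume "?b \<noteq> 0"
      then have "2 * (- (?a + 1) / (2 * ?b)) * ?b = - (?a + 1)" by simp
      then show False using q[of "- (?a + 1) / (2 * ?b)"] True by simp
    qed
    then show ?thesis using True by simp
  next
    case False
    then have c: "?c > 0" using L2_inner_self_nonneg[of M g] by linarith
    have "?a + 2 * (- ?b / ?c) * ?b + (- ?b / ?c)\<^sup>2 * ?c = (?a * ?c - ?b\<^sup>2) / ?c"
      using False by (simp add: field_simps power2_eq_square)
    then have "0 \<le> (?a * ?c - ?b\<^sup>2) / ?c" using q[of "- ?b / ?c"] by metis
    then show ?thesis using c by (simp add: zero_le_divide_iff)
  qed
  then have "sqrt (?b\<^sup>2) \<le> sqrt (?a * ?c)" by (rule real_sqrt_le_mono)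
  then show ?thesis by (simp add: L2_norm_def real_sqrt_mult)
qed

lemma L2_inner_diff_self:
  assumes "f \<in> L2 M" "g \<in> L2 M"
  shows "L2_inner M (\<lambda>x. f x - g x) (\<lambda>x. f x - g x) = L2_inner M f f - 2 * L2_inner M f g + L2_inner M g g"
  using assms L2_diff[OF assms]
  by (simp add: L2_inner_diff L2_inner_diff_right L2_inner_commute[of M g f])

lemma L2_inner_add_self_le:
  assumes "f \<in> L2 M" "g \<in> L2 M"
  shows "L2_inner M (\<lambda>x. f x + g x) (\<lambda>x. f x + g x) \<le> 2 * L2_inner M f f + 2 * L2_inner M g g"
proof -
  have "L2_inner M (\<lambda>x. f x + g x) (\<lambda>x. f x + g x) \<le> (\<integral>x. 2 * (f x * f x) + 2 * (g x * g x) \<partial>M)"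
    unfolding L2_inner_def
  proof (rule integral_mono)
    show "integrable M (\<lambda>x. (f x + g x) * (f x + g x))"
      by (rule L2_mult_integrable[OF L2_add[OF assms] L2_add[OF assms]])
    show "integrable M (\<lambda>x. 2 * (f x * f x) + 2 * (g x * g x))"
      using L2_mult_integrable[OF assms(1,1)] L2_mult_integrable[OF assms(2,2)] by auto
    show "(f x + g x) * (f x + g x) \<le> 2 * (f x * f x) + 2 * (g x * g x)" for x
      using sum_squares_bound[of "f x" "g x"] by (simp add: algebra_simps power2_eq_square)
  qed
  then show ?thesis
    using L2_mult_integrable[OF assms(1,1)] L2_mult_integrable[OF assms(2,2)]
    by (simp add: L2_inner_def)
qed

lemma L2_tendsto_iff:
  "L2_tendsto M F f \<longleftrightarrow> (\<forall>n. F n \<in> L2 M) \<and> f \<in> L2 M \<and>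
     (\<lambda>n. L2_inner M (\<lambda>x. F n x - f x) (\<lambda>x. F n x - f x)) \<longlonglongrightarrow> 0"
proof -
  have "(\<lambda>n. L2_norm M (\<lambda>x. F n x - f x)) \<longlonglongrightarrow> 0 \<longleftrightarrow>
    (\<lambda>n. L2_inner M (\<lambda>x. F n x - f x) (\<lambda>x. F n x - f x)) \<longlonglongrightarrow> 0" (is "?L \<longleftrightarrow> ?R")
  proof
    assume ?L
    from tendsto_power[OF this, of 2] show ?R by (simp add: L2_norm_power2)
  next
    assume ?R
    from tendsto_real_sqrt[OF this] show ?L by (simp add: L2_norm_def)
  qed
  then show ?thesis by (simp add: L2_tendsto_def)
qed

lemma L2_tendsto_inner:
  assumes "L2_tendsto M F f" "g \<in> L2 M"
  shows "(\<lambda>n. L2_inner M (F n) g) \<longlonglongrightarrow> L2_inner M f g"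
proof -
  have F: "F n \<in> L2 M" "f \<in> L2 M" for n using assms by (auto simp: L2_tendsto_def)
  have "(\<lambda>n. L2_inner M (F n) g - L2_inner M f g) \<longlonglongrightarrow> 0"
  proof (rule Lim_null_comparison)
    show "(\<lambda>n. L2_norm M (\<lambda>x. F n x - f x) * L2_norm M g) \<longlonglongrightarrow> 0"
      using assms by (auto simp: L2_tendsto_def intro: tendsto_mult_left_zero)
    show "\<forall>\<^sub>F n in sequentially. norm (L2_inner M (F n) g - L2_inner M f g)
        \<le> L2_norm M (\<lambda>x. F n x - f x) * L2_norm M g"
      using L2_Cauchy_Schwarz[OF L2_diff[OF F] assms(2)]
      by (intro always_eventually allI) (simp only: L2_inner_diff[OF F assms(2)] real_norm_def)
  qed
  then show ?thesis by (simp add: LIM_zero_iff)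
qed

definition L2_Cauchy :: "'a measure \<Rightarrow> (nat \<Rightarrow> 'a \<Rightarrow> real) \<Rightarrow> bool" where
  "L2_Cauchy M F \<longleftrightarrow> (\<forall>n. F n \<in> L2 M) \<and> 
     (\<forall>e>0. \<exists>N. \<forall>m\<ge>N. \<forall>n\<ge>N. L2_inner M (\<lambda>x. F m x - F n x) (\<lambda>x. F m x - F n x) < e)"

text \<open>
  Riesz--Fischer.  Along a subsequence the increments \<open>d\<^sub>k\<close> satisfy \<open>\<parallel>d\<^sub>k\<parallel>\<^sup>2 \<le> 4\<^sup>-\<^sup>k\<close>, hence
  \<open>\<Sum> 2\<^sup>k \<parallel>d\<^sub>k\<parallel>\<^sup>2\<close> is finite and \<open>\<Sum> 2\<^sup>k (d\<^sub>k)\<^sup>2\<close> is finite almost everywhere.  There \<open>d\<^sub>k\<close> decays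
  geometrically, so the subsequence converges, and Fatou's lemma identifies the limit.
\<close>

theorem L2_complete:
  assumes "L2_Cauchy M F"
  obtains f where "L2_tendsto M F f"
proof -
  let ?D = "\<lambda>m n. L2_inner M (\<lambda>x. F m x - F n x) (\<lambda>x. F m x - F n x)"
  have F: "F n \<in> L2 M" for n using assms by (simp add: L2_Cauchy_def)
  have [measurable]: "F n \<in> borel_measurable M" for n using F L2_measurable by blast
  have D_int: "integrable M (\<lambda>x. (F m x - F n x)\<^sup>2)" for m n
    using L2_square_integrable[OF L2_diff[OF F F]] .
  have D_nn: "(\<integral>\<^sup>+x. ennreal ((F m x - F n x)\<^sup>2) \<partial>M) = ennreal (?D m n)" for m n
    using D_int by (simp add: nn_integral_eq_integral L2_inner_def power2_eq_square)
  have C: "\<exists>N. \<forall>m\<ge>N. \<forall>n\<ge>N. ?D m n < e" if "e > 0" for e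
    using assms that by (auto simp: L2_Cauchy_def)
  obtain N where N: "\<And>k m n. m \<ge> N k \<Longrightarrow> n \<ge> N k \<Longrightarrow> ?D m n < (1/4) ^ k"
    using C[of "(1/4) ^ _"] by (simp, metis)
  \<comment> \<open>The summand \<open>k\<close> makes \<open>r\<close> unbounded even if the thresholds \<open>N\<close> are not.\<close>
  define r where "r k = (\<Sum>i\<le>k. N i) + k" for k
  have rN: "r k \<ge> N k" for k
    unfolding r_def by (metis atMost_iff finite_atMost le_add1 le_refl le_trans member_le_sum zero_le)
  have rS: "r (Suc k) \<ge> N k" for k
    using rN[of k] unfolding r_def by simp
  have rk: "r k \<ge> k" for k by (simp add: r_def)
  define d where "d k x = F (r (Suc k)) x - F (r k) x" for k x
  have [measurable]: "d k \<in> borel_measurable M" for k unfolding d_def by measurable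
  have "(\<integral>\<^sup>+x. (\<Sum>k. ennreal (2 ^ k * (d k x)\<^sup>2)) \<partial>M) = (\<Sum>k. \<integral>\<^sup>+x. ennreal (2 ^ k * (d k x)\<^sup>2) \<partial>M)"
    by (rule nn_integral_suminf) measurable
  also have "\<dots> \<le> (\<Sum>k. ennreal ((1/2) ^ k))"
  proof (rule suminf_le)
    fix k
    have "(\<integral>\<^sup>+x. ennreal (2 ^ k * (d k x)\<^sup>2) \<partial>M) = ennreal (2 ^ k * ?D (r (Suc k)) (r k))"
      using D_nn[of "r (Suc k)" "r k"]
      by (simp add: ennreal_mult nn_integral_cmult d_def L2_inner_self_nonneg)
    also have "\<dots> \<le> ennreal (2 ^ k * (1/4) ^ k)"
      using N[OF rS rN, of k] by (intro ennreal_leI mult_left_mono) auto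
    also have "(2::real) ^ k * (1/4) ^ k = (1/2) ^ k"
      by (simp add: power_mult_distrib[symmetric])
    finally show "(\<integral>\<^sup>+x. ennreal (2 ^ k * (d k x)\<^sup>2) \<partial>M) \<le> ennreal ((1/2) ^ k)" .
  qed auto
  also have "\<dots> < \<infinity>"
    by (subst suminf_ennreal2) (auto simp: summable_geometric)
  finally have "AE x in M. (\<Sum>k. ennreal (2 ^ k * (d k x)\<^sup>2)) \<noteq> \<infinity>"
    by (intro nn_integral_noteq_infinite) auto
  then have conv: "AE x in M. convergent (\<lambda>k. F (r k) x)"
  proof eventually_elim
    fix x assume "(\<Sum>k. ennreal (2 ^ k * (d k x)\<^sup>2)) \<noteq> \<infinity>"
    then have "summable (\<lambda>k. 2 ^ k * (d k x)\<^sup>2)"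
      by (intro summable_suminf_not_top) auto
    then have "(\<lambda>k. 2 ^ k * (d k x)\<^sup>2) \<longlonglongrightarrow> 0" by (rule summable_LIMSEQ_zero)
    then have ev: "\<forall>\<^sub>F k in sequentially. 2 ^ k * (d k x)\<^sup>2 < 1"
      by (rule order_tendstoD) simp
    have "summable (\<lambda>k. d k x)"
    proof (rule summable_comparison_test_ev)
      show "summable (\<lambda>k. (sqrt (1/2)) ^ k)" by (rule summable_geometric) auto
      show "\<forall>\<^sub>F k in sequentially. norm (d k x) \<le> (sqrt (1/2)) ^ k"
        using ev
      proof eventually_elim
        fix k assume "2 ^ k * (d k x)\<^sup>2 < 1"
        then have "(d k x)\<^sup>2 \<le> (1/2) ^ k" by (simp add: field_simps)
        then have "\<bar>d k x\<bar> \<le> sqrt ((1/2) ^ k)" by (metis real_sqrt_abs real_sqrt_le_mono)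
        then show "norm (d k x) \<le> (sqrt (1/2)) ^ k" by (simp only: real_sqrt_power real_norm_def)
      qed
    qed
    then have "convergent (\<lambda>n. \<Sum>k<n. d k x)"
      by (simp add: summable_iff_convergent)
    moreover have "(\<lambda>n. \<Sum>k<n. d k x) = (\<lambda>n. F (r n) x - F (r 0) x)"
      unfolding d_def by (rule ext) (rule sum_lessThan_telescope)
    ultimately show "convergent (\<lambda>k. F (r k) x)"
      using convergent_diff_const_right_iff by fastforce
  qed
  define f where "f x = lim (\<lambda>k. F (r k) x)" for x
  have [measurable]: "f \<in> borel_measurable M"
    unfolding f_def by measurable
  have lim: "AE x in M. (\<lambda>k. F (r k) x) \<longlonglongrightarrow> f x"
    using conv unfolding f_def by eventually_elim (simp add: convergent_LIMSEQ_iff)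
  have bound: "(\<integral>\<^sup>+x. ennreal ((F n x - f x)\<^sup>2) \<partial>M) \<le> ennreal e" 
    if n: "\<And>m. m \<ge> n0 \<Longrightarrow> ?D n m \<le> e" for n n0 e
  proof -
    have "(\<integral>\<^sup>+x. ennreal ((F n x - f x)\<^sup>2) \<partial>M) = (\<integral>\<^sup>+x. liminf (\<lambda>k. ennreal ((F n x - F (r k) x)\<^sup>2)) \<partial>M)"
    proof (rule nn_integral_cong_AE)
      show "AE x in M. ennreal ((F n x - f x)\<^sup>2) = liminf (\<lambda>k. ennreal ((F n x - F (r k) x)\<^sup>2))"
        using lim
      proof eventually_elim
        fix x assume "(\<lambda>k. F (r k) x) \<longlonglongrightarrow> f x"
        then have "(\<lambda>k. ennreal ((F n x - F (r k) x)\<^sup>2)) \<longlonglongrightarrow> ennreal ((F n x - f x)\<^sup>2)"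
          by (intro tendsto_ennrealI tendsto_power tendsto_diff tendsto_const)
        then show "ennreal ((F n x - f x)\<^sup>2) = liminf (\<lambda>k. ennreal ((F n x - F (r k) x)\<^sup>2))"
          by (rule lim_imp_Liminf[symmetric, OF trivial_limit_sequentially])
      qed
    qed
    also have "\<dots> \<le> liminf (\<lambda>k. \<integral>\<^sup>+x. ennreal ((F n x - F (r k) x)\<^sup>2) \<partial>M)"
      by (rule nn_integral_liminf) measurable
    also have "\<dots> = liminf (\<lambda>k. ennreal (?D n (r k)))" by (simp only: D_nn)
    also have "\<dots> \<le> liminf (\<lambda>k. ennreal e)"
    proof (rule Liminf_mono)
      show "\<forall>\<^sub>F k in sequentially. ennreal (?D n (r k)) \<le> ennreal e"
        using eventually_ge_at_top[of n0]
      proof eventually_elim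
        case (elim k)
        then show ?case using n[of "r k"] rk[of k] by (intro ennreal_leI) simp
      qed
    qed
    finally show ?thesis by (simp add: Liminf_const)
  qed
  \<comment> \<open>One function of the sequence at finite distance from \<open>f\<close> puts \<open>f\<close> into \<open>L\<^sup>2\<close>.\<close>
  obtain n1 where n1: "\<And>m n. m \<ge> n1 \<Longrightarrow> n \<ge> n1 \<Longrightarrow> ?D m n < 1" using C[of 1] by auto
  have "(\<integral>\<^sup>+x. ennreal ((F n1 x - f x)\<^sup>2) \<partial>M) < \<infinity>"
    using bound[of n1 n1 1] n1[of n1] by (force simp: less_imp_le intro: le_less_trans)
  then have "integrable M (\<lambda>x. (F n1 x - f x)\<^sup>2)"
    by (intro integrableI_bounded) auto
  then have "(\<lambda>x. F n1 x - f x) \<in> L2 M" by (simp add: L2_def)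
  from L2_diff[OF F[of n1] this] have f: "f \<in> L2 M" by simp
  have "(\<lambda>n. L2_inner M (\<lambda>x. F n x - f x) (\<lambda>x. F n x - f x)) \<longlonglongrightarrow> 0"
  proof (rule LIMSEQ_I)
    fix e :: real assume e: "0 < e"
    then obtain n2 where n2: "\<And>m n. m \<ge> n2 \<Longrightarrow> n \<ge> n2 \<Longrightarrow> ?D m n < e/2" using C[of "e/2"] by auto
    have "norm (L2_inner M (\<lambda>x. F n x - f x) (\<lambda>x. F n x - f x) - 0) < e" if "n \<ge> n2" for n
    proof -
      have "ennreal (L2_inner M (\<lambda>x. F n x - f x) (\<lambda>x. F n x - f x)) = (\<integral>\<^sup>+x. ennreal ((F n x - f x)\<^sup>2) \<partial>M)"
        using L2_square_integrable[OF L2_diff[OF F f]]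
        by (simp add: nn_integral_eq_integral L2_inner_def power2_eq_square)
      also have "\<dots> \<le> ennreal (e/2)"
        using bound[of n2 n "e/2"] n2 that less_imp_le by blast
      finally have "L2_inner M (\<lambda>x. F n x - f x) (\<lambda>x. F n x - f x) \<le> e/2"
        using e by (simp add: ennreal_le_iff)
      then show ?thesis using e L2_inner_self_nonneg[of M "\<lambda>x. F n x - f x"] by simp
    qed
    then show "\<exists>no. \<forall>n\<ge>no. norm (L2_inner M (\<lambda>x. F n x - f x) (\<lambda>x. F n x - f x) - 0) < e" by blast
  qed
  then have "L2_tendsto M F f" using F f by (simp add: L2_tendsto_iff)
  then show ?thesis by (rule that)
qed

section \<open>Representing bounded functionals by minimising sequences\<close>

text \<open>
  This is the Riesz representation theorem for a space that need not be complete, so that the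
  representing vector appears only as a Cauchy sequence.  The sequence minimises
  \<open>J(v) = a(v,v) - 2 l(v)\<close>.  The parallelogram law gives the Cauchy property, and comparing \<open>J(v\<^sub>n)\<close>
  with \<open>J(v\<^sub>n + t \<phi>)\<close> for \<open>t = \<plusminus>1/\<surd>n\<close> gives the Euler--Lagrange equation in the limit.
\<close>

lemma Riesz_minimising_sequence:
  fixes V :: "('a \<Rightarrow> real) set" and a :: "('a \<Rightarrow> real) \<Rightarrow> ('a \<Rightarrow> real) \<Rightarrow> real"
    and l :: "('a \<Rightarrow> real) \<Rightarrow> real"
  assumes ne: "V \<noteq> {}"
    and closed: "\<And>u v t. u \<in> V \<Longrightarrow> v \<in> V \<Longrightarrow> (\<lambda>x. u x + t * v x) \<in> V"
    and a_lin: "\<And>u v w t. u \<in> V \<Longrightarrow> v \<in> V \<Longrightarrow> w \<in> V \<Longrightarrow> a (\<lambda>x. u x + t * v x) w = a u w + t * a v w"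
    and a_sym: "\<And>u v. u \<in> V \<Longrightarrow> v \<in> V \<Longrightarrow> a u v = a v u"
    and a_nonneg: "\<And>u. u \<in> V \<Longrightarrow> 0 \<le> a u u"
    and l_lin: "\<And>u v t. u \<in> V \<Longrightarrow> v \<in> V \<Longrightarrow> l (\<lambda>x. u x + t * v x) = l u + t * l v"
    and l_bound: "\<And>u. u \<in> V \<Longrightarrow> (l u)\<^sup>2 \<le> C * a u u"
  obtains v where "\<And>n. v n \<in> V"
    and "\<And>e. e > 0 \<Longrightarrow> \<exists>N. \<forall>m\<ge>N. \<forall>n\<ge>N. a (\<lambda>x. v m x - v n x) (\<lambda>x. v m x - v n x) < e"
    and "\<And>\<phi>. \<phi> \<in> V \<Longrightarrow> (\<lambda>n. a (v n) \<phi>) \<longlonglongrightarrow> l \<phi>"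
proof -
  define J where "J u = a u u - 2 * l u" for u
  have Jt: "J (\<lambda>x. u x + t * w x) = J u + 2 * t * (a u w - l w) + t\<^sup>2 * a w w"
    if u: "u \<in> V" and w: "w \<in> V" for u w t
  proof -
    let ?s = "\<lambda>x. u x + t * w x"
    have s: "?s \<in> V" by (rule closed[OF u w])
    have "a ?s ?s = a u ?s + t * a w ?s" using a_lin[OF u w s] .
    also have "a u ?s = a u u + t * a w u" using a_sym[OF u s] a_lin[OF u w u] by simp
    also have "a w ?s = a u w + t * a w w" using a_sym[OF w s] a_lin[OF u w w] by simp
    finally show ?thesis
      using l_lin[OF u w] a_sym[OF u w] by (simp add: J_def power2_eq_square algebra_simps)
  qed
  have J_bdd: "J u \<ge> - \<bar>C\<bar>" if u: "u \<in> V" for u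
  proof -
    have "0 \<le> (\<bar>C\<bar> - l u)\<^sup>2" by simp
    then have q: "2 * (\<bar>C\<bar> * l u) \<le> \<bar>C\<bar>\<^sup>2 + (l u)\<^sup>2" by (simp add: power2_eq_square algebra_simps)
    have "(l u)\<^sup>2 \<le> \<bar>C\<bar> * a u u"
      using l_bound[OF u] a_nonneg[OF u] by (smt (verit) mult_right_mono abs_ge_self)
    then have "2 * (\<bar>C\<bar> * l u) \<le> \<bar>C\<bar> * (\<bar>C\<bar> + a u u)"
      using q by (simp add: power2_eq_square algebra_simps)
    show ?thesis
    proof (cases "C = 0")
      case True
      then have "l u = 0" using l_bound[OF u] by simp
      then show ?thesis using a_nonneg[OF u] True by (simp add: J_def)
    next
      case False
      have "\<bar>C\<bar> * (2 * l u) \<le> \<bar>C\<bar> * (\<bar>C\<bar> + a u u)"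
        using \<open>2 * (\<bar>C\<bar> * l u) \<le> \<bar>C\<bar> * (\<bar>C\<bar> + a u u)\<close> by simp
      then have "2 * l u \<le> \<bar>C\<bar> + a u u" using False by (simp add: mult_le_cancel_left)
      then show ?thesis by (simp add: J_def)
    qed
  qed
  define d where "d = Inf (J ` V)"
  have bdd: "bdd_below (J ` V)" using J_bdd by (meson bdd_belowI2)
  have d_le: "d \<le> J u" if "u \<in> V" for u
    unfolding d_def using that bdd by (simp add: cInf_lower)
  have "\<exists>u\<in>V. J u < d + 1 / Suc n" for n
    using cInf_lessD[of "J ` V" "d + 1 / Suc n"] ne unfolding d_def by auto
  then obtain v where vV: "\<And>n. v n \<in> V" and vJ: "\<And>n. J (v n) < d + 1 / Suc n" by metis
  have diff: "(\<lambda>x. u x - w x) \<in> V" if "u \<in> V" "w \<in> V" for u w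
    using closed[OF that, of "-1"] by simp
  have Cau: "a (\<lambda>x. v m x - v n x) (\<lambda>x. v m x - v n x) \<le> 2 * (1 / Suc m + 1 / Suc n)" for m n
  proof -
    let ?w = "\<lambda>x. v m x - v n x"
    have w: "?w \<in> V" by (rule diff[OF vV vV])
    have "J (\<lambda>x. v n x + 1 * ?w x) = J (v n) + 2 * (a (v n) ?w - l ?w) + a ?w ?w"
      using Jt[OF vV w, of n 1] by simp
    then have 1: "J (v m) = J (v n) + 2 * (a (v n) ?w - l ?w) + a ?w ?w" by simp
    have "d \<le> J (\<lambda>x. v n x + (1/2) * ?w x)"
      by (rule d_le[OF closed[OF vV w]])
    also have "\<dots> = J (v n) + (a (v n) ?w - l ?w) + a ?w ?w / 4"
      using Jt[OF vV w, of n "1/2"] by (simp add: power2_eq_square)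
    finally have 2: "d \<le> J (v n) + (a (v n) ?w - l ?w) + a ?w ?w / 4" .
    have "2 * d \<le> jn + jm - b / 2" if "jm = jn + 2 * c + b" "d \<le> jn + c + b / 4" for jn jm b c
      using that by linarith
    from this[OF 1 2] have 2: "2 * d \<le> J (v n) + J (v m) - a ?w ?w / 2" .
    have "b \<le> 2 * (p + q)" if "2 * d \<le> jn + jm - b / 2" "jm < d + p" "jn < d + q" for jn jm b p q
      using that by (simp add: field_simps)
    from this[OF 2 vJ vJ] show ?thesis .
  qed
  have EL: "\<bar>a (v n) \<phi> - l \<phi>\<bar> \<le> (1 + a \<phi> \<phi>) * sqrt (1 / Suc n)" if \<phi>: "\<phi> \<in> V" for n \<phi>
  proof -
    \<comment> \<open>This step length balances the defect \<open>s\<^sup>2\<close> of the minimising sequence against the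
      quadratic term.\<close>
    define s where "s = sqrt (1 / Suc n)"
    have s: "s > 0" and s2: "s\<^sup>2 = 1 / Suc n" by (simp_all add: s_def)
    have "0 \<le> s * s + 2 * t * (a (v n) \<phi> - l \<phi>) + s * s * a \<phi> \<phi>" if t: "t\<^sup>2 = s\<^sup>2" for t
      using d_le[OF closed[OF vV \<phi>], of n t] Jt[OF vV \<phi>, of n t] vJ[of n] t s2
      by (simp add: power2_eq_square)
    from this[of s] this[of "- s"] 
    have *: "0 \<le> s * (s + 2 * (a (v n) \<phi> - l \<phi>) + s * a \<phi> \<phi>)" 
      "0 \<le> s * (s - 2 * (a (v n) \<phi> - l \<phi>) + s * a \<phi> \<phi>)"
      by (simp_all add: algebra_simps)
    then have "2 * \<bar>a (v n) \<phi> - l \<phi>\<bar> \<le> s + s * a \<phi> \<phi>"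
      using s by (simp add: zero_le_mult_iff abs_if)
    moreover have "0 \<le> s + s * a \<phi> \<phi>" using s a_nonneg[OF \<phi>] by simp
    ultimately show ?thesis unfolding s_def[symmetric] by (simp add: algebra_simps)
  qed
  have inv0: "(\<lambda>n. 1 / real (Suc n)) \<longlonglongrightarrow> 0" by (rule LIMSEQ_Suc[OF lim_1_over_n])
  show thesis
  proof
    show "\<And>n. v n \<in> V" by (rule vV)
    show "\<exists>N. \<forall>m\<ge>N. \<forall>n\<ge>N. a (\<lambda>x. v m x - v n x) (\<lambda>x. v m x - v n x) < e" if e: "e > 0" for e
    proof -
      have "\<forall>\<^sub>F n in sequentially. 1 / real (Suc n) < e / 4"
        using order_tendstoD(2)[OF inv0, of "e/4"] e by simp
      then obtain N where "\<And>n. n \<ge> N \<Longrightarrow> 1 / real (Suc n) < e / 4"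
        by (auto simp: eventually_sequentially)
      moreover have "2 * (p + q) < e" if "p < e / 4" "q < e / 4" for p q
        using that by (simp add: field_simps)
      ultimately have "2 * (1 / real (Suc m) + 1 / real (Suc n)) < e" if "m \<ge> N" "n \<ge> N" for m n
        using that by blast
      then show ?thesis using Cau by (meson le_less_trans)
    qed
    show "(\<lambda>n. a (v n) \<phi>) \<longlonglongrightarrow> l \<phi>" if \<phi>: "\<phi> \<in> V" for \<phi>
    proof -
      have "(\<lambda>n. a (v n) \<phi> - l \<phi>) \<longlonglongrightarrow> 0"
      proof (rule Lim_null_comparison)
        show "\<forall>\<^sub>F n in sequentially. norm (a (v n) \<phi> - l \<phi>) \<le> (1 + a \<phi> \<phi>) * sqrt (1 / Suc n)"
          using EL[OF \<phi>] by simp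
        show "(\<lambda>n. (1 + a \<phi> \<phi>) * sqrt (1 / real (Suc n))) \<longlonglongrightarrow> 0"
          using tendsto_mult[OF tendsto_const[of "1 + a \<phi> \<phi>"] tendsto_real_sqrt[OF inv0]] by simp
      qed
      then show ?thesis by (simp add: LIM_zero_iff)
    qed
  qed
qed

section \<open>Calculus of smooth functions\<close>

lemma partial_eq:
  assumes "(f has_derivative D) (at x)"
  shows "partial i f x = D i"
  unfolding partial_def using frechet_derivative_at[OF assms] by simp

lemma has_derivative_partial:
  assumes "f differentiable (at x)"
  shows "(f has_derivative (\<lambda>h. \<Sum>i\<in>Basis. (h \<bullet> i) * partial i f x)) (at x)"
proof -
  let ?D = "frechet_derivative f (at x)"
  have D: "(f has_derivative ?D) (at x)" using assms by (simp add: frechet_derivative_works)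
  then have lin: "linear ?D" by (simp add: has_derivative_linear)
  have "?D h = (\<Sum>i\<in>Basis. (h \<bullet> i) * partial i f x)" for h
  proof -
    have "?D h = ?D (\<Sum>i\<in>Basis. (h \<bullet> i) *\<^sub>R i)" by (simp add: euclidean_representation)
    also have "\<dots> = (\<Sum>i\<in>Basis. (h \<bullet> i) * ?D i)"
      by (simp add: linear_sum[OF lin] linear_scale[OF lin])
    finally show ?thesis by (simp add: partial_def)
  qed
  then have eq: "?D = (\<lambda>h. \<Sum>i\<in>Basis. (h \<bullet> i) * partial i f x)" by (rule ext)
  from D show ?thesis by (subst (asm) eq)
qed

lemma Ck_on_SucI:
  assumes "\<And>x. f differentiable (at x)" "\<And>i. i \<in> Basis \<Longrightarrow> Ck_on k UNIV (partial i f)"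
  shows "Ck_on (Suc k) UNIV f"
  using assms by simp

lemma Ck_on_differentiable: "Ck_on (Suc k) UNIV f \<Longrightarrow> f differentiable (at x)"
  by simp

lemma Ck_on_partial: "Ck_on (Suc k) UNIV f \<Longrightarrow> i \<in> Basis \<Longrightarrow> Ck_on k UNIV (partial i f)"
  by simp

lemma Ck_on_SucD: "Ck_on (Suc k) UNIV f \<Longrightarrow> Ck_on k UNIV f"
proof (induction k arbitrary: f)
  case 0
  then show ?case
    by (auto simp: continuous_on_eq_continuous_at intro: differentiable_imp_continuous_within)
next
  case (Suc k)
  show ?case
  proof (rule Ck_on_SucI)
    show "f differentiable (at x)" for x using Suc.prems by (rule Ck_on_differentiable)
    show "Ck_on k UNIV (partial i f)" if "i \<in> Basis" for i
      using Suc.IH Ck_on_partial[OF Suc.prems that] by blast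
  qed
qed

lemma Ck_on_mono: "Ck_on k UNIV f \<Longrightarrow> j \<le> k \<Longrightarrow> Ck_on j UNIV f"
  by (induction k) (auto simp del: Ck_on.simps(2) simp: le_Suc_eq dest: Ck_on_SucD)

lemma Ck_on_continuous: "Ck_on k UNIV f \<Longrightarrow> continuous_on UNIV f"
  using Ck_on_mono[of k f 0] by simp

lemma partial_const [simp]: "partial i (\<lambda>x. c) = (\<lambda>x. 0)"
  by (rule ext) (rule partial_eq[where D="\<lambda>_. 0"], simp)

lemma Ck_on_const [simp]: "Ck_on k UNIV (\<lambda>x. c)"
  by (induction k arbitrary: c) auto

lemma partial_add:
  assumes "f differentiable (at x)" "g differentiable (at x)"
  shows "partial i (\<lambda>x. f x + g x) x = partial i f x + partial i g x"
  using assms by (simp add: partial_def frechet_derivative_works partial_eq[unfolded partial_def, OF has_derivative_add])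

lemma partial_mult:
  fixes f g :: "'a::euclidean_space \<Rightarrow> real"
  assumes "f differentiable (at x)" "g differentiable (at x)"
  shows "partial i (\<lambda>x. f x * g x) x = f x * partial i g x + partial i f x * g x"
  using assms by (simp add: partial_def frechet_derivative_works partial_eq[unfolded partial_def, OF has_derivative_mult])

lemma Ck_on_add:
  "Ck_on k UNIV f \<Longrightarrow> Ck_on k UNIV g \<Longrightarrow> Ck_on k UNIV (\<lambda>x. f x + g x)"
proof (induction k arbitrary: f g)
  case 0
  then show ?case by (simp add: continuous_on_add)
next
  case (Suc k)
  have "partial i (\<lambda>x. f x + g x) = (\<lambda>x. partial i f x + partial i g x)" for i
    using Suc.prems by (auto simp: partial_add)
  with Suc show ?case by (intro Ck_on_SucI) (auto intro!: differentiable_add)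
qed

lemma Ck_on_mult:
  "Ck_on k UNIV f \<Longrightarrow> Ck_on k UNIV g \<Longrightarrow> Ck_on k UNIV (\<lambda>x. f x * g x)"
proof (induction k arbitrary: f g)
  case 0
  then show ?case by (simp add: continuous_on_mult)
next
  case (Suc k)
  have "partial i (\<lambda>x. f x * g x) = (\<lambda>x. f x * partial i g x + partial i f x * g x)" for i
    using Suc.prems by (auto simp: partial_mult)
  with Suc Ck_on_SucD[OF Suc.prems(1)] Ck_on_SucD[OF Suc.prems(2)] show ?case 
    by (intro Ck_on_SucI) (auto intro!: Ck_on_add differentiable_mult)
qed

lemma Ck_on_cmult: "Ck_on k UNIV f \<Longrightarrow> Ck_on k UNIV (\<lambda>x. c * f x)"
  by (intro Ck_on_mult) auto

lemma Ck_on_diff: "Ck_on k UNIV f \<Longrightarrow> Ck_on k UNIV g \<Longrightarrow> Ck_on k UNIV (\<lambda>x. f x - g x)"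
  using Ck_on_add[OF _ Ck_on_cmult[of k g "-1"], of f] by simp

lemma Ck_on_sum: "(\<And>i. i \<in> I \<Longrightarrow> Ck_on k UNIV (f i)) \<Longrightarrow> Ck_on k UNIV (\<lambda>x. \<Sum>i\<in>I. f i x)"
proof (induction I rule: infinite_finite_induct)
  case (insert i I)
  then have "Ck_on k UNIV (\<lambda>x. f i x + (\<Sum>i\<in>I. f i x))" by (intro Ck_on_add) simp_all
  then show ?case using insert by simp
qed simp_all

lemma Ck_on_prod: "(\<And>i. i \<in> I \<Longrightarrow> Ck_on k UNIV (f i)) \<Longrightarrow> Ck_on k UNIV (\<lambda>x. \<Prod>i\<in>I. f i x)"
proof (induction I rule: infinite_finite_induct)
  case (insert i I)
  then have "Ck_on k UNIV (\<lambda>x. f i x * (\<Prod>i\<in>I. f i x))" by (intro Ck_on_mult) simp_all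
  then show ?case using insert by simp
qed simp_all

text \<open>
  The derivative \<open>- f' / f\<^sup>2\<close> is a product of \<open>f'\<close> with two copies of the function itself, to
  which the induction hypothesis applies.
\<close>

lemma Ck_on_inverse:
  fixes f :: "'a::euclidean_space \<Rightarrow> real"
  assumes nz: "\<And>x. f x \<noteq> 0"
  shows "Ck_on k UNIV f \<Longrightarrow> Ck_on k UNIV (\<lambda>x. inverse (f x))"
proof (induction k)
  case 0
  then show ?case using nz by (simp add: continuous_on_inverse)
next
  case (Suc k)
  have d: "f differentiable (at x)" for x using Suc.prems by simp
  have D: "((\<lambda>x. inverse (f x)) has_derivative
      (\<lambda>h. - (inverse (f x) * frechet_derivative f (at x) h * inverse (f x)))) (at x)" for x
    using d nz by (intro Deriv.has_derivative_inverse) (simp_all add: frechet_derivative_works[symmetric])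
  have p: "partial i (\<lambda>x. inverse (f x)) = (\<lambda>x. (- 1) * (inverse (f x) * (partial i f x * inverse (f x))))" for i
    using partial_eq[OF D] by (auto simp: partial_def algebra_simps)
  have "Ck_on k UNIV (\<lambda>x. inverse (f x))" using Suc.IH Ck_on_SucD[OF Suc.prems] .
  with Suc.prems D show ?case unfolding Ck_on.simps(2) p
    by (intro conjI ballI Ck_on_cmult Ck_on_mult) (simp_all add: differentiableI[OF D])
qed

lemma partial_inner: "partial i (\<lambda>x. x \<bullet> c) = (\<lambda>x. i \<bullet> c)"
  by (rule ext, rule partial_eq) (auto intro!: derivative_eq_intros)

lemma Ck_on_inner: "Ck_on k UNIV (\<lambda>x. x \<bullet> c)"
  by (cases k) (auto simp: partial_inner intro!: continuous_intros)

lemma Ck_on_norm_square: "Ck_on k UNIV (\<lambda>x::'a::euclidean_space. (norm (x - z))\<^sup>2)"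
proof -
  have eq: "(\<lambda>x::'a. (norm (x - z))\<^sup>2) = (\<lambda>x. \<Sum>i\<in>Basis. (x \<bullet> i - z \<bullet> i) * (x \<bullet> i - z \<bullet> i))"
    unfolding power2_norm_eq_inner by (rule ext, subst euclidean_inner) (simp add: inner_diff_left)
  show ?thesis unfolding eq by (intro Ck_on_sum Ck_on_mult Ck_on_diff Ck_on_inner Ck_on_const)
qed

lemma partial_affine:
  assumes "f differentiable (at (a + c *\<^sub>R y))"
  shows "partial i (\<lambda>y. f (a + c *\<^sub>R y)) y = c * partial i f (a + c *\<^sub>R y)"
proof -
  have "((\<lambda>y. a + c *\<^sub>R y) has_derivative (\<lambda>h. c *\<^sub>R h)) (at y)"
    by (auto intro!: derivative_eq_intros)
  from has_derivative_compose[OF this has_derivative_partial[OF assms]]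
  have "((\<lambda>y. f (a + c *\<^sub>R y)) has_derivative
      (\<lambda>h. \<Sum>j\<in>Basis. (c *\<^sub>R h \<bullet> j) * partial j f (a + c *\<^sub>R y))) (at y)" .
  from partial_eq[OF this, of i]
  have "partial i (\<lambda>y. f (a + c *\<^sub>R y)) y = c * (\<Sum>j\<in>Basis. (i \<bullet> j) * partial j f (a + c *\<^sub>R y))"
    by (simp only: sum_distrib_left inner_scaleR_left mult.assoc)
  also have "\<dots> = c * partial i f (a + c *\<^sub>R y)"
    by (rule arg_cong[where f="(*) c", OF partial_eq[OF has_derivative_partial[OF assms], symmetric]])
  finally show ?thesis .
qed

lemma Ck_on_affine: "Ck_on k UNIV f \<Longrightarrow> Ck_on k UNIV (\<lambda>y. f (a + c *\<^sub>R y))"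
proof (induction k arbitrary: f)
  case 0
  then show ?case
    using continuous_on_compose2[of UNIV f UNIV "\<lambda>y. a + c *\<^sub>R y"]
    by (simp add: continuous_on_add continuous_on_scaleR)
next
  case (Suc k)
  have d: "f differentiable (at x)" for x using Suc.prems by simp
  have p: "partial i (\<lambda>y. f (a + c *\<^sub>R y)) = (\<lambda>y. c * partial i f (a + c *\<^sub>R y))" for i
    by (rule ext) (rule partial_affine[OF d])
  have "(\<lambda>y. f (a + c *\<^sub>R y)) differentiable (at y)" for y
  proof -
    have "((\<lambda>y. a + c *\<^sub>R y) has_derivative (\<lambda>h. c *\<^sub>R h)) (at y)"
      by (auto intro!: derivative_eq_intros)
    from has_derivative_compose[OF this has_derivative_partial[OF d]] show ?thesis
      by (rule differentiableI)
  qed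
  moreover have "Ck_on k UNIV (partial i (\<lambda>y. f (a + c *\<^sub>R y)))" if "i \<in> Basis" for i
    unfolding p by (intro Ck_on_cmult Suc.IH Ck_on_partial[OF Suc.prems that])
  ultimately show ?case by (rule Ck_on_SucI)
qed

text \<open>
  The induction on the order of differentiability replaces \<open>g\<^sub>m\<close> by its derivative \<open>g\<^sub>m\<^sub>+\<^sub>1\<close>, so the
  whole sequence of derivatives is kept in the statement.
\<close>

lemma Ck_on_compose_real:
  fixes g :: "nat \<Rightarrow> real \<Rightarrow> real"
  assumes g: "\<And>m t. (g m has_real_derivative g (Suc m) t) (at t)"
  shows "Ck_on k UNIV f \<Longrightarrow> Ck_on k UNIV (\<lambda>x. g m (f x))"
proof (induction k arbitrary: m)
  case 0
  have "continuous_on UNIV (g m)"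
    by (meson DERIV_isCont continuous_at_imp_continuous_on g)
  then show ?case using 0 continuous_on_compose2[of UNIV "g m" UNIV f] by simp
next
  case (Suc k)
  have D: "((\<lambda>x. g m (f x)) has_derivative (\<lambda>h. frechet_derivative f (at x) h * g (Suc m) (f x))) (at x)" for x
    using has_derivative_compose[of f _ x UNIV "g m"] Suc.prems g[of m "f x"]
    by (auto simp: has_field_derivative_def frechet_derivative_works mult.commute)
  have p: "partial i (\<lambda>x. g m (f x)) = (\<lambda>x. partial i f x * g (Suc m) (f x))" for i
    using partial_eq[OF D] by (auto simp: partial_def)
  have "Ck_on k UNIV (\<lambda>x. g (Suc m) (f x))" using Suc.IH Ck_on_SucD[OF Suc.prems] .
  with Suc.prems D show ?case unfolding Ck_on.simps(2) p
    by (auto intro!: Ck_on_mult differentiableI)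
qed

text \<open>
  The derivative of \<open>p(1/t) exp(-1/t)\<close>, continued by \<open>0\<close> to the left of the origin, is a function
  of the same form with another polynomial \<open>p\<close>; hence all of these functions are smooth.
\<close>

definition flat_exp :: "real poly \<Rightarrow> real \<Rightarrow> real" where
  "flat_exp p t = (if t > 0 then poly p (1 / t) * exp (- (1 / t)) else 0)"

lemma poly_exp_tendsto_0: "((\<lambda>u. poly p u * exp (- u)) \<longlongrightarrow> 0) (at_top :: real filter)"
proof -
  have "((\<lambda>u. \<Sum>i\<le>degree p. coeff p i * (u ^ i / exp u)) \<longlongrightarrow> (\<Sum>i\<le>degree p. coeff p i * 0)) at_top"
    by (intro tendsto_sum tendsto_mult tendsto_const tendsto_power_div_exp_0)
  moreover have "(\<lambda>u. \<Sum>i\<le>degree p. coeff p i * (u ^ i / exp u)) = (\<lambda>u. poly p u * exp (- u))"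
    by (rule ext) (simp add: poly_altdef sum_distrib_right exp_minus divide_inverse mult.assoc)
  ultimately show ?thesis by simp
qed

lemma flat_exp_deriv:
  "(flat_exp p has_real_derivative flat_exp ([:0, 0, 1:] * (p - pderiv p)) t) (at t)"
proof -
  let ?q = "[:0, 0, 1:] * (p - pderiv p)"
  consider "t > 0" | "t < 0" | "t = 0" by linarith
  then show ?thesis
  proof cases
    case 1
    have "((\<lambda>t. poly p (1 / t) * exp (- (1 / t))) has_real_derivative
        poly ?q (1 / t) * exp (- (1 / t))) (at t)"
      using 1 by (auto intro!: derivative_eq_intros simp: field_simps power2_eq_square)
    then have "(flat_exp p has_real_derivative poly ?q (1 / t) * exp (- (1 / t))) (at t)"
      by (rule has_field_derivative_transform_within_open[where S="{0<..}"]) (use 1 in \<open>auto simp: flat_exp_def\<close>)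
    then show ?thesis using 1 by (simp add: flat_exp_def)
  next
    case 2
    have "((\<lambda>t. 0) has_real_derivative 0) (at t)" by simp
    then have "(flat_exp p has_real_derivative 0) (at t)"
      by (rule has_field_derivative_transform_within_open[where S="{..<0}"]) (use 2 in \<open>auto simp: flat_exp_def\<close>)
    then show ?thesis using 2 by (simp add: flat_exp_def)
  next
    case 3
    have "((\<lambda>h. flat_exp p h / h) \<longlongrightarrow> 0) (at_right 0)"
    proof (rule Lim_transform_eventually)
      show "((\<lambda>h. poly ([:0, 1:] * p) (inverse h) * exp (- inverse h)) \<longlongrightarrow> 0) (at_right 0)"
        by (rule filterlim_compose[OF poly_exp_tendsto_0 filterlim_inverse_at_top_right])
      show "\<forall>\<^sub>F h in at_right 0. poly ([:0, 1:] * p) (inverse h) * exp (- inverse h) = flat_exp p h / h"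
        by (rule eventually_at_rightI[of 0 1]) (auto simp: flat_exp_def field_simps)
    qed
    moreover have "((\<lambda>h. flat_exp p h / h) \<longlongrightarrow> 0) (at_left 0)"
      by (rule Lim_transform_eventually[OF tendsto_const], rule eventually_at_leftI[of "-1"]) (auto simp: flat_exp_def)
    ultimately have "((\<lambda>h. flat_exp p h / h) \<longlongrightarrow> 0) (at 0)" by (rule filterlim_split_at[rotated])
    then show ?thesis using 3 by (simp add: DERIV_def flat_exp_def)
  qed
qed

definition cutoff :: "real \<Rightarrow> real" where
  "cutoff t = (if t > 0 then exp (- (1 / t)) else 0)"

lemma cutoff_nonneg: "0 \<le> cutoff t" and cutoff_le_1: "cutoff t \<le> 1"
  and cutoff_pos_iff: "0 < cutoff t \<longleftrightarrow> 0 < t" and cutoff_eq_0: "t \<le> 0 \<Longrightarrow> cutoff t = 0"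
  by (auto simp: cutoff_def)

lemma Ck_on_cutoff: 
  assumes "Ck_on k UNIV f"
  shows "Ck_on k UNIV (\<lambda>x. cutoff (f x))"
proof -
  define P :: "nat \<Rightarrow> real poly" where "P m = ((\<lambda>p. [:0, 0, 1:] * (p - pderiv p)) ^^ m) 1" for m
  have P_Suc: "P (Suc m) = [:0, 0, 1:] * (P m - pderiv (P m))" for m
    by (simp only: P_def funpow.simps o_apply)
  have "(flat_exp (P m) has_real_derivative flat_exp (P (Suc m)) t) (at t)" for m t
    unfolding P_Suc by (rule flat_exp_deriv)
  from Ck_on_compose_real[of "\<lambda>m. flat_exp (P m)", OF this assms, where m=0]
  have "Ck_on k UNIV (\<lambda>x. flat_exp (P 0) (f x))" .
  moreover have "flat_exp (P 0) = cutoff"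
    by (rule ext) (simp add: P_def flat_exp_def cutoff_def)
  ultimately show ?thesis by (simp only:)
qed

section \<open>Test functions and integration by parts\<close>

lemma compact_support_in_iff:
  "compact_support_in \<Omega> f \<longleftrightarrow> (\<exists>K. compact K \<and> K \<subseteq> \<Omega> \<and> (\<forall>x. x \<notin> K \<longrightarrow> f x = 0))"
proof
  assume "compact_support_in \<Omega> f"
  then show "\<exists>K. compact K \<and> K \<subseteq> \<Omega> \<and> (\<forall>x. x \<notin> K \<longrightarrow> f x = 0)"
    unfolding compact_support_in_def using closure_subset[of "{x. f x \<noteq> 0}"] by blast
next
  assume "\<exists>K. compact K \<and> K \<subseteq> \<Omega> \<and> (\<forall>x. x \<notin> K \<longrightarrow> f x = 0)"
  then obtain K where K: "compact K" "K \<subseteq> \<Omega>" "\<And>x. x \<notin> K \<Longrightarrow> f x = 0" by blast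
  have "closure {x. f x \<noteq> 0} \<subseteq> K"
    using K by (intro closure_minimal) (auto simp: compact_imp_closed)
  moreover have "compact (closure {x. f x \<noteq> 0})"
    using compact_Int_closed[OF K(1) closed_closure[of "{x. f x \<noteq> 0}"]] calculation
    by (simp add: Int_absorb1)
  ultimately show "compact_support_in \<Omega> f"
    using K(2) by (auto simp: compact_support_in_def)
qed

lemma partial_zero_outside:
  fixes f :: "'a::euclidean_space \<Rightarrow> real"
  assumes "closed K" "\<And>x. x \<notin> K \<Longrightarrow> f x = 0" "x \<notin> K"
  shows "partial i f x = 0"
proof (rule partial_eq[where D="\<lambda>_. 0"])
  have "((\<lambda>x. 0) has_derivative (\<lambda>_. 0)) (at x)" by simp
  then show "(f has_derivative (\<lambda>_. 0)) (at x)"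
    by (rule has_derivative_transform_within_open[where s="- K"]) (use assms in auto)
qed

lemma classical_lap_zero_outside:
  assumes "closed K" "\<And>x. x \<notin> K \<Longrightarrow> f x = 0" "x \<notin> K"
  shows "classical_lap f x = 0"
  unfolding classical_lap_def
  by (intro sum.neutral ballI partial_zero_outside[OF assms(1) _ assms(3)]) 
     (rule partial_zero_outside[OF assms(1,2)])

lemma Cc_inf_iff: "f \<in> Cc_inf \<Omega> \<longleftrightarrow>
    (\<forall>k. Ck_on k UNIV f) \<and> (\<exists>K. compact K \<and> K \<subseteq> \<Omega> \<and> (\<forall>x. x \<notin> K \<longrightarrow> f x = 0))"
  by (simp add: Cc_inf_def smooth_on_def compact_support_in_iff)

lemma Cck_iff: "f \<in> Cck k \<Omega> \<longleftrightarrow>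
    Ck_on k UNIV f \<and> (\<exists>K. compact K \<and> K \<subseteq> \<Omega> \<and> (\<forall>x. x \<notin> K \<longrightarrow> f x = 0))"
  by (simp add: Cck_def compact_support_in_iff)

lemma Cc_infI:
  assumes "\<And>k. Ck_on k UNIV f" "compact K" "K \<subseteq> \<Omega>" "\<And>x. x \<notin> K \<Longrightarrow> f x = 0"
  shows "f \<in> Cc_inf \<Omega>"
  using assms unfolding Cc_inf_iff by blast

lemma Cc_infE:
  assumes "f \<in> Cc_inf \<Omega>"
  obtains K where "\<And>k. Ck_on k UNIV f" "compact K" "K \<subseteq> \<Omega>" "\<And>x. x \<notin> K \<Longrightarrow> f x = 0"
  using assms unfolding Cc_inf_iff by blast

lemma Cc_inf_Ck: "f \<in> Cc_inf \<Omega> \<Longrightarrow> Ck_on k UNIV f"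
  by (simp add: Cc_inf_iff)

lemma Cc_inf_subset_Cck: "Cc_inf \<Omega> \<subseteq> Cck k \<Omega>"
  by (auto simp: Cc_inf_iff Cck_iff)

lemma Cc_inf_mono: "\<Omega> \<subseteq> \<Omega>' \<Longrightarrow> Cc_inf \<Omega> \<subseteq> Cc_inf \<Omega>'"
  unfolding Cc_inf_iff subset_iff by blast

lemma Cc_inf_zero [simp]: "(\<lambda>x. 0) \<in> Cc_inf \<Omega>"
  by (rule Cc_infI[of _ "{}"]) auto

lemma Cc_inf_partial: "f \<in> Cc_inf \<Omega> \<Longrightarrow> i \<in> Basis \<Longrightarrow> partial i f \<in> Cc_inf \<Omega>"
  by (erule Cc_infE, rule Cc_infI)
     (auto intro: Ck_on_partial partial_zero_outside compact_imp_closed simp del: Ck_on.simps)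

lemma Cc_inf_axpy:
  assumes f: "f \<in> Cc_inf \<Omega>" and g: "g \<in> Cc_inf \<Omega>"
  shows "(\<lambda>x. f x + t * g x) \<in> Cc_inf \<Omega>"
proof -
  obtain K where K: "compact K" "K \<subseteq> \<Omega>" "\<And>x. x \<notin> K \<Longrightarrow> f x = 0" using Cc_infE[OF f] by metis
  obtain L where L: "compact L" "L \<subseteq> \<Omega>" "\<And>x. x \<notin> L \<Longrightarrow> g x = 0" using Cc_infE[OF g] by metis
  show ?thesis
    by (rule Cc_infI[of _ "K \<union> L"]) 
       (use K L Cc_inf_Ck[OF f] Cc_inf_Ck[OF g] in \<open>auto intro!: Ck_on_add Ck_on_cmult\<close>)
qed

lemma Ck_on_classical_lap: "Ck_on (Suc (Suc k)) UNIV f \<Longrightarrow> Ck_on k UNIV (classical_lap f)"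
  unfolding classical_lap_def by (intro Ck_on_sum Ck_on_partial)

lemma Cc_inf_lap: "f \<in> Cc_inf \<Omega> \<Longrightarrow> classical_lap f \<in> Cc_inf \<Omega>"
  by (erule Cc_infE, rule Cc_infI)
     (auto intro: Ck_on_classical_lap classical_lap_zero_outside compact_imp_closed simp del: Ck_on.simps)

lemma compact_support_bounded:
  fixes f :: "'a::euclidean_space \<Rightarrow> real"
  assumes "continuous_on UNIV f" "compact K" "\<And>x. x \<notin> K \<Longrightarrow> f x = 0"
  obtains C where "0 < C" "\<And>x. \<bar>f x\<bar> \<le> C"
proof -
  have "compact (f ` K)"
    using assms by (meson compact_continuous_image continuous_on_subset subset_UNIV)
  then obtain C where C: "0 < C" "\<And>y. y \<in> f ` K \<Longrightarrow> norm y \<le> C"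
    using compact_imp_bounded bounded_pos by metis
  have "\<bar>f x\<bar> \<le> C" for x
    using C assms(3)[of x] by (cases "x \<in> K") auto
  then show thesis using C(1) that by blast
qed

lemma compact_support_integrable:
  fixes f :: "'a::euclidean_space \<Rightarrow> real"
  assumes "continuous_on UNIV f" "compact K" "\<And>x. x \<notin> K \<Longrightarrow> f x = 0"
  shows "integrable lborel f"
proof -
  have "integrable lborel (\<lambda>x. indicator K x *\<^sub>R f x)"
    by (intro borel_integrable_compact assms continuous_on_subset[OF assms(1)]) auto
  moreover have "(\<lambda>x. indicator K x *\<^sub>R f x) = f"
    by (rule ext) (use assms(3) in \<open>auto simp: indicator_def\<close>)
  ultimately show ?thesis by simp
qed

lemma continuous_imp_lebesgue_on_measurable:
  fixes f :: "'a::euclidean_space \<Rightarrow> real"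
  assumes "continuous_on UNIV f"
  shows "f \<in> borel_measurable (lebesgue_on S)"
  using borel_measurable_continuous_onI[OF assms] by (intro measurable_restrict_space1 measurable_completion) simp

lemma integral_lebesgue_on_vanishing:
  fixes f :: "'a::euclidean_space \<Rightarrow> real"
  assumes "f \<in> borel_measurable borel" "\<And>x. x \<notin> S \<Longrightarrow> f x = 0" "S \<in> sets lebesgue"
  shows "(\<integral>x. f x \<partial>lebesgue_on S) = (\<integral>x. f x \<partial>lborel)"
    and "integrable (lebesgue_on S) f \<longleftrightarrow> integrable lborel f"
proof -
  have eq: "(\<lambda>x. if x \<in> S then f x else 0) = f" using assms(2) by auto
  show "(\<integral>x. f x \<partial>lebesgue_on S) = (\<integral>x. f x \<partial>lborel)"
    using Lebesgue_Measure.integral_restrict_UNIV[OF assms(3), of f] assms(1) by (simp add: eq integral_completion)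
  show "integrable (lebesgue_on S) f \<longleftrightarrow> integrable lborel f"
    using Lebesgue_Measure.integrable_restrict_UNIV[OF assms(3), of f] assms(1) by (simp add: eq integrable_completion)
qed

lemma lborel_integral_translation:
  fixes f :: "'a::euclidean_space \<Rightarrow> real"
  assumes "f \<in> borel_measurable borel"
  shows "(\<integral>x. f (c + x) \<partial>lborel) = (\<integral>x. f x \<partial>lborel)"
proof -
  have "(\<integral>x. f x \<partial>distr lborel borel ((+) c)) = (\<integral>x. f (c + x) \<partial>lborel)"
    using assms by (intro integral_distr) auto
  then show ?thesis by (simp add: lborel_distr_plus)
qed

lemma DERIV_along_line:
  fixes f :: "'a::euclidean_space \<Rightarrow> real"
  assumes "f differentiable (at (x + s *\<^sub>R i))"
  shows "((\<lambda>s. f (x + s *\<^sub>R i)) has_real_derivative partial i f (x + s *\<^sub>R i)) (at s)"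
proof -
  let ?D = "frechet_derivative f (at (x + s *\<^sub>R i))"
  have D: "(f has_derivative ?D) (at (x + s *\<^sub>R i))" using assms by (simp add: frechet_derivative_works)
  have "((\<lambda>s. x + s *\<^sub>R i) has_derivative (\<lambda>h. h *\<^sub>R i)) (at s)"
    by (auto intro!: derivative_eq_intros)
  from has_derivative_compose[OF this D]
  have "((\<lambda>s. f (x + s *\<^sub>R i)) has_derivative (\<lambda>h. ?D (h *\<^sub>R i))) (at s)" .
  moreover have "?D (h *\<^sub>R i) = h * ?D i" for h
    using linear_scale[OF has_derivative_linear[OF D]] by simp
  ultimately show ?thesis
    by (simp add: has_field_derivative_def partial_def mult_commute_abs)
qed

text \<open>
  The integral of a difference quotient in direction \<open>i\<close> vanishes by translation invariance, and
  the difference quotients converge boundedly to the partial derivative.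
\<close>

lemma integral_partial_eq_0:
  fixes f :: "'a::euclidean_space \<Rightarrow> real"
  assumes f: "Ck_on 1 UNIV f" and K: "compact K" "\<And>x. x \<notin> K \<Longrightarrow> f x = 0" and i: "i \<in> Basis"
  shows "(\<integral>x. partial i f x \<partial>lborel) = 0"
proof -
  have d: "f differentiable (at x)" for x using f by simp
  have cf: "continuous_on UNIV f" using f Ck_on_continuous by blast
  have cp: "continuous_on UNIV (partial i f)" using f i by simp
  have [measurable]: "f \<in> borel_measurable borel" "partial i f \<in> borel_measurable borel"
    using cf cp by (auto intro: borel_measurable_continuous_onI)
  have p0: "partial i f x = 0" if "x \<notin> K" for x
    using compact_imp_closed[OF K(1)] K(2) that by (rule partial_zero_outside)
  obtain C where C: "0 < C" "\<And>x. \<bar>partial i f x\<bar> \<le> C"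
    using compact_support_bounded[OF cp K(1) p0] by blast
  obtain R where R: "0 < R" "\<And>x. x \<in> K \<Longrightarrow> norm x \<le> R"
    using compact_imp_bounded[OF K(1)] bounded_pos by metis
  define t where "t n = 1 / real (Suc n)" for n
  have t: "0 < t n" "t n \<le> 1" for n by (auto simp: t_def)
  have t0: "t \<longlonglongrightarrow> 0" unfolding t_def by (rule LIMSEQ_Suc[OF lim_1_over_n])
  define g where "g n x = (f (x + t n *\<^sub>R i) - f x) / t n" for n x
  have [measurable]: "g n \<in> borel_measurable lborel" for n unfolding g_def by measurable
  have "integrable lborel f" by (rule compact_support_integrable[OF cf K])
  moreover have "integrable lborel (\<lambda>x. f (x + t n *\<^sub>R i))" for n
  proof -
    have "compact ((\<lambda>x. x - t n *\<^sub>R i) ` K)" 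
      by (intro compact_continuous_image continuous_intros K)
    moreover have "f (x + t n *\<^sub>R i) = 0" if "x \<notin> (\<lambda>x. x - t n *\<^sub>R i) ` K" for x
      using that by (intro K(2)) (metis add_diff_cancel_right' imageI)
    ultimately show ?thesis
      by (intro compact_support_integrable continuous_on_compose2[OF cf] continuous_intros) auto
  qed
  moreover have "(\<integral>x. f (x + t n *\<^sub>R i) \<partial>lborel) = (\<integral>x. f x \<partial>lborel)" for n
    using lborel_integral_translation[of f "t n *\<^sub>R i"] by (simp add: add.commute)
  ultimately have g0: "(\<integral>x. g n x \<partial>lborel) = 0" for n
    unfolding g_def by simp
  have "(\<lambda>n. \<integral>x. g n x \<partial>lborel) \<longlonglongrightarrow> (\<integral>x. partial i f x \<partial>lborel)"
  proof (rule integral_dominated_convergence[where w="\<lambda>x. C * indicator (cball 0 (R + 1)) x"])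
    show "AE x in lborel. (\<lambda>n. g n x) \<longlonglongrightarrow> partial i f x"
    proof (rule AE_I2)
      fix x
      have "((\<lambda>s. f (x + s *\<^sub>R i)) has_real_derivative partial i f x) (at 0)"
        using DERIV_along_line[of f x 0 i] d by simp
      then have "((\<lambda>h. (f (x + h *\<^sub>R i) - f x) / h) \<longlongrightarrow> partial i f x) (at 0)"
        by (simp add: DERIV_def)
      moreover have "filterlim t (at 0) sequentially"
        using t0 t(1) by (auto simp: filterlim_at intro!: always_eventually) (metis less_irrefl)
      ultimately show "(\<lambda>n. g n x) \<longlonglongrightarrow> partial i f x"
        unfolding g_def by (rule filterlim_compose)
    qed
    show "integrable lborel (\<lambda>x::'a. C * indicator (cball 0 (R + 1)) x)"
      by (intro integrable_mult_right integrable_real_indicator) (use emeasure_bounded_finite[OF bounded_cball[of "0::'a" "R + 1"]] in \<open>simp_all add: less_top\<close>)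
    show "AE x in lborel. norm (g n x) \<le> C * indicator (cball 0 (R + 1)) x" for n
    proof (rule AE_I2)
      fix x
      show "norm (g n x) \<le> C * indicator (cball 0 (R + 1)) x"
      proof (cases "norm x \<le> R + 1")
        case True
        have "\<exists>z. 0 < z \<and> z < t n \<and> f (x + t n *\<^sub>R i) - f (x + 0 *\<^sub>R i) = (t n - 0) * partial i f (x + z *\<^sub>R i)"
          by (rule MVT2[where f="\<lambda>s. f (x + s *\<^sub>R i)", OF t(1)]) (rule DERIV_along_line[OF d])
        then obtain z where "f (x + t n *\<^sub>R i) - f x = t n * partial i f (x + z *\<^sub>R i)" by auto
        then have "g n x = partial i f (x + z *\<^sub>R i)" using t(1)[of n] by (simp add: g_def)
        then show ?thesis using True C(2) by simp
      next
        case False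
        then have "x \<notin> K" using R(2) by force
        moreover have "x + t n *\<^sub>R i \<notin> K"
        proof
          assume "x + t n *\<^sub>R i \<in> K"
          then have "norm (x + t n *\<^sub>R i) \<le> R" by (rule R(2))
          moreover have "norm (t n *\<^sub>R i) \<le> 1" using t[of n] i by simp
          moreover have "norm x \<le> norm (x + t n *\<^sub>R i) + norm (t n *\<^sub>R i)"
            using norm_triangle_ineq4[of "x + t n *\<^sub>R i" "t n *\<^sub>R i"] by simp
          ultimately show False using False by linarith
        qed
        ultimately show ?thesis using K(2) False by (simp add: g_def)
      qed
    qed
  qed measurable
  then show ?thesis using g0 by (simp add: LIMSEQ_const_iff)
qed

lemma integral_by_parts:
  fixes f g :: "'a::euclidean_space \<Rightarrow> real"
  assumes f: "Ck_on 1 UNIV f" and g: "Ck_on 1 UNIV g"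
    and K: "compact K" "K \<subseteq> S" "\<And>x. x \<notin> K \<Longrightarrow> f x = 0" and S: "S \<in> sets lebesgue" and i: "i \<in> Basis"
  shows "(\<integral>x. f x * partial i g x \<partial>lebesgue_on S) = - (\<integral>x. partial i f x * g x \<partial>lebesgue_on S)"
proof -
  have c: "continuous_on UNIV f" "continuous_on UNIV g" "continuous_on UNIV (partial i f)"
      "continuous_on UNIV (partial i g)"
    using f g i Ck_on_continuous by (blast, blast, simp_all)
  have p0: "partial i f x = 0" if "x \<notin> K" for x
    using compact_imp_closed[OF K(1)] K(3) that by (rule partial_zero_outside)
  have i1: "integrable lborel (\<lambda>x. f x * partial i g x)"
    by (rule compact_support_integrable[OF _ K(1)]) (auto intro!: continuous_on_mult c simp: K(3))
  have i2: "integrable lborel (\<lambda>x. partial i f x * g x)"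
    by (rule compact_support_integrable[OF _ K(1)]) (auto intro!: continuous_on_mult c simp: p0)
  have "0 = (\<integral>x. partial i (\<lambda>x. f x * g x) x \<partial>lborel)"
    by (rule integral_partial_eq_0[OF Ck_on_mult[OF f g] K(1) _ i, symmetric]) (simp add: K(3))
  also have "\<dots> = (\<integral>x. f x * partial i g x + partial i f x * g x \<partial>lborel)"
    using f g by (simp add: partial_mult)
  also have "\<dots> = (\<integral>x. f x * partial i g x \<partial>lborel) + (\<integral>x. partial i f x * g x \<partial>lborel)"
    by (rule Bochner_Integration.integral_add[OF i1 i2])
  also have "(\<integral>x. f x * partial i g x \<partial>lborel) = (\<integral>x. f x * partial i g x \<partial>lebesgue_on S)"
    by (rule integral_lebesgue_on_vanishing(1)[symmetric])
       (use K S borel_measurable_integrable[OF i1] in auto)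
  also have "(\<integral>x. partial i f x * g x \<partial>lborel) = (\<integral>x. partial i f x * g x \<partial>lebesgue_on S)"
    by (rule integral_lebesgue_on_vanishing(1)[symmetric])
       (use K(2) p0 S borel_measurable_integrable[OF i2] in auto)
  finally show ?thesis by simp
qed

section \<open>The fundamental lemma of the calculus of variations\<close>

text \<open>
  Since \<open>cutoff(n s)\<close> tends to \<open>1\<close> for \<open>s > 0\<close> and vanishes for \<open>s \<le> 0\<close>, these test functions
  increase to the indicator of the open box, staying supported in the closed box.
\<close>

definition box_bump :: "'a::euclidean_space \<Rightarrow> 'a \<Rightarrow> nat \<Rightarrow> 'a \<Rightarrow> real" where
  "box_bump a b n x =
     (\<Prod>i\<in>Basis. cutoff (real (Suc n) * (x \<bullet> i - a \<bullet> i)) * cutoff (real (Suc n) * (b \<bullet> i - x \<bullet> i)))"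

lemma box_bump_Cc_inf:
  assumes "cbox a b \<subseteq> \<Omega>"
  shows "box_bump a b n \<in> Cc_inf \<Omega>"
proof (rule Cc_infI[where K="cbox a b"])
  show "Ck_on k UNIV (box_bump a b n)" for k
    unfolding box_bump_def
    by (intro Ck_on_prod Ck_on_mult[OF Ck_on_cutoff Ck_on_cutoff] Ck_on_cmult Ck_on_diff Ck_on_inner Ck_on_const)
  fix x assume "x \<notin> cbox a b"
  then obtain i where i: "i \<in> Basis" "x \<bullet> i < a \<bullet> i \<or> b \<bullet> i < x \<bullet> i"
    by (auto simp: mem_box not_le)
  then have "real (Suc n) * (x \<bullet> i - a \<bullet> i) \<le> 0 \<or> real (Suc n) * (b \<bullet> i - x \<bullet> i) \<le> 0"
    by (auto simp: mult_le_0_iff)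
  then have "cutoff (real (Suc n) * (x \<bullet> i - a \<bullet> i)) * cutoff (real (Suc n) * (b \<bullet> i - x \<bullet> i)) = 0"
    using cutoff_eq_0 by auto
  then show "box_bump a b n x = 0"
    unfolding box_bump_def using i(1) by (intro prod_zero) auto
qed (use assms in auto)

lemma box_bump_bounds: "0 \<le> box_bump a b n x" "box_bump a b n x \<le> 1"
  unfolding box_bump_def
  by (auto intro!: prod_nonneg prod_le_1 mult_nonneg_nonneg mult_le_one cutoff_nonneg cutoff_le_1)

lemma cutoff_scaled_tendsto:
  "(\<lambda>n. cutoff (real (Suc n) * s)) \<longlonglongrightarrow> (if s > 0 then 1 else 0)"
proof (cases "s > 0")
  case True
  have "(\<lambda>n. exp (- (1 / s * (1 / real (Suc n))))) \<longlonglongrightarrow> exp (- (1 / s * 0))"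
    by (intro tendsto_intros LIMSEQ_Suc[OF lim_1_over_n])
  moreover have "exp (- (1 / s * (1 / real (Suc n)))) = cutoff (real (Suc n) * s)" for n
    using True by (simp add: cutoff_def mult.commute)
  ultimately show ?thesis using True by simp
next
  case False
  then have "cutoff (real (Suc n) * s) = 0" for n
    by (intro cutoff_eq_0) (simp add: mult_le_0_iff)
  then show ?thesis using False by simp
qed

lemma box_bump_tendsto: "(\<lambda>n. box_bump a b n x) \<longlonglongrightarrow> indicator (box a b) x"
proof -
  have "(\<lambda>n. box_bump a b n x) \<longlonglongrightarrow>
      (\<Prod>i\<in>Basis. (if x \<bullet> i - a \<bullet> i > 0 then 1 else 0) * (if b \<bullet> i - x \<bullet> i > 0 then 1 else (0::real)))"
    unfolding box_bump_def by (intro tendsto_prod tendsto_mult cutoff_scaled_tendsto)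
  moreover have "(\<Prod>i\<in>Basis. (if x \<bullet> i - a \<bullet> i > 0 then 1 else 0) * (if b \<bullet> i - x \<bullet> i > 0 then 1 else (0::real)))
      = indicator (box a b) x"
    by (cases "x \<in> box a b") (auto simp: mem_box indicator_def intro!: prod.neutral)
  ultimately show ?thesis by simp
qed

text \<open>
  Boxes form an intersection-stable generator of the Borel sets, so the class of sets over which
  \<open>h\<close> integrates to \<open>0\<close> contains all Borel sets.
\<close>

lemma AE_zero_if_box_integrals_zero:
  fixes h :: "'a::euclidean_space \<Rightarrow> real"
  assumes h: "integrable lborel h"
    and whole: "(\<integral>x. h x \<partial>lborel) = 0"
    and boxes: "\<And>a b. (\<integral>x. indicator (box a b) x * h x \<partial>lborel) = 0"
  shows "AE x in lborel. h x = 0"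
proof (rule density_unique_real[OF h integrable_zero])
  fix A :: "'a set" assume "A \<in> sets lborel"
  have sets: "sigma_sets UNIV (range (\<lambda>(a, b). box a b)) = sets (borel :: 'a measure)"
    by (subst borel_eq_box) (rule sets_measure_of[symmetric], simp)
  then have A: "A \<in> sigma_sets UNIV (range (\<lambda>(a, b). box a b))"
    using \<open>A \<in> sets lborel\<close> by (simp only: sets_lborel)
  have ind: "integrable lborel (\<lambda>x. indicator B x * h x)" if "B \<in> sets borel" for B
    using integrable_mult_indicator[OF _ h, of B] that by simp
  have "(\<integral>x. indicator A x * h x \<partial>lborel) = 0"
  proof (rule sigma_sets_induct_disjoint[OF _ _ A])
    show "Int_stable (range (\<lambda>(a, b). box a b :: 'a set))"
    proof (rule Int_stableI)
      fix X Y :: "'a set" assume "X \<in> range (\<lambda>(a, b). box a b)" "Y \<in> range (\<lambda>(a, b). box a b)"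
      then obtain a b c d where "X = box a b" "Y = box c d" by auto
      then show "X \<inter> Y \<in> range (\<lambda>(a, b). box a b)"
        using box_Int_box[of a b c d] by (auto intro: rev_image_eqI)
    qed
    show "range (\<lambda>(a, b). box a b) \<subseteq> Pow (UNIV :: 'a set)" by simp
  next
    fix B :: "'a set" assume "B \<in> range (\<lambda>(a, b). box a b)"
    then show "(\<integral>x. indicator B x * h x \<partial>lborel) = 0" using boxes by auto
  next
    fix B :: "'a set" assume B: "B \<in> sigma_sets UNIV (range (\<lambda>(a, b). box a b))"
      "(\<integral>x. indicator B x * h x \<partial>lborel) = 0"
    have "(\<integral>x. indicator (UNIV - B) x * h x \<partial>lborel) = (\<integral>x. h x - indicator B x * h x \<partial>lborel)"
      by (rule Bochner_Integration.integral_cong) (auto simp: indicator_def)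
    also have "\<dots> = 0"
      using h ind[of B] B whole by (simp add: sets)
    finally show "(\<integral>x. indicator (UNIV - B) x * h x \<partial>lborel) = 0" .
  next
    fix B :: "nat \<Rightarrow> 'a set"
    assume B: "disjoint_family B" "range B \<subseteq> sigma_sets UNIV (range (\<lambda>(a, b). box a b))"
      and IH: "\<And>i. (\<integral>x. indicator (B i) x * h x \<partial>lborel) = 0"
    have "(\<integral>x\<in>(\<Union>i. B i). h x \<partial>lborel) = (\<Sum>i. (\<integral>x\<in>(B i). h x \<partial>lborel))"
    proof (rule lebesgue_integral_countable_add)
      show "B i \<in> sets lborel" for i using B(2) by (auto simp: sets)
      then have "(\<Union>i. B i) \<in> sets borel" by auto
      then show "set_integrable lborel (\<Union>i. B i) h"
        using ind unfolding set_integrable_def by simp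
    qed (use B(1) in \<open>auto simp: disjoint_family_on_def\<close>)
    then show "(\<integral>x. indicator (\<Union>i. B i) x * h x \<partial>lborel) = 0"
      using IH by (simp add: set_lebesgue_integral_def)
  qed simp
  then show "(\<integral>x\<in>A. h x \<partial>lborel) = (\<integral>x\<in>A. 0 \<partial>lborel)"
    by (simp add: set_lebesgue_integral_def)
qed

text \<open>
  A Borel representative \<open>g\<close> of \<open>w\<close> integrates to \<open>0\<close> over every box with closure in the domain,
  because test functions approximate the indicators of such boxes boundedly.  Intersections of boxes
  are boxes, so the criterion above applies to \<open>g\<close> restricted to one box, and countably many boxes
  cover the domain.
\<close>

lemma fundamental_lemma_variations:
  fixes w :: "'a::euclidean_space \<Rightarrow> real"
  assumes \<Omega>: "open \<Omega>" and w: "integrable (lebesgue_on \<Omega>) w"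
    and test: "\<And>\<phi>. \<phi> \<in> Cc_inf \<Omega> \<Longrightarrow> (\<integral>x. w x * \<phi> x \<partial>lebesgue_on \<Omega>) = 0"
  shows "AE x in lebesgue_on \<Omega>. w x = 0"
proof -
  have \<Omega>_sets: "\<Omega> \<in> sets lebesgue" "\<Omega> \<in> sets borel" using \<Omega> by auto
  have wm: "(\<lambda>x. if x \<in> \<Omega> then w x else 0) \<in> borel_measurable lebesgue"
    using w by (simp add: borel_measurable_if_lebesgue_on borel_measurable_if \<Omega>_sets borel_measurable_integrable)
  then obtain g where g: "g \<in> borel_measurable lborel"
      and gw: "AE x in lborel. (if x \<in> \<Omega> then w x else 0) = g x"
    using completion_ex_borel_measurable_real by blast
  have [measurable]: "g \<in> borel_measurable borel" using g by simp
  have gwL: "AE x in lebesgue. (if x \<in> \<Omega> then w x else 0) = g x"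
    using gw by (rule AE_completion)
  have wL: "integrable lebesgue (\<lambda>x. if x \<in> \<Omega> then w x else 0)"
    using Lebesgue_Measure.integrable_restrict_UNIV[OF \<Omega>_sets(1), of w] w by simp
  have "integrable lebesgue g"
    by (rule integrable_cong_AE_imp[OF wL]) (use gwL in \<open>auto intro: measurable_completion\<close>)
  then have gi: "integrable lborel g" by (simp add: integrable_completion)
  have test': "(\<integral>x. g x * \<phi> x \<partial>lborel) = 0" if \<phi>: "\<phi> \<in> Cc_inf \<Omega>" for \<phi>
  proof -
    have \<phi>m: "\<phi> \<in> borel_measurable borel"
      using Ck_on_continuous[OF Cc_inf_Ck[OF \<phi>]] by (rule borel_measurable_continuous_onI)
    have "(\<integral>x. g x * \<phi> x \<partial>lborel) = (\<integral>x. g x * \<phi> x \<partial>lebesgue)"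
      using \<phi>m by (subst integral_completion) auto
    also have "\<dots> = (\<integral>x. (if x \<in> \<Omega> then w x else 0) * \<phi> x \<partial>lebesgue)"
    proof (rule integral_cong_AE)
      have \<phi>L: "\<phi> \<in> borel_measurable lebesgue" using \<phi>m by (simp add: measurable_completion)
      show "(\<lambda>x. g x * \<phi> x) \<in> borel_measurable lebesgue"
        by (rule borel_measurable_times[OF measurable_completion[OF g] \<phi>L])
      show "(\<lambda>x. (if x \<in> \<Omega> then w x else 0) * \<phi> x) \<in> borel_measurable lebesgue"
        by (rule borel_measurable_times[OF wm \<phi>L])
      show "AE x in lebesgue. g x * \<phi> x = (if x \<in> \<Omega> then w x else 0) * \<phi> x"
        using gwL by eventually_elim simp
    qed
    also have "\<dots> = (\<integral>x. (if x \<in> \<Omega> then w x * \<phi> x else 0) \<partial>lebesgue)"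
      by (rule Bochner_Integration.integral_cong) auto
    also have "\<dots> = (\<integral>x. w x * \<phi> x \<partial>lebesgue_on \<Omega>)"
      by (rule Lebesgue_Measure.integral_restrict_UNIV[OF \<Omega>_sets(1)])
    finally show ?thesis using test[OF \<phi>] by simp
  qed
  have box0: "(\<integral>x. indicator (box a b) x * g x \<partial>lborel) = 0" if ab: "cbox a b \<subseteq> \<Omega>" for a b
  proof -
    have [measurable]: "box_bump a b n \<in> borel_measurable borel" for n
      using Ck_on_continuous[OF Cc_inf_Ck[OF box_bump_Cc_inf[OF ab]]] by (rule borel_measurable_continuous_onI)
    have "(\<lambda>n. \<integral>x. g x * box_bump a b n x \<partial>lborel) \<longlonglongrightarrow> (\<integral>x. g x * indicator (box a b) x \<partial>lborel)"
    proof (rule integral_dominated_convergence[where w="\<lambda>x. \<bar>g x\<bar>"])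
      show "AE x in lborel. (\<lambda>n. g x * box_bump a b n x) \<longlonglongrightarrow> g x * indicator (box a b) x"
        by (intro AE_I2 tendsto_mult tendsto_const box_bump_tendsto)
      show "AE x in lborel. norm (g x * box_bump a b n x) \<le> \<bar>g x\<bar>" for n
        using box_bump_bounds[of a b n] by (intro AE_I2) (simp add: abs_mult mult_left_le)
    qed (use gi in auto)
    then show ?thesis
      using test'[OF box_bump_Cc_inf[OF ab]] by (simp add: LIMSEQ_const_iff mult.commute)
  qed
  have g0: "AE x in lborel. x \<in> cbox a b \<longrightarrow> g x = 0" if ab: "cbox a b \<subseteq> \<Omega>" for a b
  proof -
    have "AE x in lborel. indicator (box a b) x * g x = 0"
    proof (rule AE_zero_if_box_integrals_zero)
      show "integrable lborel (\<lambda>x. indicator (box a b) x * g x)"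
        using integrable_mult_indicator[OF _ gi, of "box a b"] by simp
      show "(\<integral>x. indicator (box a b) x * g x \<partial>lborel) = 0" by (rule box0[OF ab])
      fix c d :: 'a
      obtain p q where pq: "box c d \<inter> box a b = box p q" "cbox c d \<inter> cbox a b = cbox p q"
        using box_Int_box[of c d a b] Int_interval[of c d a b] by metis
      have "(\<integral>x. indicator (box c d) x * (indicator (box a b) x * g x) \<partial>lborel)
          = (\<integral>x. indicator (box p q) x * g x \<partial>lborel)"
        by (rule Bochner_Integration.integral_cong) (auto simp: pq(1)[symmetric] indicator_def)
      also have "\<dots> = 0" using ab pq(2) by (intro box0) blast
      finally show "(\<integral>x. indicator (box c d) x * (indicator (box a b) x * g x) \<partial>lborel) = 0" .
    qed
    moreover have "AE x in lborel. x \<notin> cbox a b - box a b"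
      using negligible_frontier_interval[of a b]
      by (intro AE_not_in) (simp add: negligible_iff_null_sets null_sets_completion_iff)
    ultimately show ?thesis by eventually_elim (auto simp: indicator_def)
  qed
  obtain \<D> where D: "countable \<D>" "\<D> \<subseteq> Pow \<Omega>" "\<And>X. X \<in> \<D> \<Longrightarrow> \<exists>a b. X = cbox a b" "\<Union>\<D> = \<Omega>"
    using open_countable_Union_open_cbox[OF \<Omega>] by metis
  have "AE x in lborel. \<forall>X\<in>\<D>. x \<in> X \<longrightarrow> g x = 0"
    unfolding AE_ball_countable[OF D(1)]
  proof
    fix X assume X: "X \<in> \<D>"
    then obtain a b where ab: "X = cbox a b" using D(3) by blast
    show "AE x in lborel. x \<in> X \<longrightarrow> g x = 0"
      unfolding ab by (rule g0) (use X ab D(2) in auto)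
  qed
  then have "AE x in lborel. x \<in> \<Omega> \<longrightarrow> g x = 0"
    by eventually_elim (use D(4) in blast)
  then have "AE x in lebesgue. x \<in> \<Omega> \<longrightarrow> g x = 0" by (rule AE_completion)
  with gwL have "AE x in lebesgue. x \<in> \<Omega> \<longrightarrow> w x = 0"
    by eventually_elim auto
  then show ?thesis using \<Omega>_sets by (simp add: AE_restrict_space_iff)
qed

section \<open>Weak derivatives on a bounded open set\<close>

definition gradient :: "('a::euclidean_space \<Rightarrow> real) \<Rightarrow> 'a \<Rightarrow> 'a" where
  "gradient f x = (\<Sum>i\<in>Basis. partial i f x *\<^sub>R i)"

lemma gradient_inner: "i \<in> Basis \<Longrightarrow> gradient f x \<bullet> i = partial i f x"
  by (simp add: gradient_def)

lemma power2_norm_coords: "(norm x)\<^sup>2 = (\<Sum>i\<in>Basis. (x \<bullet> i)\<^sup>2)" for x :: "'a::euclidean_space"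
  by (subst power2_norm_eq_inner, subst euclidean_inner) (simp add: power2_eq_square)

locale bounded_open =
  fixes \<Omega> :: "'a::euclidean_space set"
  assumes open_dom: "open \<Omega>" and bounded_dom: "bounded \<Omega>"
begin

abbreviation "\<mu> \<equiv> lebesgue_on \<Omega>"

lemma dom_sets: "\<Omega> \<in> sets lebesgue"
  using open_dom by auto

sublocale finite_measure "lebesgue_on \<Omega>"
  by (rule finite_measure_lebesgue_on) (use open_dom bounded_dom in \<open>auto intro: bounded_set_imp_lmeasurable\<close>)

lemma continuous_bounded_on_dom:
  fixes f :: "'a \<Rightarrow> real"
  assumes "continuous_on UNIV f"
  obtains C where "0 < C" "\<And>x. x \<in> \<Omega> \<Longrightarrow> \<bar>f x\<bar> \<le> C"
proof -
  have "compact (f ` closure \<Omega>)"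
    using assms bounded_dom by (meson compact_closure compact_continuous_image continuous_on_subset subset_UNIV)
  then obtain C where "0 < C" "\<And>y. y \<in> f ` closure \<Omega> \<Longrightarrow> norm y \<le> C"
    using compact_imp_bounded bounded_pos by metis
  then show thesis using that closure_subset[of \<Omega>] by (metis image_eqI real_norm_def subsetD)
qed

lemma continuous_in_L2:
  fixes f :: "'a \<Rightarrow> real"
  assumes "continuous_on UNIV f"
  shows "f \<in> L2 \<mu>"
proof -
  obtain C where "0 < C" "\<And>x. x \<in> \<Omega> \<Longrightarrow> \<bar>f x\<bar> \<le> C" using continuous_bounded_on_dom[OF assms] by metis
  then show ?thesis
    using continuous_imp_lebesgue_on_measurable[OF assms] by (intro bounded_in_L2) auto
qed

lemma L2_mult_continuous:
  fixes g :: "'a \<Rightarrow> real"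
  assumes "f \<in> L2 \<mu>" "continuous_on UNIV g"
  shows "(\<lambda>x. f x * g x) \<in> L2 \<mu>"
proof -
  obtain C where "0 < C" "\<And>x. x \<in> \<Omega> \<Longrightarrow> \<bar>g x\<bar> \<le> C" using continuous_bounded_on_dom[OF assms(2)] by metis
  then show ?thesis
    using continuous_imp_lebesgue_on_measurable[OF assms(2)] by (intro L2_bounded_mult[OF assms(1)]) auto
qed

lemma Ck_in_L2: "Ck_on k UNIV f \<Longrightarrow> f \<in> L2 \<mu>"
  using Ck_on_continuous continuous_in_L2 by blast

lemma Cc_inf_in_L2: "\<phi> \<in> Cc_inf U \<Longrightarrow> \<phi> \<in> L2 \<mu>"
  using Cc_inf_Ck Ck_in_L2 by blast

lemma L2_eq_if_weakly_eq:
  assumes "w \<in> L2 \<mu>" "w' \<in> L2 \<mu>"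
    and "\<And>\<phi>. \<phi> \<in> Cc_inf \<Omega> \<Longrightarrow> L2_inner \<mu> w \<phi> = L2_inner \<mu> w' \<phi>"
  shows "AE x in \<mu>. w x = w' x"
proof -
  have "AE x in \<mu>. w x - w' x = 0"
  proof (rule fundamental_lemma_variations[OF open_dom])
    show "integrable \<mu> (\<lambda>x. w x - w' x)" by (rule L2_integrable[OF L2_diff[OF assms(1,2)]])
    show "(\<integral>x. (w x - w' x) * \<phi> x \<partial>\<mu>) = 0" if "\<phi> \<in> Cc_inf \<Omega>" for \<phi>
      using L2_inner_diff[OF assms(1,2) Cc_inf_in_L2[OF that]] assms(3)[OF that]
      by (simp add: L2_inner_def)
  qed
  then show ?thesis by simp
qed

text \<open>
  The Riesz sequence of the functional \<open>\<phi> \<mapsto> \<langle>f, \<phi>\<rangle>\<close> on the test functions converges by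
  completeness, and its limit is \<open>f\<close> by the fundamental lemma.
\<close>

lemma Cc_inf_dense:
  assumes f: "f \<in> L2 \<mu>"
  obtains \<phi> where "\<And>n. \<phi> n \<in> Cc_inf \<Omega>" "L2_tendsto \<mu> \<phi> f"
proof -
  have L: "u \<in> L2 \<mu>" if "u \<in> Cc_inf \<Omega>" for u using Cc_inf_in_L2[OF that] .
  obtain \<phi> where \<phi>: "\<And>n. \<phi> n \<in> Cc_inf \<Omega>"
    and C: "\<And>e. e > 0 \<Longrightarrow> \<exists>N. \<forall>m\<ge>N. \<forall>n\<ge>N. L2_inner \<mu> (\<lambda>x. \<phi> m x - \<phi> n x) (\<lambda>x. \<phi> m x - \<phi> n x) < e"
    and lim: "\<And>u. u \<in> Cc_inf \<Omega> \<Longrightarrow> (\<lambda>n. L2_inner \<mu> (\<phi> n) u) \<longlonglongrightarrow> L2_inner \<mu> f u"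
  proof (rule Riesz_minimising_sequence[of "Cc_inf \<Omega>" "L2_inner \<mu>" "L2_inner \<mu> f" "L2_inner \<mu> f f"])
    show "Cc_inf \<Omega> \<noteq> {}" using Cc_inf_zero by blast
    show "(\<lambda>x. u x + t * v x) \<in> Cc_inf \<Omega>" if "u \<in> Cc_inf \<Omega>" "v \<in> Cc_inf \<Omega>" for u v t
      using that by (rule Cc_inf_axpy)
    show "L2_inner \<mu> (\<lambda>x. u x + t * v x) w = L2_inner \<mu> u w + t * L2_inner \<mu> v w"
      if "u \<in> Cc_inf \<Omega>" "v \<in> Cc_inf \<Omega>" "w \<in> Cc_inf \<Omega>" for u v w t
      by (rule L2_inner_axpy[OF that[THEN L]])
    show "L2_inner \<mu> u v = L2_inner \<mu> v u" for u v by (rule L2_inner_commute)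
    show "0 \<le> L2_inner \<mu> u u" for u by (rule L2_inner_self_nonneg)
    show "L2_inner \<mu> f (\<lambda>x. u x + t * v x) = L2_inner \<mu> f u + t * L2_inner \<mu> f v"
      if "u \<in> Cc_inf \<Omega>" "v \<in> Cc_inf \<Omega>" for u v t
      by (rule L2_inner_axpy_right[OF that[THEN L] f])
    show "(L2_inner \<mu> f u)\<^sup>2 \<le> L2_inner \<mu> f f * L2_inner \<mu> u u" if "u \<in> Cc_inf \<Omega>" for u
    proof -
      have "\<bar>L2_inner \<mu> f u\<bar>\<^sup>2 \<le> (L2_norm \<mu> f * L2_norm \<mu> u)\<^sup>2"
        by (intro power_mono L2_Cauchy_Schwarz f L that) simp
      then show ?thesis by (simp add: power_mult_distrib L2_norm_power2)
    qed
  qed blast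
  have "L2_Cauchy \<mu> \<phi>" unfolding L2_Cauchy_def using C L[OF \<phi>] by blast
  then obtain g where g: "L2_tendsto \<mu> \<phi> g" by (rule L2_complete)
  then have gL: "g \<in> L2 \<mu>" by (simp add: L2_tendsto_def)
  have "AE x in \<mu>. f x = g x"
  proof (rule L2_eq_if_weakly_eq[OF f gL])
    fix u assume u: "u \<in> Cc_inf \<Omega>"
    show "L2_inner \<mu> f u = L2_inner \<mu> g u"
      using lim[OF u] L2_tendsto_inner[OF g L[OF u]] by (rule LIMSEQ_unique)
  qed
  then have "L2_inner \<mu> (\<lambda>x. \<phi> n x - f x) (\<lambda>x. \<phi> n x - f x)
      = L2_inner \<mu> (\<lambda>x. \<phi> n x - g x) (\<lambda>x. \<phi> n x - g x)" for n
    using L2_diff[OF L[OF \<phi>] f, THEN L2_measurable] L2_diff[OF L[OF \<phi>] gL, THEN L2_measurable]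
    by (intro L2_inner_cong_AE) auto
  then have "L2_tendsto \<mu> \<phi> f"
    using g f by (simp add: L2_tendsto_iff)
  then show thesis using \<phi> that by blast
qed

lemma is_weak_grad_unique:
  assumes "is_weak_grad \<Omega> u G" "is_weak_grad \<Omega> u G'"
  shows "AE x in \<mu>. G x = G' x"
proof -
  have "AE x in \<mu>. \<forall>i\<in>Basis. G x \<bullet> i = G' x \<bullet> i"
  proof (rule AE_finite_allI)
    fix i :: 'a assume i: "i \<in> Basis"
    show "AE x in \<mu>. G x \<bullet> i = G' x \<bullet> i"
    proof (rule L2_eq_if_weakly_eq)
      show "(\<lambda>x. G x \<bullet> i) \<in> L2 \<mu>" "(\<lambda>x. G' x \<bullet> i) \<in> L2 \<mu>"
        using assms i by (auto simp: is_weak_grad_def)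
      fix \<phi> assume "\<phi> \<in> Cc_inf \<Omega>"
      then have "- (\<integral>x. (G x \<bullet> i) * \<phi> x \<partial>\<mu>) = - (\<integral>x. (G' x \<bullet> i) * \<phi> x \<partial>\<mu>)"
        using assms i unfolding is_weak_grad_def by metis
      then show "L2_inner \<mu> (\<lambda>x. G x \<bullet> i) \<phi> = L2_inner \<mu> (\<lambda>x. G' x \<bullet> i) \<phi>"
        by (simp add: L2_inner_def)
    qed
  qed simp
  then show ?thesis by eventually_elim (blast intro: euclidean_eqI)
qed

lemma is_weak_grad_weak_grad:
  assumes "is_weak_grad \<Omega> u G"
  shows "is_weak_grad \<Omega> u (weak_grad \<Omega> u)"
  unfolding weak_grad_def by (rule someI[of "is_weak_grad \<Omega> u", OF assms])

lemma weak_grad_AE: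
  assumes "is_weak_grad \<Omega> u G"
  shows "AE x in \<mu>. weak_grad \<Omega> u x = G x"
  by (rule is_weak_grad_unique[OF is_weak_grad_weak_grad[OF assms] assms])

lemma is_weak_lap_unique:
  assumes "is_weak_lap \<Omega> u w" "is_weak_lap \<Omega> u w'"
  shows "AE x in \<mu>. w x = w' x"
  by (rule L2_eq_if_weakly_eq) (use assms in \<open>auto simp: is_weak_lap_def L2_inner_def\<close>)

lemma is_weak_lap_weak_lap:
  assumes "is_weak_lap \<Omega> u w"
  shows "is_weak_lap \<Omega> u (weak_lap \<Omega> u)"
  unfolding weak_lap_def by (rule someI[of "is_weak_lap \<Omega> u", OF assms])

lemma weak_lap_AE:
  assumes "is_weak_lap \<Omega> u w"
  shows "AE x in \<mu>. weak_lap \<Omega> u x = w x"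
  by (rule is_weak_lap_unique[OF is_weak_lap_weak_lap[OF assms] assms])

lemma weak_lap_in_L2:
  assumes "u \<in> H0_lap \<Omega>"
  shows "weak_lap \<Omega> u \<in> L2 \<mu>"
proof -
  obtain w where "is_weak_lap \<Omega> u w" using assms unfolding H0_lap_def by blast
  from is_weak_lap_weak_lap[OF this] show ?thesis unfolding is_weak_lap_def by blast
qed

text \<open>
  The norm is defined through one chosen weak gradient; any other one may be used to compute it.
\<close>

lemma H1_norm_eq:
  assumes u: "u \<in> L2 \<mu>" and G: "is_weak_grad \<Omega> u G"
  shows "H1_norm \<Omega> u = sqrt (L2_inner \<mu> u u + (\<Sum>i\<in>Basis. L2_inner \<mu> (\<lambda>x. G x \<bullet> i) (\<lambda>x. G x \<bullet> i)))"
proof -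
  let ?W = "weak_grad \<Omega> u"
  have W: "(\<lambda>x. ?W x \<bullet> i) \<in> L2 \<mu>" if "i \<in> Basis" for i
    using is_weak_grad_weak_grad[OF G] that by (simp add: is_weak_grad_def)
  have G2: "(\<lambda>x. G x \<bullet> i) \<in> L2 \<mu>" if "i \<in> Basis" for i
    using G that by (simp add: is_weak_grad_def)
  have "(\<integral>x. (u x)\<^sup>2 + (norm (?W x))\<^sup>2 \<partial>\<mu>) = (\<integral>x. (u x)\<^sup>2 + (\<Sum>i\<in>Basis. (?W x \<bullet> i)\<^sup>2) \<partial>\<mu>)"
    by (simp only: power2_norm_coords)
  also have "\<dots> = (\<integral>x. (u x)\<^sup>2 \<partial>\<mu>) + (\<Sum>i\<in>Basis. \<integral>x. (?W x \<bullet> i)\<^sup>2 \<partial>\<mu>)"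
    using L2_square_integrable[OF u] L2_square_integrable[OF W]
    by (simp add: Bochner_Integration.integral_sum)
  also have "(\<Sum>i\<in>Basis. \<integral>x. (?W x \<bullet> i)\<^sup>2 \<partial>\<mu>) = (\<Sum>i\<in>Basis. L2_inner \<mu> (\<lambda>x. G x \<bullet> i) (\<lambda>x. G x \<bullet> i))"
  proof (rule sum.cong[OF refl])
    fix i :: 'a assume i: "i \<in> Basis"
    have "AE x in \<mu>. ?W x \<bullet> i = G x \<bullet> i" using weak_grad_AE[OF G] by eventually_elim simp
    then have "L2_inner \<mu> (\<lambda>x. ?W x \<bullet> i) (\<lambda>x. ?W x \<bullet> i) = L2_inner \<mu> (\<lambda>x. G x \<bullet> i) (\<lambda>x. G x \<bullet> i)"
      by (intro L2_inner_cong_AE L2_measurable W G2 i)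
    then show "(\<integral>x. (?W x \<bullet> i)\<^sup>2 \<partial>\<mu>) = L2_inner \<mu> (\<lambda>x. G x \<bullet> i) (\<lambda>x. G x \<bullet> i)"
      by (simp add: L2_inner_def power2_eq_square)
  qed
  finally show ?thesis unfolding H1_norm_def by (simp add: L2_inner_def power2_eq_square)
qed

lemma by_parts_Cc_inf:
  assumes "Ck_on 1 UNIV f" "\<phi> \<in> Cc_inf \<Omega>" "i \<in> Basis"
  shows "L2_inner \<mu> f (partial i \<phi>) = - L2_inner \<mu> (partial i f) \<phi>"
proof -
  obtain K where K: "compact K" "K \<subseteq> \<Omega>" "\<And>x. x \<notin> K \<Longrightarrow> \<phi> x = 0" using Cc_infE[OF assms(2)] by metis
  from integral_by_parts[OF Cc_inf_Ck[OF assms(2)] assms(1) K dom_sets assms(3)]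
  show ?thesis by (simp add: L2_inner_def mult.commute)
qed

lemma is_weak_grad_gradient:
  assumes "Ck_on 1 UNIV f"
  shows "is_weak_grad \<Omega> f (gradient f)"
  unfolding is_weak_grad_def
proof (intro ballI conjI)
  fix i :: 'a assume i: "i \<in> Basis"
  have "continuous_on UNIV (partial i f)" using assms i by simp
  then show "(\<lambda>x. gradient f x \<bullet> i) \<in> L2 \<mu>" by (simp add: gradient_inner i continuous_in_L2)
  fix \<phi> assume "\<phi> \<in> Cc_inf \<Omega>"
  from by_parts_Cc_inf[OF assms this i]
  show "(\<integral>x. f x * partial i \<phi> x \<partial>\<mu>) = - (\<integral>x. (gradient f x \<bullet> i) * \<phi> x \<partial>\<mu>)"
    by (simp add: L2_inner_def gradient_inner i)
qed

lemma Ck_in_H1: "Ck_on 1 UNIV f \<Longrightarrow> f \<in> H1 \<Omega>"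
  unfolding H1_def using is_weak_grad_gradient Ck_in_L2 by blast

lemma L2_inner_classical_lap:
  assumes "f \<in> L2 \<mu>" "Ck_on 2 UNIV \<psi>"
  shows "L2_inner \<mu> f (classical_lap \<psi>) = (\<Sum>i\<in>Basis. L2_inner \<mu> f (partial i (partial i \<psi>)))"
proof -
  have 2: "2 = Suc (Suc 0)" by simp
  have p: "partial i (partial i \<psi>) \<in> L2 \<mu>" if "i \<in> Basis" for i
    using Ck_on_partial[OF Ck_on_partial[OF assms(2)[unfolded 2]]] that Ck_in_L2 by blast
  have "L2_inner \<mu> (\<lambda>x. \<Sum>i\<in>Basis. 1 * partial i (partial i \<psi>) x) f = (\<Sum>i\<in>Basis. 1 * L2_inner \<mu> (partial i (partial i \<psi>)) f)"
    by (rule L2_inner_sum[OF p assms(1)])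
  then show ?thesis
    by (simp add: classical_lap_def[abs_def] L2_inner_commute[of \<mu> f])
qed

lemma Green_compact_support:
  assumes f: "Ck_on 2 UNIV f" and K: "compact K" "K \<subseteq> \<Omega>" "\<And>x. x \<notin> K \<Longrightarrow> f x = 0" and \<psi>: "Ck_on 2 UNIV \<psi>"
  shows "L2_inner \<mu> f (classical_lap \<psi>) = L2_inner \<mu> (classical_lap f) \<psi>"
proof -
  have 2: "2 = Suc 1" by simp
  have C1: "Ck_on 1 UNIV f" "Ck_on 1 UNIV \<psi>" using f \<psi> Ck_on_SucD unfolding 2 by blast+
  have "L2_inner \<mu> f (partial i (partial i \<psi>)) = L2_inner \<mu> (partial i (partial i f)) \<psi>" if i: "i \<in> Basis" for i
  proof -
    have p: "Ck_on 1 UNIV (partial i f)" "Ck_on 1 UNIV (partial i \<psi>)"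
      using Ck_on_partial[OF f[unfolded 2] i] Ck_on_partial[OF \<psi>[unfolded 2] i] .
    have p0: "partial i f x = 0" if "x \<notin> K" for x
      using compact_imp_closed[OF K(1)] K(3) that by (rule partial_zero_outside)
    have "L2_inner \<mu> f (partial i (partial i \<psi>)) = - L2_inner \<mu> (partial i f) (partial i \<psi>)"
      unfolding L2_inner_def by (rule integral_by_parts[OF C1(1) p(2) K dom_sets i])
    also have "\<dots> = L2_inner \<mu> (partial i (partial i f)) \<psi>"
      unfolding L2_inner_def using integral_by_parts[OF p(1) C1(2) K(1,2) p0 dom_sets i] by simp
    finally show ?thesis .
  qed
  then show ?thesis
    using L2_inner_classical_lap[OF Ck_in_L2[OF f] \<psi>] L2_inner_classical_lap[OF Ck_in_L2[OF \<psi>] f]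
    by (simp add: L2_inner_commute[of \<mu> \<psi>])
qed

lemma is_weak_lap_Cc_inf:
  assumes "f \<in> Cc_inf \<Omega>"
  shows "is_weak_lap \<Omega> f (classical_lap f)"
proof -
  obtain K where K: "compact K" "K \<subseteq> \<Omega>" "\<And>x. x \<notin> K \<Longrightarrow> f x = 0" using Cc_infE[OF assms] by metis
  show ?thesis
    unfolding is_weak_lap_def
    using Green_compact_support[OF Cc_inf_Ck[OF assms] K Cc_inf_Ck] Cc_inf_in_L2[OF Cc_inf_lap[OF assms]]
    by (simp add: L2_inner_def)
qed

lemma H1_tendsto_const:
  assumes "f \<in> H1 \<Omega>"
  shows "H1_tendsto \<Omega> (\<lambda>n. f) f"
proof -
  have "is_weak_grad \<Omega> (\<lambda>x. 0) (\<lambda>x. 0)"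
    by (simp add: is_weak_grad_def)
  then have "H1_norm \<Omega> (\<lambda>x. 0) = 0"
    using H1_norm_eq[of "\<lambda>x. 0" "\<lambda>x. 0"] by (simp add: L2_inner_def)
  then show ?thesis using assms by (simp add: H1_tendsto_def)
qed

lemma Cc_inf_in_H0_lap:
  assumes "f \<in> Cc_inf \<Omega>"
  shows "f \<in> H0_lap \<Omega>"
proof -
  have "f \<in> H10 \<Omega>"
    unfolding H10_def using assms H1_tendsto_const[OF Ck_in_H1[OF Cc_inf_Ck[OF assms]]]
    by (intro CollectI exI[of _ "\<lambda>n. f"]) simp
  then show ?thesis unfolding H0_lap_def using is_weak_lap_Cc_inf[OF assms] by blast
qed

end

section \<open>The Poincare inequality and the Dirichlet problem for the Laplacian\<close>

context bounded_open
begin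

text \<open>
  Integrating \<open>\<phi>\<^sup>2 = \<phi>\<^sup>2 \<partial>\<^sub>i x\<^sub>i\<close> by parts produces the factor \<open>x\<^sub>i\<close>, which is bounded on the domain.
\<close>

lemma Poincare_inequality:
  obtains C where "\<And>\<phi> i. \<phi> \<in> Cc_inf \<Omega> \<Longrightarrow> i \<in> Basis \<Longrightarrow>
    L2_inner \<mu> \<phi> \<phi> \<le> C * L2_inner \<mu> (partial i \<phi>) (partial i \<phi>)"
proof -
  obtain R where R: "\<And>x. x \<in> \<Omega> \<Longrightarrow> norm x \<le> R"
    using bounded_dom bounded_iff by metis
  have "L2_inner \<mu> \<phi> \<phi> \<le> (4 * R\<^sup>2) * L2_inner \<mu> (partial i \<phi>) (partial i \<phi>)"
    if \<phi>: "\<phi> \<in> Cc_inf \<Omega>" and i: "i \<in> Basis" for \<phi> i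
  proof -
    let ?p = "partial i \<phi>"
    have d: "\<phi> differentiable (at x)" for x using Cc_inf_Ck[OF \<phi>, of 1] by simp
    have L: "\<phi> \<in> L2 \<mu>" "?p \<in> L2 \<mu>" using \<phi> Cc_inf_partial[OF \<phi> i] Cc_inf_in_L2 by blast+
    obtain K where K: "compact K" "K \<subseteq> \<Omega>" "\<And>x. x \<notin> K \<Longrightarrow> \<phi> x = 0" using Cc_infE[OF \<phi>] by metis
    have "(\<integral>x. (\<phi> x * \<phi> x) * partial i (\<lambda>x. x \<bullet> i) x \<partial>\<mu>)
        = - (\<integral>x. partial i (\<lambda>x. \<phi> x * \<phi> x) x * (x \<bullet> i) \<partial>\<mu>)"
      by (rule integral_by_parts[OF Ck_on_mult[OF Cc_inf_Ck Cc_inf_Ck] Ck_on_inner K(1,2) _ dom_sets i])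
         (use \<phi> K(3) in auto)
    then have "L2_inner \<mu> \<phi> \<phi> = (\<integral>x. - (2 * \<phi> x * ?p x * (x \<bullet> i)) \<partial>\<mu>)"
      using i by (simp add: L2_inner_def partial_inner partial_mult[OF d d] algebra_simps)
    also have "\<dots> \<le> (\<integral>x. (1/2) * (\<phi> x * \<phi> x) + (2 * R\<^sup>2) * (?p x * ?p x) \<partial>\<mu>)"
    proof (rule integral_mono)
      have "continuous_on UNIV (\<lambda>x. x \<bullet> i)" by (intro continuous_intros)
      from integrable_mult_right[OF L2_mult_integrable[OF L(1) L2_mult_continuous[OF L(2) this]], of "-2"]
      show "integrable \<mu> (\<lambda>x. - (2 * \<phi> x * ?p x * (x \<bullet> i)))" by (simp add: mult.assoc)
      show "integrable \<mu> (\<lambda>x. (1/2) * (\<phi> x * \<phi> x) + (2 * R\<^sup>2) * (?p x * ?p x))"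
        using L2_mult_integrable[OF L(1) L(1)] L2_mult_integrable[OF L(2) L(2)] by simp
      fix x assume "x \<in> space \<mu>"
      then have "norm x \<le> R" using R by simp
      then have "\<bar>x \<bullet> i\<bar> \<le> R" using Basis_le_norm[OF i, of x] by linarith
      then have xR: "(x \<bullet> i)\<^sup>2 \<le> R\<^sup>2" using abs_le_square_iff[of "x \<bullet> i" R] by simp
      \<comment> \<open>The weights leave half of \<open>\<phi>\<^sup>2\<close>, which is absorbed by the left-hand side.\<close>
      have "0 \<le> (\<phi> x + 2 * (?p x * (x \<bullet> i)))\<^sup>2" by simp
      then have "- (2 * \<phi> x * ?p x * (x \<bullet> i)) \<le> (1/2) * (\<phi> x * \<phi> x) + 2 * ((x \<bullet> i)\<^sup>2 * (?p x * ?p x))"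
        by (simp add: power2_eq_square algebra_simps)
      also have "\<dots> \<le> (1/2) * (\<phi> x * \<phi> x) + 2 * (R\<^sup>2 * (?p x * ?p x))"
        using mult_right_mono[OF xR, of "?p x * ?p x"] by simp
      finally show "- (2 * \<phi> x * ?p x * (x \<bullet> i)) \<le> (1/2) * (\<phi> x * \<phi> x) + (2 * R\<^sup>2) * (?p x * ?p x)"
        by simp
    qed
    also have "\<dots> = (1/2) * L2_inner \<mu> \<phi> \<phi> + (2 * R\<^sup>2) * L2_inner \<mu> ?p ?p"
      using L2_mult_integrable[OF L(1) L(1)] L2_mult_integrable[OF L(2) L(2)] by (simp add: L2_inner_def)
    finally show ?thesis by simp
  qed
  then show thesis using that by blast
qed

text \<open>
  The Riesz sequence \<open>v\<^sub>n\<close> for the Dirichlet form and the functional \<open>\<phi> \<mapsto> -\<langle>f, \<phi>\<rangle>\<close> is Cauchy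
  together with its first derivatives, by the Poincare inequality.  Keeping the sequence in the
  conclusion makes integration by parts against functions that do not vanish on the boundary
  available for the solution.
\<close>

theorem Dirichlet_problem_solvable:
  assumes f: "f \<in> L2 \<mu>"
  obtains b G v where "b \<in> H0_lap \<Omega>" "is_weak_lap \<Omega> b f" "is_weak_grad \<Omega> b G"
    "\<And>n. v n \<in> Cc_inf \<Omega>" "L2_tendsto \<mu> v b"
    "\<And>i. i \<in> Basis \<Longrightarrow> L2_tendsto \<mu> (\<lambda>n. partial i (v n)) (\<lambda>x. G x \<bullet> i)"
proof -
  define D where "D u v = (\<Sum>i\<in>Basis. L2_inner \<mu> (partial i u) (partial i v))" for u v
  define l where "l \<phi> = - L2_inner \<mu> f \<phi>" for \<phi>
  obtain C where C: "\<And>\<phi> i. \<phi> \<in> Cc_inf \<Omega> \<Longrightarrow> i \<in> Basis \<Longrightarrow>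
    L2_inner \<mu> \<phi> \<phi> \<le> C * L2_inner \<mu> (partial i \<phi>) (partial i \<phi>)" using Poincare_inequality by blast
  have L: "u \<in> L2 \<mu>" if "u \<in> Cc_inf \<Omega>" for u using Cc_inf_in_L2[OF that] .
  have Lp: "partial i u \<in> L2 \<mu>" if "u \<in> Cc_inf \<Omega>" "i \<in> Basis" for u i
    using Cc_inf_in_L2[OF Cc_inf_partial[OF that]] .
  have D_le: "L2_inner \<mu> (partial i u) (partial i u) \<le> D u u" if "i \<in> Basis" for i u
    unfolding D_def by (rule member_le_sum[OF that]) (auto intro: L2_inner_self_nonneg)
  have P: "L2_inner \<mu> u u \<le> \<bar>C\<bar> * D u u" if u: "u \<in> Cc_inf \<Omega>" for u
  proof -
    obtain i :: 'a where i: "i \<in> Basis" using nonempty_Basis by blast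
    have "L2_inner \<mu> u u \<le> C * L2_inner \<mu> (partial i u) (partial i u)" by (rule C[OF u i])
    also have "\<dots> \<le> \<bar>C\<bar> * L2_inner \<mu> (partial i u) (partial i u)"
      by (intro mult_right_mono L2_inner_self_nonneg) simp
    also have "\<dots> \<le> \<bar>C\<bar> * D u u" by (intro mult_left_mono D_le[OF i]) simp
    finally show ?thesis .
  qed
  have p_axpy: "partial i (\<lambda>x. u x + t * v x) = (\<lambda>x. partial i u x + t * partial i v x)"
    if u: "u \<in> Cc_inf \<Omega>" and v: "v \<in> Cc_inf \<Omega>" for u v t i
  proof
    fix x
    have d: "u differentiable (at x)" "v differentiable (at x)"
      using Cc_inf_Ck[OF u, of 1] Cc_inf_Ck[OF v, of 1] by simp_all
    have "partial i (\<lambda>x. t * v x) x = t * partial i v x"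
      using partial_mult[of "\<lambda>x. t" x v i] d by simp
    then show "partial i (\<lambda>x. u x + t * v x) x = partial i u x + t * partial i v x"
      using partial_add[of u x "\<lambda>x. t * v x" i] d by simp
  qed
  have p_diff: "partial i (\<lambda>x. u x - v x) = (\<lambda>x. partial i u x - partial i v x)"
    if "u \<in> Cc_inf \<Omega>" "v \<in> Cc_inf \<Omega>" for u v i
    using p_axpy[OF that, of i "-1"] by simp
  obtain v where v: "\<And>n. v n \<in> Cc_inf \<Omega>"
    and Cau: "\<And>e. e > 0 \<Longrightarrow> \<exists>N. \<forall>m\<ge>N. \<forall>n\<ge>N. D (\<lambda>x. v m x - v n x) (\<lambda>x. v m x - v n x) < e"
    and lim: "\<And>u. u \<in> Cc_inf \<Omega> \<Longrightarrow> (\<lambda>n. D (v n) u) \<longlonglongrightarrow> l u"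
  proof (rule Riesz_minimising_sequence[of "Cc_inf \<Omega>" D l "L2_inner \<mu> f f * \<bar>C\<bar>"])
    show "Cc_inf \<Omega> \<noteq> {}" using Cc_inf_zero by blast
    show "(\<lambda>x. u x + t * v x) \<in> Cc_inf \<Omega>" if "u \<in> Cc_inf \<Omega>" "v \<in> Cc_inf \<Omega>" for u v t
      using that by (rule Cc_inf_axpy)
    show "D (\<lambda>x. u x + t * v x) w = D u w + t * D v w"
      if "u \<in> Cc_inf \<Omega>" "v \<in> Cc_inf \<Omega>" "w \<in> Cc_inf \<Omega>" for u v w t
    proof -
      have "D (\<lambda>x. u x + t * v x) w = (\<Sum>i\<in>Basis. L2_inner \<mu> (partial i u) (partial i w)
          + t * L2_inner \<mu> (partial i v) (partial i w))"
        unfolding D_def p_axpy[OF that(1,2)]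
        by (intro sum.cong refl L2_inner_axpy Lp that)
      then show ?thesis by (simp add: D_def sum.distrib sum_distrib_left)
    qed
    show "D u v = D v u" for u v unfolding D_def by (simp only: L2_inner_commute)
    show "0 \<le> D u u" for u unfolding D_def by (intro sum_nonneg L2_inner_self_nonneg)
    show "l (\<lambda>x. u x + t * v x) = l u + t * l v"
      if "u \<in> Cc_inf \<Omega>" "v \<in> Cc_inf \<Omega>" for u v t
      using L2_inner_axpy_right[OF that[THEN L] f] by (simp add: l_def)
    show "(l u)\<^sup>2 \<le> L2_inner \<mu> f f * \<bar>C\<bar> * D u u" if u: "u \<in> Cc_inf \<Omega>" for u
    proof -
      have "\<bar>L2_inner \<mu> f u\<bar>\<^sup>2 \<le> (L2_norm \<mu> f * L2_norm \<mu> u)\<^sup>2"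
        by (intro power_mono L2_Cauchy_Schwarz f L u) simp
      also have "\<dots> = L2_inner \<mu> f f * L2_inner \<mu> u u"
        by (simp add: power_mult_distrib L2_norm_power2)
      also have "\<dots> \<le> L2_inner \<mu> f f * (\<bar>C\<bar> * D u u)"
        by (intro mult_left_mono P[OF u] L2_inner_self_nonneg)
      finally show ?thesis by (simp add: l_def)
    qed
  qed blast
  have vdiff: "(\<lambda>x. v m x - v n x) \<in> Cc_inf \<Omega>" for m n
    using Cc_inf_axpy[OF v v, of m "-1" n] by simp
  have Lv: "v n \<in> L2 \<mu>" for n using L[OF v] .
  have "L2_Cauchy \<mu> v"
    unfolding L2_Cauchy_def
  proof (intro conjI allI impI)
    fix e :: real assume "e > 0"
    then have "e / (\<bar>C\<bar> + 1) > 0" by simp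
    then obtain N where N: "\<And>m n. m \<ge> N \<Longrightarrow> n \<ge> N \<Longrightarrow>
        D (\<lambda>x. v m x - v n x) (\<lambda>x. v m x - v n x) < e / (\<bar>C\<bar> + 1)" using Cau by blast
    have "L2_inner \<mu> (\<lambda>x. v m x - v n x) (\<lambda>x. v m x - v n x) < e" if "m \<ge> N" "n \<ge> N" for m n
    proof -
      let ?d = "D (\<lambda>x. v m x - v n x) (\<lambda>x. v m x - v n x)"
      have "0 \<le> ?d" unfolding D_def by (intro sum_nonneg L2_inner_self_nonneg)
      then have "\<bar>C\<bar> * ?d \<le> (\<bar>C\<bar> + 1) * ?d" by (intro mult_right_mono) auto
      also have "\<dots> < e" using N[OF that] by (simp add: field_simps)
      finally show ?thesis using P[OF vdiff, of m n] by linarith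
    qed
    then show "\<exists>N. \<forall>m\<ge>N. \<forall>n\<ge>N. L2_inner \<mu> (\<lambda>x. v m x - v n x) (\<lambda>x. v m x - v n x) < e" by blast
  qed (rule Lv)
  then obtain b where b: "L2_tendsto \<mu> v b" by (rule L2_complete)
  have "\<exists>g. L2_tendsto \<mu> (\<lambda>n. partial i (v n)) g" if i: "i \<in> Basis" for i
  proof -
    have "L2_Cauchy \<mu> (\<lambda>n. partial i (v n))"
      unfolding L2_Cauchy_def
    proof (intro conjI allI impI)
      fix e :: real assume "e > 0"
      then obtain N where N: "\<And>m n. m \<ge> N \<Longrightarrow> n \<ge> N \<Longrightarrow>
          D (\<lambda>x. v m x - v n x) (\<lambda>x. v m x - v n x) < e" using Cau by blast
      have "L2_inner \<mu> (\<lambda>x. partial i (v m) x - partial i (v n) x) (\<lambda>x. partial i (v m) x - partial i (v n) x) < e"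
        if "m \<ge> N" "n \<ge> N" for m n
        using D_le[OF i, of "\<lambda>x. v m x - v n x"] N[OF that] unfolding p_diff[OF v v] by linarith
      then show "\<exists>N. \<forall>m\<ge>N. \<forall>n\<ge>N. L2_inner \<mu> (\<lambda>x. partial i (v m) x - partial i (v n) x)
          (\<lambda>x. partial i (v m) x - partial i (v n) x) < e" by blast
    qed (rule Lp[OF v i])
    then show ?thesis using L2_complete by blast
  qed
  then obtain g where g: "\<And>i. i \<in> Basis \<Longrightarrow> L2_tendsto \<mu> (\<lambda>n. partial i (v n)) (g i)" by metis
  define G where "G x = (\<Sum>i\<in>Basis. g i x *\<^sub>R i)" for x
  have Gi: "(\<lambda>x. G x \<bullet> i) = g i" if "i \<in> Basis" for i
    unfolding G_def using that by simp
  have bL: "b \<in> L2 \<mu>" using b by (simp add: L2_tendsto_def)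
  have gL: "g i \<in> L2 \<mu>" if "i \<in> Basis" for i using g[OF that] by (simp add: L2_tendsto_def)
  have parts: "L2_inner \<mu> b (partial i \<phi>) = - L2_inner \<mu> (g i) \<phi>" if i: "i \<in> Basis" and \<phi>: "\<phi> \<in> Cc_inf \<Omega>" for i \<phi>
  proof (rule LIMSEQ_unique)
    show "(\<lambda>n. L2_inner \<mu> (v n) (partial i \<phi>)) \<longlonglongrightarrow> L2_inner \<mu> b (partial i \<phi>)"
      by (rule L2_tendsto_inner[OF b Lp[OF \<phi> i]])
    have "(\<lambda>n. - L2_inner \<mu> (partial i (v n)) \<phi>) \<longlonglongrightarrow> - L2_inner \<mu> (g i) \<phi>"
      by (intro tendsto_minus L2_tendsto_inner[OF g[OF i] L[OF \<phi>]])
    then show "(\<lambda>n. L2_inner \<mu> (v n) (partial i \<phi>)) \<longlonglongrightarrow> - L2_inner \<mu> (g i) \<phi>"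
      by (simp add: by_parts_Cc_inf[OF Cc_inf_Ck[OF v] \<phi> i])
  qed
  have grad: "is_weak_grad \<Omega> b G"
    unfolding is_weak_grad_def using parts gL by (simp add: Gi Gi[THEN fun_cong] L2_inner_def)
  have lap: "is_weak_lap \<Omega> b f"
    unfolding is_weak_lap_def
  proof (intro conjI f ballI)
    fix \<phi> assume \<phi>: "\<phi> \<in> Cc_inf \<Omega>"
    have "L2_inner \<mu> b (classical_lap \<phi>) = (\<Sum>i\<in>Basis. L2_inner \<mu> b (partial i (partial i \<phi>)))"
      by (rule L2_inner_classical_lap[OF bL Cc_inf_Ck[OF \<phi>]])
    also have "\<dots> = (\<Sum>i\<in>Basis. - L2_inner \<mu> (g i) (partial i \<phi>))"
      by (intro sum.cong refl parts Cc_inf_partial \<phi>)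
    also have "\<dots> = - (\<Sum>i\<in>Basis. L2_inner \<mu> (g i) (partial i \<phi>))" by (simp add: sum_negf)
    also have "(\<Sum>i\<in>Basis. L2_inner \<mu> (g i) (partial i \<phi>)) = l \<phi>"
    proof (rule LIMSEQ_unique)
      show "(\<lambda>n. D (v n) \<phi>) \<longlonglongrightarrow> (\<Sum>i\<in>Basis. L2_inner \<mu> (g i) (partial i \<phi>))"
        unfolding D_def by (intro tendsto_sum L2_tendsto_inner g Lp \<phi>)
      show "(\<lambda>n. D (v n) \<phi>) \<longlonglongrightarrow> l \<phi>" by (rule lim[OF \<phi>])
    qed
    finally show "(\<integral>x. b x * classical_lap \<phi> x \<partial>\<mu>) = (\<integral>x. f x * \<phi> x \<partial>\<mu>)"
      by (simp add: L2_inner_def l_def)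
  qed
  have "H1_tendsto \<Omega> v b"
    unfolding H1_tendsto_def
  proof (intro conjI allI)
    show "v n \<in> H1 \<Omega>" for n by (rule Ck_in_H1[OF Cc_inf_Ck[OF v]])
    show "b \<in> H1 \<Omega>" unfolding H1_def using bL grad by blast
    define E where "E n = L2_inner \<mu> (\<lambda>x. v n x - b x) (\<lambda>x. v n x - b x)
      + (\<Sum>i\<in>Basis. L2_inner \<mu> (\<lambda>x. partial i (v n) x - g i x) (\<lambda>x. partial i (v n) x - g i x))" for n
    have "H1_norm \<Omega> (\<lambda>x. v n x - b x) = sqrt (E n)" for n
    proof -
      let ?G = "\<lambda>x. gradient (v n) x - G x"
      have eq: "(\<lambda>x. ?G x \<bullet> i) = (\<lambda>x. partial i (v n) x - g i x)" if "i \<in> Basis" for i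
        using Gi[OF that] by (simp add: inner_diff_left gradient_inner that fun_eq_iff)
      have "is_weak_grad \<Omega> (\<lambda>x. v n x - b x) ?G"
        unfolding is_weak_grad_def
      proof (intro ballI conjI)
        fix i :: 'a assume i: "i \<in> Basis"
        show "(\<lambda>x. ?G x \<bullet> i) \<in> L2 \<mu>" unfolding eq[OF i] by (rule L2_diff[OF Lp[OF v i] gL[OF i]])
        fix \<phi> assume \<phi>: "\<phi> \<in> Cc_inf \<Omega>"
        have "L2_inner \<mu> (\<lambda>x. v n x - b x) (partial i \<phi>) = - L2_inner \<mu> (\<lambda>x. ?G x \<bullet> i) \<phi>"
          unfolding eq[OF i] L2_inner_diff[OF Lv bL Lp[OF \<phi> i]] L2_inner_diff[OF Lp[OF v i] gL[OF i] L[OF \<phi>]]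
          using by_parts_Cc_inf[OF Cc_inf_Ck[OF v] \<phi> i, of n] parts[OF i \<phi>] by simp
        then show "(\<integral>x. (v n x - b x) * partial i \<phi> x \<partial>\<mu>) = - (\<integral>x. (?G x \<bullet> i) * \<phi> x \<partial>\<mu>)"
          by (simp add: L2_inner_def)
      qed
      from H1_norm_eq[OF L2_diff[OF Lv bL] this]
      show ?thesis unfolding E_def by (simp add: eq)
    qed
    moreover have "E \<longlonglongrightarrow> 0 + (\<Sum>i\<in>(Basis::'a set). 0)"
      unfolding E_def using b g by (intro tendsto_add tendsto_sum) (auto simp: L2_tendsto_iff)
    then have "(\<lambda>n. sqrt (E n)) \<longlonglongrightarrow> 0" using tendsto_real_sqrt by fastforce
    ultimately show "(\<lambda>n. H1_norm \<Omega> (\<lambda>x. v n x - b x)) \<longlonglongrightarrow> 0" by simp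
  qed
  then have "b \<in> H10 \<Omega>" unfolding H10_def using v by blast
  then have "b \<in> H0_lap \<Omega>" unfolding H0_lap_def using lap by blast
  moreover have "L2_tendsto \<mu> (\<lambda>n. partial i (v n)) (\<lambda>x. G x \<bullet> i)" if "i \<in> Basis" for i
    unfolding Gi[OF that] by (rule g[OF that])
  ultimately show thesis using that lap grad v b by blast
qed

end

section \<open>Mollification\<close>

lemma lborel_integral_reflection:
  fixes f :: "'a::euclidean_space \<Rightarrow> real"
  assumes f: "f \<in> borel_measurable borel"
  shows "(\<integral>y. f (x - y) \<partial>lborel) = (\<integral>y. f y \<partial>lborel)"
proof -
  have "(lborel :: 'a measure) = distr lborel borel (\<lambda>y. x + (-1) *\<^sub>R y)"
    using lborel_affine[of "-1" x] by (simp add: density_1)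
  then have "(\<integral>y. f y \<partial>lborel) = (\<integral>y. f y \<partial>distr lborel borel (\<lambda>y. x + (-1) *\<^sub>R y))" by simp
  also have "\<dots> = (\<integral>y. f (x + (-1) *\<^sub>R y) \<partial>lborel)"
    using f by (intro integral_distr) auto
  finally show ?thesis by simp
qed

text \<open>
  The centre \<open>z\<close> is arbitrary so that convolution with the bump combines smoothing with a
  translation by \<open>z\<close>.
\<close>

lemma mollifier_exists:
  fixes z :: "'a::euclidean_space"
  assumes e: "e > 0"
  obtains k where "k \<in> Cc_inf UNIV" "\<And>x. 0 \<le> k x" "\<And>x. e < norm (x - z) \<Longrightarrow> k x = 0"
    "(\<integral>x. k x \<partial>lborel) = 1"
proof -
  define \<beta> where "\<beta> x = cutoff (e\<^sup>2 - (norm (x - z))\<^sup>2)" for x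
  have Ck: "Ck_on m UNIV \<beta>" for m
    unfolding \<beta>_def by (intro Ck_on_cutoff Ck_on_diff Ck_on_const Ck_on_norm_square)
  have \<beta>0: "\<beta> x = 0" if "x \<notin> cball z e" for x
    unfolding \<beta>_def using that e by (intro cutoff_eq_0) (simp add: dist_norm norm_minus_commute power_mono)
  have \<beta>_nn: "0 \<le> \<beta> x" for x by (simp add: \<beta>_def cutoff_nonneg)
  have i: "integrable lborel \<beta>"
    using Ck_on_continuous[OF Ck] compact_cball \<beta>0 by (rule compact_support_integrable)
  define c where "c = (\<integral>x. \<beta> x \<partial>lborel)"
  have "c \<noteq> 0"
  proof
    assume "c = 0"
    then have "AE x in lborel. \<beta> x = 0"
      using integral_nonneg_eq_0_iff_AE[OF i] \<beta>_nn by (simp add: c_def)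
    then have "AE x in lborel. x \<notin> ball z e"
    proof eventually_elim
      fix x assume x: "\<beta> x = 0"
      show "x \<notin> ball z e"
      proof
        assume "x \<in> ball z e"
        then have "norm (x - z) < e" by (simp add: dist_norm norm_minus_commute)
        then have "(norm (x - z))\<^sup>2 < e\<^sup>2" by (intro power_strict_mono) auto
        then have "0 < \<beta> x" by (simp add: \<beta>_def cutoff_pos_iff)
        then show False using x by simp
      qed
    qed
    then have "ball z e \<in> null_sets lborel"
      by (intro iffD2[OF AE_iff_null_sets]) simp
    then have "negligible (ball z e)" 
      by (simp add: negligible_iff_null_sets null_sets_completionI)
    then show False using e open_not_negligible[of "ball z e"] by simp
  qed
  moreover have "0 \<le> c" unfolding c_def using \<beta>_nn by simp
  ultimately have c: "c > 0" by simp
  show thesis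
  proof (rule that[of "\<lambda>x. (1 / c) * \<beta> x"])
    show "(\<lambda>x. (1 / c) * \<beta> x) \<in> Cc_inf UNIV"
      by (rule Cc_infI[OF Ck_on_cmult[OF Ck] compact_cball[of z e]]) (simp_all add: \<beta>0)
    show "0 \<le> (1 / c) * \<beta> x" for x using c \<beta>_nn by simp
    show "(1 / c) * \<beta> x = 0" if "e < norm (x - z)" for x
      using \<beta>0[of x] that by (simp add: dist_norm norm_minus_commute)
    show "(\<integral>x. (1 / c) * \<beta> x \<partial>lborel) = 1" using c i by (simp add: c_def)
  qed
qed

lemma Cc_inf_reflect:
  assumes "k \<in> Cc_inf UNIV"
  shows "(\<lambda>y. k (x - y)) \<in> Cc_inf UNIV" and "classical_lap (\<lambda>y. k (x - y)) y = classical_lap k (x - y)"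
proof -
  obtain K where K: "\<And>n. Ck_on n UNIV k" "compact K" "\<And>x. x \<notin> K \<Longrightarrow> k x = 0"
    using Cc_infE[OF assms] by metis
  have eq: "(\<lambda>y. k (x - y)) = (\<lambda>y. k (x + (-1) *\<^sub>R y))" by simp
  show "(\<lambda>y. k (x - y)) \<in> Cc_inf UNIV"
  proof (rule Cc_infI)
    show "Ck_on n UNIV (\<lambda>y. k (x - y))" for n unfolding eq by (rule Ck_on_affine[OF K(1)])
    show "compact ((\<lambda>w. x - w) ` K)" by (intro compact_continuous_image continuous_intros K)
    show "k (x - y) = 0" if "y \<notin> (\<lambda>w. x - w) ` K" for y
    proof (rule K(3), rule notI)
      assume "x - y \<in> K"
      then have "y \<in> (\<lambda>w. x - w) ` K" by (intro image_eqI[of _ _ "x - y"]) simp_all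
      with that show False by contradiction
    qed
  qed simp
  have p: "partial i (\<lambda>y. g (x + (-1) *\<^sub>R y)) = (\<lambda>y. (-1) * partial i g (x + (-1) *\<^sub>R y))"
    if "Ck_on 1 UNIV g" for g i
    by (rule ext, rule partial_affine) (use that in simp)
  have 2: "partial i (partial i (\<lambda>y. k (x - y))) y = partial i (partial i k) (x - y)" if i: "i \<in> Basis" for i
  proof -
    have c: "Ck_on 1 UNIV (partial i k)" using Ck_on_partial[OF K(1)[of "Suc 1"] i] .
    have d: "(\<lambda>y. partial i k (x + (-1) *\<^sub>R y)) differentiable (at y)" for y
      using Ck_on_affine[OF c, of x "-1"] by simp
    have "partial i (partial i (\<lambda>y. k (x - y))) y = partial i (\<lambda>y. (-1) * partial i k (x + (-1) *\<^sub>R y)) y"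
      unfolding eq p[OF K(1)] ..
    also have "\<dots> = (-1) * partial i (\<lambda>y. partial i k (x + (-1) *\<^sub>R y)) y"
      using partial_mult[of "\<lambda>_. -1" y "\<lambda>y. partial i k (x + (-1) *\<^sub>R y)" i] d by simp
    finally show ?thesis unfolding p[OF c] by simp
  qed
  then show "classical_lap (\<lambda>y. k (x - y)) y = classical_lap k (x - y)"
    unfolding classical_lap_def by (intro sum.cong refl)
qed

text \<open>
  Both bounds together dominate the difference quotients of a convolution, including the
  linear term that is subtracted from them.
\<close>

lemma Cc_inf_Lipschitz:
  fixes k :: "'a::euclidean_space \<Rightarrow> real"
  assumes "k \<in> Cc_inf UNIV"
  obtains L where "\<And>x h. \<bar>k (x + h) - k x\<bar> \<le> L * norm h"
    "\<And>x h. \<bar>\<Sum>i\<in>Basis. (h \<bullet> i) * partial i k x\<bar> \<le> L * norm h"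
proof -
  obtain K where K: "\<And>n. Ck_on n UNIV k" "compact K" "\<And>x. x \<notin> K \<Longrightarrow> k x = 0"
    using Cc_infE[OF assms] by metis
  have "\<exists>C. \<forall>x. \<bar>partial i k x\<bar> \<le> C" if i: "i \<in> Basis" for i
  proof -
    obtain K' where "\<And>n. Ck_on n UNIV (partial i k)" "compact K'" "\<And>x. x \<notin> K' \<Longrightarrow> partial i k x = 0"
      using Cc_infE[OF Cc_inf_partial[OF assms i]] by metis
    then show ?thesis using compact_support_bounded[OF Ck_on_continuous] by metis
  qed
  then obtain C where C: "\<And>i x. i \<in> Basis \<Longrightarrow> \<bar>partial i k x\<bar> \<le> C i" by metis
  define L where "L = (\<Sum>i\<in>(Basis::'a set). C i)"
  have D: "\<bar>\<Sum>i\<in>Basis. (h \<bullet> i) * partial i k x\<bar> \<le> L * norm h" for x h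
  proof -
    have "\<bar>\<Sum>i\<in>Basis. (h \<bullet> i) * partial i k x\<bar> \<le> (\<Sum>i\<in>Basis. \<bar>(h \<bullet> i) * partial i k x\<bar>)"
      by (rule sum_abs)
    also have "\<dots> \<le> (\<Sum>i\<in>Basis. norm h * C i)"
      unfolding abs_mult by (intro sum_mono mult_mono Basis_le_norm C) auto
    finally show ?thesis by (simp add: L_def sum_distrib_left mult.commute)
  qed
  have "norm (k (x + h) - k x) \<le> L * norm (x + h - x)" for x h
  proof (rule differentiable_bound[of UNIV k "\<lambda>x h. \<Sum>i\<in>Basis. (h \<bullet> i) * partial i k x"])
    show "(k has_derivative (\<lambda>h. \<Sum>i\<in>Basis. (h \<bullet> i) * partial i k x)) (at x within UNIV)" for x
      using K(1)[of 1] by (intro has_derivative_partial) simp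
    show "onorm (\<lambda>h. \<Sum>i\<in>Basis. (h \<bullet> i) * partial i k x) \<le> L" for x
      by (rule onorm_le) (use D in simp)
  qed auto
  then have "\<bar>k (x + h) - k x\<bar> \<le> L * norm h" for x h by simp
  from that[OF this D] show thesis .
qed

context bounded_open
begin

definition conv :: "('a \<Rightarrow> real) \<Rightarrow> ('a \<Rightarrow> real) \<Rightarrow> 'a \<Rightarrow> real" where
  "conv U k x = (\<integral>y. U y * k (x - y) \<partial>\<mu>)"

lemma conv_eq_inner: "conv U k x = L2_inner \<mu> U (\<lambda>y. k (x - y))"
  by (simp add: conv_def L2_inner_def)

text \<open>
  Differentiation under the integral sign: the remainder of the first-order expansion of \<open>k\<close>,
  divided by the norm of the increment, tends to \<open>0\<close> pointwise and is bounded by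
  twice the Lipschitz constant, so that a multiple of \<open>\<bar>U\<bar>\<close> dominates the integrands.
\<close>

lemma conv_has_derivative:
  assumes U: "U \<in> L2 \<mu>" and k: "k \<in> Cc_inf UNIV"
  shows "(conv U k has_derivative (\<lambda>h. \<Sum>i\<in>Basis. (h \<bullet> i) * conv U (partial i k) x)) (at x)"
proof -
  obtain L where L: "\<And>x h. \<bar>k (x + h) - k x\<bar> \<le> L * norm h"
    "\<And>x h. \<bar>\<Sum>i\<in>Basis. (h \<bullet> i) * partial i k x\<bar> \<le> L * norm h" using Cc_inf_Lipschitz[OF k] by blast
  have ck: "continuous_on UNIV k" using Ck_on_continuous[OF Cc_inf_Ck[OF k]] .
  have ckp: "continuous_on UNIV (partial i k)" if "i \<in> Basis" for i
    using Ck_on_continuous[OF Cc_inf_Ck[OF Cc_inf_partial[OF k that]]] .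
  have I: "integrable \<mu> (\<lambda>y. U y * m (x - y))" if m: "continuous_on UNIV m" for m x
  proof -
    have "continuous_on UNIV (\<lambda>y. m (x - y))"
      using continuous_on_compose2[OF m, of UNIV "\<lambda>y. x - y"] by (simp add: continuous_on_diff)
    from L2_integrable[OF L2_mult_continuous[OF U this]] show ?thesis .
  qed
  define r where "r h y = k (x + h - y) - k (x - y) - (\<Sum>i\<in>Basis. (h \<bullet> i) * partial i k (x - y))" for h y
  have r_bound: "\<bar>r h y\<bar> \<le> 2 * L * norm h" for h y
    using L(1)[of "x - y" h] L(2)[of h "x - y"] unfolding r_def by (simp add: algebra_simps)
  have r_int: "integrable \<mu> (\<lambda>y. U y * r h y)"
    and conv_r: "conv U k (x + h) - conv U k x - (\<Sum>i\<in>Basis. (h \<bullet> i) * conv U (partial i k) x) = (\<integral>y. U y * r h y \<partial>\<mu>)" for h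
  proof -
    have eq: "(\<lambda>y. U y * r h y) = (\<lambda>y. U y * k (x + h - y) - U y * k (x - y)
        - (\<Sum>i\<in>Basis. (h \<bullet> i) * (U y * partial i k (x - y))))"
      by (rule ext) (simp add: r_def right_diff_distrib sum_distrib_left mult.left_commute)
    have i3: "integrable \<mu> (\<lambda>y. (h \<bullet> i) * (U y * partial i k (x - y)))" if "i \<in> Basis" for i
      by (intro integrable_mult_right I ckp that)
    show "integrable \<mu> (\<lambda>y. U y * r h y)"
      unfolding eq by (intro Bochner_Integration.integrable_diff Bochner_Integration.integrable_sum I ck i3)
    show "conv U k (x + h) - conv U k x - (\<Sum>i\<in>Basis. (h \<bullet> i) * conv U (partial i k) x) = (\<integral>y. U y * r h y \<partial>\<mu>)"
      unfolding eq conv_def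
      by (simp add: I[OF ck] I[OF ckp] i3 Bochner_Integration.integral_sum Bochner_Integration.integrable_sum)
  qed
  have "((\<lambda>h. norm (\<integral>y. U y * r h y \<partial>\<mu>) / norm h) \<longlongrightarrow> 0) (at 0)"
    unfolding tendsto_at_iff_sequentially
  proof (intro allI impI)
    fix X :: "nat \<Rightarrow> 'a" assume X: "\<forall>i. X i \<in> UNIV - {0}" "X \<longlonglongrightarrow> 0"
    have "(\<lambda>n. \<integral>y. U y * r (X n) y / norm (X n) \<partial>\<mu>) \<longlonglongrightarrow> (\<integral>y. 0 \<partial>\<mu>)"
    proof (rule integral_dominated_convergence[where w="\<lambda>y. 2 * L * \<bar>U y\<bar>"])
      show "integrable \<mu> (\<lambda>y. 2 * L * \<bar>U y\<bar>)"
        using L2_integrable[OF U] by simp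
      show "(\<lambda>y. U y * r (X n) y / norm (X n)) \<in> borel_measurable \<mu>" for n
        using borel_measurable_integrable[OF r_int] by simp
      show "AE y in \<mu>. (\<lambda>n. U y * r (X n) y / norm (X n)) \<longlonglongrightarrow> 0"
      proof (rule AE_I2)
        fix y
        have "(k has_derivative (\<lambda>h. \<Sum>i\<in>Basis. (h \<bullet> i) * partial i k (x - y))) (at (x - y))"
          using Cc_inf_Ck[OF k, of 1] by (intro has_derivative_partial) simp
        then have "((\<lambda>h. norm (k (x - y + h) - k (x - y) - (\<Sum>i\<in>Basis. (h \<bullet> i) * partial i k (x - y))) / norm h) \<longlongrightarrow> 0) (at 0)"
          unfolding has_derivative_at by simp
        then have "((\<lambda>h. norm (r h y) / norm h) \<longlongrightarrow> 0) (at 0)"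
          unfolding r_def by (simp add: algebra_simps)
        then have "((\<lambda>h. norm (r h y) / norm h) \<circ> X) \<longlonglongrightarrow> 0"
          unfolding tendsto_at_iff_sequentially using X by blast
        then have "(\<lambda>n. norm (r (X n) y / norm (X n))) \<longlonglongrightarrow> 0" by (simp add: o_def)
        then have "(\<lambda>n. r (X n) y / norm (X n)) \<longlonglongrightarrow> 0" by (rule tendsto_norm_zero_cancel)
        from tendsto_mult_right_zero[OF this, of "U y"]
        show "(\<lambda>n. U y * r (X n) y / norm (X n)) \<longlonglongrightarrow> 0" by simp
      qed
      show "AE y in \<mu>. norm (U y * r (X n) y / norm (X n)) \<le> 2 * L * \<bar>U y\<bar>" for n
      proof (rule AE_I2)
        fix y
        have n: "norm (X n) > 0" using X(1) by simp
        have "\<bar>U y\<bar> * \<bar>r (X n) y\<bar> \<le> \<bar>U y\<bar> * (2 * L * norm (X n))"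
          by (intro mult_left_mono r_bound) simp
        then show "norm (U y * r (X n) y / norm (X n)) \<le> 2 * L * \<bar>U y\<bar>"
          using n by (simp add: abs_mult field_simps)
      qed
    qed simp
    then have "(\<lambda>n. (\<integral>y. U y * r (X n) y \<partial>\<mu>) / norm (X n)) \<longlonglongrightarrow> 0" by simp
    from tendsto_norm_zero[OF this]
    show "((\<lambda>h. norm (\<integral>y. U y * r h y \<partial>\<mu>) / norm h) \<circ> X) \<longlonglongrightarrow> 0"
      by (simp add: o_def)
  qed
  moreover have "bounded_linear (\<lambda>h. \<Sum>i\<in>Basis. (h \<bullet> i) * conv U (partial i k) x)"
    by (intro bounded_linear_sum bounded_linear_mult_const bounded_linear_inner_left)
  ultimately show ?thesis
    unfolding has_derivative_at conv_r by blast
qed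

lemma partial_conv:
  assumes "U \<in> L2 \<mu>" "k \<in> Cc_inf UNIV" "i \<in> Basis"
  shows "partial i (conv U k) = conv U (partial i k)"
proof
  fix x
  have "partial i (conv U k) x = (\<Sum>j\<in>Basis. (i \<bullet> j) * conv U (partial j k) x)"
    by (rule partial_eq[OF conv_has_derivative[OF assms(1,2)]])
  also have "\<dots> = (\<Sum>j\<in>Basis. if j = i then conv U (partial j k) x else 0)"
    by (rule sum.cong) (auto simp: inner_Basis assms(3))
  also have "\<dots> = conv U (partial i k) x" using assms(3) by simp
  finally show "partial i (conv U k) x = conv U (partial i k) x" .
qed

lemma Ck_on_conv:
  assumes "U \<in> L2 \<mu>"
  shows "k \<in> Cc_inf UNIV \<Longrightarrow> Ck_on n UNIV (conv U k)"
proof (induction n arbitrary: k)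
  case 0
  have "conv U k differentiable (at x)" for x
    using conv_has_derivative[OF assms 0] by (rule differentiableI)
  then show ?case
    by (auto simp: continuous_on_eq_continuous_at intro: differentiable_imp_continuous_within)
next
  case (Suc n)
  show ?case
  proof (rule Ck_on_SucI)
    show "conv U k differentiable (at x)" for x
      using conv_has_derivative[OF assms Suc.prems] by (rule differentiableI)
    show "Ck_on n UNIV (partial i (conv U k))" if "i \<in> Basis" for i
      unfolding partial_conv[OF assms Suc.prems that] by (rule Suc.IH[OF Cc_inf_partial[OF Suc.prems that]])
  qed
qed

lemma classical_lap_conv:
  assumes U: "U \<in> L2 \<mu>" and k: "k \<in> Cc_inf UNIV"
  shows "classical_lap (conv U k) x = L2_inner \<mu> U (classical_lap (\<lambda>y. k (x - y)))"
proof -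
  have pp: "partial i (partial i k) \<in> Cc_inf UNIV" if "i \<in> Basis" for i
    using Cc_inf_partial[OF Cc_inf_partial[OF k that] that] .
  have "classical_lap (conv U k) x = (\<Sum>i\<in>Basis. 1 * L2_inner \<mu> (\<lambda>y. partial i (partial i k) (x - y)) U)"
    unfolding classical_lap_def
    by (intro sum.cong refl)
       (simp add: partial_conv U k Cc_inf_partial conv_eq_inner L2_inner_commute[of \<mu> U])
  also have "\<dots> = L2_inner \<mu> (\<lambda>y. \<Sum>i\<in>Basis. 1 * partial i (partial i k) (x - y)) U"
    by (rule L2_inner_sum[symmetric, OF Cc_inf_in_L2[OF Cc_inf_reflect(1)[OF pp]] U])
  also have "(\<lambda>y. \<Sum>i\<in>Basis. 1 * partial i (partial i k) (x - y)) = classical_lap (\<lambda>y. k (x - y))"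
    by (rule ext) (simp add: Cc_inf_reflect(2)[OF k] classical_lap_def)
  finally show ?thesis by (simp add: L2_inner_commute[of \<mu> U])
qed

lemma pair_sigma_finite_dom: "pair_sigma_finite \<mu> \<mu>"
  by (intro pair_sigma_finite.intro) unfold_locales

lemma kernel_measurable:
  fixes k :: "'a \<Rightarrow> real"
  assumes "continuous_on UNIV k"
  shows "(\<lambda>(x, y). k (x - y)) \<in> borel_measurable (\<mu> \<Otimes>\<^sub>M \<mu>)"
proof -
  have id: "(\<lambda>x. x) \<in> measurable \<mu> borel"
    by (intro measurable_restrict_space1 measurable_completion) simp
  have "(\<lambda>p. fst p - snd p) \<in> borel_measurable (\<mu> \<Otimes>\<^sub>M \<mu>)"
    by (intro borel_measurable_diff measurable_compose[OF measurable_fst id] measurable_compose[OF measurable_snd id])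
  from measurable_compose[OF this borel_measurable_continuous_onI[OF assms]]
  show ?thesis by (simp add: case_prod_beta')
qed

lemma kernel_product_integrable:
  fixes k :: "'a \<Rightarrow> real"
  assumes P: "integrable \<mu> P" and W: "integrable \<mu> W"
    and k: "continuous_on UNIV k" "\<And>x. \<bar>k x\<bar> \<le> C"
  shows "integrable (\<mu> \<Otimes>\<^sub>M \<mu>) (\<lambda>(x, y). P x * W y * k (x - y))"
proof -
  interpret pair_sigma_finite \<mu> \<mu> by (rule pair_sigma_finite_dom)
  have [measurable]: "P \<in> borel_measurable \<mu>" "W \<in> borel_measurable \<mu>" using P W by auto
  have "integrable (\<mu> \<Otimes>\<^sub>M \<mu>) (\<lambda>(x, y). P x * W y)"
  proof (rule Fubini_integrable)
    show "integrable \<mu> (\<lambda>x. \<integral>y. norm (case (x, y) of (x, y) \<Rightarrow> P x * W y) \<partial>\<mu>)"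
      using P by (simp add: abs_mult)
    show "AE x in \<mu>. integrable \<mu> (\<lambda>y. case (x, y) of (x, y) \<Rightarrow> P x * W y)"
      using W by simp
  qed measurable
  then have i: "integrable (\<mu> \<Otimes>\<^sub>M \<mu>) (\<lambda>p. C * (case p of (x, y) \<Rightarrow> P x * W y))"
    by (rule integrable_mult_right)
  have [measurable]: "(\<lambda>p. case p of (x, y) \<Rightarrow> k (x - y)) \<in> borel_measurable (\<mu> \<Otimes>\<^sub>M \<mu>)"
    by (rule kernel_measurable[OF k(1)])
  have "(\<lambda>p. (case p of (x, y) \<Rightarrow> P x * W y) * (case p of (x, y) \<Rightarrow> k (x - y))) \<in> borel_measurable (\<mu> \<Otimes>\<^sub>M \<mu>)"
    by measurable
  then have m: "(\<lambda>(x, y). P x * W y * k (x - y)) \<in> borel_measurable (\<mu> \<Otimes>\<^sub>M \<mu>)"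
    by (simp add: case_prod_beta')
  show ?thesis
  proof (rule Bochner_Integration.integrable_bound[OF i m], rule AE_I2)
    fix p :: "'a \<times> 'a"
    obtain x y where p: "p = (x, y)" by (cases p)
    have "\<bar>P x * W y\<bar> * \<bar>k (x - y)\<bar> \<le> \<bar>P x * W y\<bar> * \<bar>C\<bar>"
      using k(2)[of "x - y"] by (intro mult_left_mono) auto
    then show "norm (case p of (x, y) \<Rightarrow> P x * W y * k (x - y)) \<le> norm (C * (case p of (x, y) \<Rightarrow> P x * W y))"
      by (simp add: p abs_mult mult_ac)
  qed
qed

lemma continuous_compact_support_bound:
  assumes "k \<in> Cc_inf UNIV"
  obtains C where "\<And>x. \<bar>k x\<bar> \<le> C"
  using Cc_infE[OF assms] compact_support_bounded[OF Ck_on_continuous] by metis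

lemma integral_kernel_le:
  fixes k :: "'a \<Rightarrow> real"
  assumes k: "k \<in> Cc_inf UNIV" "\<And>x. 0 \<le> k x"
  shows "(\<integral>x. k (x - y) \<partial>\<mu>) \<le> (\<integral>x. k x \<partial>lborel)" "(\<integral>y. k (x - y) \<partial>\<mu>) \<le> (\<integral>x. k x \<partial>lborel)"
proof -
  have le: "(\<integral>x. g x \<partial>\<mu>) \<le> (\<integral>x. g x \<partial>lborel)" if g: "g \<in> Cc_inf UNIV" "\<And>x. 0 \<le> g x" for g :: "'a \<Rightarrow> real"
  proof -
    have c: "continuous_on UNIV g" using Ck_on_continuous[OF Cc_inf_Ck[OF g(1)]] .
    then have m: "g \<in> borel_measurable borel" by (rule borel_measurable_continuous_onI)
    have "integrable lborel g"
      using Cc_infE[OF g(1)] compact_support_integrable[OF c] by metis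
    then have i: "integrable lebesgue g" using m by (simp add: integrable_completion)
    have "(\<integral>x. g x \<partial>\<mu>) = (\<integral>x. (if x \<in> \<Omega> then g x else 0) \<partial>lebesgue)"
      using Lebesgue_Measure.integral_restrict_UNIV[OF dom_sets, of g] by simp
    also have "\<dots> \<le> (\<integral>x. g x \<partial>lebesgue)"
    proof (rule integral_mono[OF _ i])
      show "integrable lebesgue (\<lambda>x. if x \<in> \<Omega> then g x else 0)"
        using Lebesgue_Measure.integrable_restrict_UNIV[OF dom_sets, of g] L2_integrable[OF continuous_in_L2[OF c]] by simp
    qed (use g(2) in auto)
    also have "\<dots> = (\<integral>x. g x \<partial>lborel)" using m by (simp add: integral_completion)
    finally show ?thesis .
  qed
  have km: "k \<in> borel_measurable borel"
    by (rule borel_measurable_continuous_onI[OF Ck_on_continuous[OF Cc_inf_Ck[OF k(1)]]])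
  have t: "(\<lambda>x. k (x - y)) \<in> Cc_inf UNIV"
  proof -
    have "(\<lambda>x. k (0 - x)) \<in> Cc_inf UNIV" by (rule Cc_inf_reflect(1)[OF k(1)])
    from Cc_inf_reflect(1)[OF this, of y] show ?thesis by simp
  qed
  have "(\<integral>x. k (x - y) \<partial>lborel) = (\<integral>x. k x \<partial>lborel)"
    using lborel_integral_translation[OF km, of "- y"] by simp
  then show "(\<integral>x. k (x - y) \<partial>\<mu>) \<le> (\<integral>x. k x \<partial>lborel)"
    using le[OF t] k(2) by simp
  show "(\<integral>y. k (x - y) \<partial>\<mu>) \<le> (\<integral>x. k x \<partial>lborel)"
    using le[OF Cc_inf_reflect(1)[OF k(1)], of x] k(2) lborel_integral_reflection[OF km, of x] by simp
qed

text \<open>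
  Schur's test: the weighted inequality \<open>2 \<bar>P(x) W(y)\<bar> \<le> \<lambda> P(x)\<^sup>2 + W(y)\<^sup>2 / \<lambda>\<close> is integrated
  against the kernel, whose integral in either variable is at most \<open>1\<close>.
\<close>

lemma conv_Schur_bound:
  fixes k :: "'a \<Rightarrow> real"
  assumes P: "P \<in> L2 \<mu>" and W: "W \<in> L2 \<mu>" and k: "k \<in> Cc_inf UNIV" "\<And>x. 0 \<le> k x"
    "(\<integral>x. k x \<partial>lborel) = 1" and lam: "lam > 0"
  shows "2 * \<bar>L2_inner \<mu> P (conv W k)\<bar> \<le> lam * L2_inner \<mu> P P + L2_inner \<mu> W W / lam"
proof -
  interpret pair_sigma_finite \<mu> \<mu> by (rule pair_sigma_finite_dom)
  obtain C where C: "\<And>x. \<bar>k x\<bar> \<le> C" using continuous_compact_support_bound[OF k(1)] by blast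
  have ck: "continuous_on UNIV k" using Ck_on_continuous[OF Cc_inf_Ck[OF k(1)]] .
  have PP: "integrable \<mu> (\<lambda>x. P x * P x)" and WW: "integrable \<mu> (\<lambda>x. W x * W x)"
    using L2_mult_integrable P W by blast+
  have i1: "integrable (\<mu> \<Otimes>\<^sub>M \<mu>) (\<lambda>(x, y). P x * W y * k (x - y))"
    by (rule kernel_product_integrable[OF L2_integrable[OF P] L2_integrable[OF W] ck C])
  have one: "integrable \<mu> (\<lambda>x. 1::real)" by simp
  have i2: "integrable (\<mu> \<Otimes>\<^sub>M \<mu>) (\<lambda>(x, y). P x * P x * 1 * k (x - y))"
    by (rule kernel_product_integrable[OF PP one ck C])
  have i3: "integrable (\<mu> \<Otimes>\<^sub>M \<mu>) (\<lambda>(x, y). 1 * (W y * W y) * k (x - y))"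
    by (rule kernel_product_integrable[OF one WW ck C])
  have e1: "(\<integral>p. (case p of (x, y) \<Rightarrow> P x * W y * k (x - y)) \<partial>(\<mu> \<Otimes>\<^sub>M \<mu>)) = L2_inner \<mu> P (conv W k)"
    using integral_fst'[OF i1] by (simp add: L2_inner_def conv_def mult.assoc)
  have e2: "(\<integral>p. (case p of (x, y) \<Rightarrow> P x * P x * 1 * k (x - y)) \<partial>(\<mu> \<Otimes>\<^sub>M \<mu>)) \<le> L2_inner \<mu> P P"
  proof -
    have "(\<integral>p. (case p of (x, y) \<Rightarrow> P x * P x * 1 * k (x - y)) \<partial>(\<mu> \<Otimes>\<^sub>M \<mu>))
        = (\<integral>x. \<integral>y. P x * P x * 1 * k (x - y) \<partial>\<mu> \<partial>\<mu>)"
      using integral_fst'[OF i2] by simp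
    also have "\<dots> \<le> (\<integral>x. P x * P x \<partial>\<mu>)"
    proof (rule integral_mono)
      show "integrable \<mu> (\<lambda>x. \<integral>y. P x * P x * 1 * k (x - y) \<partial>\<mu>)"
        using integrable_fst'[OF i2] by simp
      show "(\<integral>y. P x * P x * 1 * k (x - y) \<partial>\<mu>) \<le> P x * P x" for x
        using mult_left_mono[OF integral_kernel_le(2)[OF k(1,2), of x], of "P x * P x"] k(3) by simp
    qed (rule PP)
    finally show ?thesis by (simp add: L2_inner_def)
  qed
  have e3: "(\<integral>p. (case p of (x, y) \<Rightarrow> 1 * (W y * W y) * k (x - y)) \<partial>(\<mu> \<Otimes>\<^sub>M \<mu>)) \<le> L2_inner \<mu> W W"
  proof -
    have "(\<integral>p. (case p of (x, y) \<Rightarrow> 1 * (W y * W y) * k (x - y)) \<partial>(\<mu> \<Otimes>\<^sub>M \<mu>))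
        = (\<integral>y. \<integral>x. 1 * (W y * W y) * k (x - y) \<partial>\<mu> \<partial>\<mu>)"
      using integral_snd[OF i3] by simp
    also have "\<dots> \<le> (\<integral>y. W y * W y \<partial>\<mu>)"
    proof (rule integral_mono)
      show "integrable \<mu> (\<lambda>y. \<integral>x. 1 * (W y * W y) * k (x - y) \<partial>\<mu>)"
        using integrable_snd[OF i3] by simp
      show "(\<integral>x. 1 * (W y * W y) * k (x - y) \<partial>\<mu>) \<le> W y * W y" for y
        using mult_left_mono[OF integral_kernel_le(1)[OF k(1,2), of y], of "W y * W y"] k(3) by simp
    qed (rule WW)
    finally show ?thesis by (simp add: L2_inner_def)
  qed
  have pt: "2 * \<bar>a * b\<bar> \<le> lam * (a * a) + (b * b) / lam" for a b :: real
  proof -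
    have "0 \<le> (lam * \<bar>a\<bar> - \<bar>b\<bar>)\<^sup>2 / lam" using lam by simp
    also have "\<dots> = lam * (a * a) + (b * b) / lam - 2 * \<bar>a * b\<bar>"
      using lam by (simp add: power2_eq_square field_simps abs_mult)
    finally show ?thesis by simp
  qed
  have "2 * \<bar>\<integral>p. (case p of (x, y) \<Rightarrow> P x * W y * k (x - y)) \<partial>(\<mu> \<Otimes>\<^sub>M \<mu>)\<bar>
      \<le> 2 * (\<integral>p. \<bar>case p of (x, y) \<Rightarrow> P x * W y * k (x - y)\<bar> \<partial>(\<mu> \<Otimes>\<^sub>M \<mu>))"
    using integral_norm_bound[of "\<mu> \<Otimes>\<^sub>M \<mu>" "\<lambda>p. case p of (x, y) \<Rightarrow> P x * W y * k (x - y)"] by simp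
  also have "\<dots> = (\<integral>p. 2 * \<bar>case p of (x, y) \<Rightarrow> P x * W y * k (x - y)\<bar> \<partial>(\<mu> \<Otimes>\<^sub>M \<mu>))" by simp
  also have "\<dots> \<le> (\<integral>p. lam * (case p of (x, y) \<Rightarrow> P x * P x * 1 * k (x - y))
      + (1 / lam) * (case p of (x, y) \<Rightarrow> 1 * (W y * W y) * k (x - y)) \<partial>(\<mu> \<Otimes>\<^sub>M \<mu>))"
  proof (rule integral_mono)
    show "integrable (\<mu> \<Otimes>\<^sub>M \<mu>) (\<lambda>p. 2 * \<bar>case p of (x, y) \<Rightarrow> P x * W y * k (x - y)\<bar>)"
      by (intro integrable_mult_right integrable_abs i1)
    show "integrable (\<mu> \<Otimes>\<^sub>M \<mu>) (\<lambda>p. lam * (case p of (x, y) \<Rightarrow> P x * P x * 1 * k (x - y))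
      + (1 / lam) * (case p of (x, y) \<Rightarrow> 1 * (W y * W y) * k (x - y)))"
      by (intro Bochner_Integration.integrable_add integrable_mult_right i2 i3)
    fix p :: "'a \<times> 'a"
    obtain x y where p: "p = (x, y)" by (cases p)
    have "(2 * \<bar>P x * W y\<bar>) * k (x - y) \<le> (lam * (P x * P x) + (W y * W y) / lam) * k (x - y)"
      by (intro mult_right_mono pt k(2))
    then show "2 * \<bar>case p of (x, y) \<Rightarrow> P x * W y * k (x - y)\<bar>
        \<le> lam * (case p of (x, y) \<Rightarrow> P x * P x * 1 * k (x - y)) + (1 / lam) * (case p of (x, y) \<Rightarrow> 1 * (W y * W y) * k (x - y))"
      using k(2)[of "x - y"] by (simp add: p abs_mult algebra_simps)
  qed
  also have "\<dots> = lam * (\<integral>p. (case p of (x, y) \<Rightarrow> P x * P x * 1 * k (x - y)) \<partial>(\<mu> \<Otimes>\<^sub>M \<mu>))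
      + (1 / lam) * (\<integral>p. (case p of (x, y) \<Rightarrow> 1 * (W y * W y) * k (x - y)) \<partial>(\<mu> \<Otimes>\<^sub>M \<mu>))"
    using i2 i3 by (subst Bochner_Integration.integral_add) (simp_all only: integrable_mult_right integral_mult_right_zero)
  also have "\<dots> \<le> lam * L2_inner \<mu> P P + (1 / lam) * L2_inner \<mu> W W"
    using lam by (intro add_mono mult_left_mono e2 e3) auto
  finally show ?thesis unfolding e1 by simp
qed

text \<open>
  For a test function \<open>g\<close> the convolution moves \<open>W\<close> by at most the size of the support of the
  kernel, so that uniform continuity of \<open>g\<close> controls the error.
\<close>

lemma conv_test_function_bound:
  fixes k :: "'a \<Rightarrow> real"
  assumes g: "g \<in> Cc_inf \<Omega>" and W: "W \<in> L2 \<mu>" "\<And>y. y \<in> \<Omega> \<Longrightarrow> y \<notin> K \<Longrightarrow> W y = 0"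
    and k: "k \<in> Cc_inf UNIV" "\<And>x. 0 \<le> k x" "(\<integral>x. k x \<partial>lborel) = 1"
    and inside: "\<And>x y. y \<in> K \<Longrightarrow> k (x - y) \<noteq> 0 \<Longrightarrow> x \<in> \<Omega>"
    and small: "\<And>x y. k (x - y) \<noteq> 0 \<Longrightarrow> \<bar>g x - g y\<bar> \<le> w"
  shows "\<bar>L2_inner \<mu> g (conv W k) - L2_inner \<mu> g W\<bar> \<le> w * (\<integral>y. \<bar>W y\<bar> \<partial>\<mu>)"
proof -
  interpret pair_sigma_finite \<mu> \<mu> by (rule pair_sigma_finite_dom)
  obtain C where C: "\<And>x. \<bar>k x\<bar> \<le> C" using continuous_compact_support_bound[OF k(1)] by blast
  have ck: "continuous_on UNIV k" using Ck_on_continuous[OF Cc_inf_Ck[OF k(1)]] .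
  have km: "k \<in> borel_measurable borel" by (rule borel_measurable_continuous_onI[OF ck])
  have gL: "g \<in> L2 \<mu>" by (rule Cc_inf_in_L2[OF g])
  have i1: "integrable (\<mu> \<Otimes>\<^sub>M \<mu>) (\<lambda>(x, y). g x * W y * k (x - y))"
    by (rule kernel_product_integrable[OF L2_integrable[OF gL] L2_integrable[OF W(1)] ck C])
  have "L2_inner \<mu> g (conv W k) = (\<integral>y. \<integral>x. g x * W y * k (x - y) \<partial>\<mu> \<partial>\<mu>)"
    using integral_fst'[OF i1] integral_snd[OF i1] by (simp add: L2_inner_def conv_def mult.assoc)
  moreover have ii: "integrable \<mu> (\<lambda>y. \<integral>x. g x * W y * k (x - y) \<partial>\<mu>)"
    using integrable_snd[OF i1] by simp
  moreover have i2: "integrable \<mu> (\<lambda>y. g y * W y)" by (rule L2_mult_integrable[OF gL W(1)])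
  ultimately have "L2_inner \<mu> g (conv W k) - L2_inner \<mu> g W
      = (\<integral>y. (\<integral>x. g x * W y * k (x - y) \<partial>\<mu>) - g y * W y \<partial>\<mu>)"
    by (simp add: L2_inner_def)
  also have "\<bar>\<dots>\<bar> \<le> (\<integral>y. \<bar>(\<integral>x. g x * W y * k (x - y) \<partial>\<mu>) - g y * W y\<bar> \<partial>\<mu>)"
    using integral_norm_bound[of \<mu> "\<lambda>y. (\<integral>x. g x * W y * k (x - y) \<partial>\<mu>) - g y * W y"] by simp
  also have "\<dots> \<le> (\<integral>y. w * \<bar>W y\<bar> \<partial>\<mu>)"
  proof (rule integral_mono)
    show "integrable \<mu> (\<lambda>y. \<bar>(\<integral>x. g x * W y * k (x - y) \<partial>\<mu>) - g y * W y\<bar>)"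
      by (intro integrable_abs Bochner_Integration.integrable_diff ii i2)
    show "integrable \<mu> (\<lambda>y. w * \<bar>W y\<bar>)"
      using L2_integrable[OF W(1)] by simp
    fix y assume y: "y \<in> space \<mu>"
    show "\<bar>(\<integral>x. g x * W y * k (x - y) \<partial>\<mu>) - g y * W y\<bar> \<le> w * \<bar>W y\<bar>"
    proof (cases "y \<in> K")
      case False
      then show ?thesis using W(2) y by simp
    next
      case True
      have t: "(\<lambda>x. k (x - y)) \<in> borel_measurable borel" using km by measurable
      have "(\<integral>x. k (x - y) \<partial>\<mu>) = (\<integral>x. k (x - y) \<partial>lborel)"
        by (rule integral_lebesgue_on_vanishing(1)[OF t _ dom_sets]) (use inside[OF True] in blast)
      then have one: "(\<integral>x. k (x - y) \<partial>\<mu>) = 1"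
        using lborel_integral_translation[OF km, of "- y"] k(3) by simp
      have kL: "(\<lambda>x. k (x - y)) \<in> L2 \<mu>"
        using continuous_on_compose2[OF ck, of UNIV "\<lambda>x. x - y"]
        by (intro continuous_in_L2) (simp add: continuous_on_diff)
      have igk: "integrable \<mu> (\<lambda>x. g x * k (x - y))" by (rule L2_mult_integrable[OF gL kL])
      have ik: "integrable \<mu> (\<lambda>x. k (x - y))" by (rule L2_integrable[OF kL])
      have "(\<integral>x. g x * W y * k (x - y) \<partial>\<mu>) = W y * (\<integral>x. g x * k (x - y) \<partial>\<mu>)"
        by (subst integral_mult_right_zero[symmetric]) (simp add: mult_ac)
      also have "\<dots> - g y * W y = W y * ((\<integral>x. g x * k (x - y) \<partial>\<mu>) - g y * (\<integral>x. k (x - y) \<partial>\<mu>))"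
        by (simp add: one algebra_simps)
      also have "\<dots> = W y * (\<integral>x. (g x - g y) * k (x - y) \<partial>\<mu>)"
        using igk ik by (simp add: left_diff_distrib)
      finally have eq: "(\<integral>x. g x * W y * k (x - y) \<partial>\<mu>) - g y * W y = W y * (\<integral>x. (g x - g y) * k (x - y) \<partial>\<mu>)" .
      have "\<bar>\<integral>x. (g x - g y) * k (x - y) \<partial>\<mu>\<bar> \<le> (\<integral>x. \<bar>(g x - g y) * k (x - y)\<bar> \<partial>\<mu>)"
        using integral_norm_bound[of \<mu> "\<lambda>x. (g x - g y) * k (x - y)"] by simp
      also have "\<dots> \<le> (\<integral>x. w * k (x - y) \<partial>\<mu>)"
      proof (rule integral_mono)
        show "integrable \<mu> (\<lambda>x. \<bar>(g x - g y) * k (x - y)\<bar>)"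
          using igk ik by (simp add: left_diff_distrib)
        show "integrable \<mu> (\<lambda>x. w * k (x - y))" using ik by simp
        show "\<bar>(g x - g y) * k (x - y)\<bar> \<le> w * k (x - y)" for x
          using small[of x y] k(2)[of "x - y"] by (cases "k (x - y) = 0") (auto simp: abs_mult intro: mult_right_mono)
      qed
      also have "\<dots> = w" using one by simp
      finally show ?thesis unfolding eq abs_mult
        by (simp add: mult.commute[of w] mult_left_mono)
    qed
  qed
  also have "\<dots> = w * (\<integral>y. \<bar>W y\<bar> \<partial>\<mu>)" by simp
  finally show ?thesis .
qed

text \<open>
  A weakly harmonic \<open>f\<close> is orthogonal to the Laplacian \<open>W\<close> of a function \<open>U\<close> that solves
  \<open>\<Delta>U = W\<close> across the boundary, provided arbitrarily small translations push the support of \<open>U\<close>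
  into the domain.  Convolution with a bump centred at such a small vector turns \<open>U\<close> into a test
  function whose Laplacian is the convolution of \<open>W\<close>; its inner product with \<open>f\<close> vanishes and is
  close to that of \<open>W\<close>.
\<close>

lemma weakly_harmonic_orthogonal:
  assumes f: "f \<in> L2 \<mu>" and harm: "\<And>\<phi>. \<phi> \<in> Cc_inf \<Omega> \<Longrightarrow> L2_inner \<mu> f (classical_lap \<phi>) = 0"
    and U: "U \<in> L2 \<mu>" "\<And>y. y \<in> \<Omega> \<Longrightarrow> y \<notin> K \<Longrightarrow> U y = 0"
    and W: "W \<in> L2 \<mu>" "\<And>y. y \<in> \<Omega> \<Longrightarrow> y \<notin> K \<Longrightarrow> W y = 0"
    and lap: "\<And>\<phi>. \<phi> \<in> Cc_inf UNIV \<Longrightarrow> L2_inner \<mu> U (classical_lap \<phi>) = L2_inner \<mu> W \<phi>"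
    and K: "compact K"
    and shift: "\<And>d. d > 0 \<Longrightarrow> \<exists>z. norm z < d \<and> (\<forall>x\<in>K. x + z \<in> \<Omega>)"
  shows "L2_inner \<mu> f W = 0"
proof -
  have "\<bar>L2_inner \<mu> f W\<bar> \<le> 3 * e" if e: "e > 0" for e
  proof -
    \<comment> \<open>\<open>lam\<close> makes the term with \<open>W\<close> in Schur's test small; the added \<open>1\<close> keeps it positive.\<close>
    define lam where "lam = (L2_inner \<mu> W W + 1) / e"
    have WW: "0 \<le> L2_inner \<mu> W W" by (rule L2_inner_self_nonneg)
    have lam: "lam > 0" using WW e by (simp add: lam_def)
    have lamW: "L2_inner \<mu> W W / lam \<le> e"
      using WW e by (simp add: lam_def field_simps)
    obtain \<phi> where \<phi>: "\<And>n. \<phi> n \<in> Cc_inf \<Omega>" "L2_tendsto \<mu> \<phi> f" using Cc_inf_dense[OF f] by blast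
    have "(\<lambda>n. L2_inner \<mu> (\<lambda>x. \<phi> n x - f x) (\<lambda>x. \<phi> n x - f x)) \<longlonglongrightarrow> 0"
      using \<phi>(2) by (simp add: L2_tendsto_iff)
    moreover have "(\<lambda>n. L2_inner \<mu> (\<phi> n) W) \<longlonglongrightarrow> L2_inner \<mu> f W"
      by (rule L2_tendsto_inner[OF \<phi>(2) W(1)])
    ultimately have "\<forall>\<^sub>F n in sequentially. L2_inner \<mu> (\<lambda>x. \<phi> n x - f x) (\<lambda>x. \<phi> n x - f x) < e / lam
        \<and> dist (L2_inner \<mu> (\<phi> n) W) (L2_inner \<mu> f W) < e"
      using e lam by (intro eventually_conj order_tendstoD(2) tendstoD) auto
    then obtain n where n: "L2_inner \<mu> (\<lambda>x. \<phi> n x - f x) (\<lambda>x. \<phi> n x - f x) < e / lam"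
      "dist (L2_inner \<mu> (\<phi> n) W) (L2_inner \<mu> f W) < e"
      using eventually_sequentially by auto
    define g where "g = \<phi> n"
    have g: "g \<in> Cc_inf \<Omega>" unfolding g_def by (rule \<phi>(1))
    have gL: "g \<in> L2 \<mu>" by (rule Cc_inf_in_L2[OF g])
    have E: "lam * L2_inner \<mu> (\<lambda>x. g x - f x) (\<lambda>x. g x - f x) \<le> e"
      using n(1) lam by (simp add: g_def field_simps)
    have gW: "\<bar>L2_inner \<mu> g W - L2_inner \<mu> f W\<bar> < e" using n(2) by (simp add: g_def dist_real_def)
    define I where "I = (\<integral>y. \<bar>W y\<bar> \<partial>\<mu>)"
    have I: "0 \<le> I" unfolding I_def by simp
    \<comment> \<open>\<open>w\<close> is the admissible oscillation of \<open>g\<close>, and \<open>d\<close> the distance over which \<open>g\<close>, being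
      Lipschitz, oscillates by at most \<open>w\<close>.\<close>
    define w where "w = e / (I + 1)"
    have w: "w > 0" and wI: "w * I \<le> e" using e I by (simp_all add: w_def field_simps)
    have gU: "g \<in> Cc_inf UNIV" using g Cc_inf_mono[of \<Omega> UNIV] by auto
    obtain L where L: "\<And>x h. \<bar>g (x + h) - g x\<bar> \<le> L * norm h"
      by (rule Cc_inf_Lipschitz[OF gU]) (rule that)
    define d where "d = w / (\<bar>L\<bar> + 1)"
    have d: "d > 0" using w by (simp add: d_def)
    have small: "\<bar>g x - g y\<bar> \<le> w" if "norm (x - y) \<le> d" for x y
    proof -
      have "\<bar>g (y + (x - y)) - g y\<bar> \<le> L * norm (x - y)" by (rule L)
      also have "\<dots> \<le> (\<bar>L\<bar> + 1) * d" using that d by (intro mult_mono) auto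
      also have "\<dots> = w" by (simp add: d_def)
      finally show ?thesis by simp
    qed
    obtain z where z: "norm z < d / 2" "\<And>x. x \<in> K \<Longrightarrow> x + z \<in> \<Omega>"
      using shift[of "d / 2"] d by auto
    have "compact ((\<lambda>x. x + z) ` K)" by (intro compact_continuous_image continuous_intros K)
    moreover have "(\<lambda>x. x + z) ` K \<subseteq> \<Omega>" using z(2) by auto
    ultimately obtain r where r: "r > 0" "(\<Union>x\<in>(\<lambda>x. x + z) ` K. ball x r) \<subseteq> \<Omega>"
      using compact_subset_open_imp_ball_epsilon_subset[OF _ open_dom] by metis
    define s where "s = min (r / 2) (d / 2)"
    have s: "s > 0" "s < r" "s \<le> d / 2" using r(1) d by (auto simp: s_def)
    obtain k where k: "k \<in> Cc_inf UNIV" "\<And>x. 0 \<le> k x" "(\<integral>x. k x \<partial>lborel) = 1"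
      and k0: "\<And>x. s < norm (x - z) \<Longrightarrow> k x = 0" using mollifier_exists[OF s(1), of z] by metis
    have k_supp: "norm (x - y - z) \<le> s" if "k (x - y) \<noteq> 0" for x y
      using k0[of "x - y"] that by fastforce
    have inside: "x + c \<in> \<Omega>" if "x \<in> K" "norm (c - z) \<le> s" for x c
    proof -
      have "x + c \<in> ball (x + z) r"
        using that(2) s(2) by (simp add: dist_norm norm_minus_commute[of z])
      then show ?thesis using r(2) that(1) by blast
    qed
    have conv_test: "conv U k \<in> Cc_inf \<Omega>"
    proof (rule Cc_infI[OF Ck_on_conv[OF U(1) k(1)]])
      show "compact {x + c |x c. x \<in> K \<and> c \<in> cball z s}" by (rule compact_sums[OF K compact_cball])
      show "{x + c |x c. x \<in> K \<and> c \<in> cball z s} \<subseteq> \<Omega>"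
        using inside by (auto simp: dist_norm norm_minus_commute)
      fix x assume x: "x \<notin> {x + c |x c. x \<in> K \<and> c \<in> cball z s}"
      have "U y * k (x - y) = 0" if y: "y \<in> \<Omega>" for y
      proof (rule ccontr)
        assume *: "U y * k (x - y) \<noteq> 0"
        then have "y \<in> K" using U(2) y by auto
        moreover have "x - y \<in> cball z s"
          using * k_supp[of x y] by (simp add: dist_norm norm_minus_commute)
        moreover have "x = y + (x - y)" by simp
        ultimately show False using x by blast
      qed
      then have "conv U k x = (\<integral>y. 0 \<partial>\<mu>)"
        unfolding conv_def by (intro Bochner_Integration.integral_cong) auto
      then show "conv U k x = 0" by simp
    qed
    have "classical_lap (conv U k) = conv W k"
      by (rule ext) (simp only: classical_lap_conv[OF U(1) k(1)] lap[OF Cc_inf_reflect(1)[OF k(1)]] conv_eq_inner)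
    then have f0: "L2_inner \<mu> f (conv W k) = 0" using harm[OF conv_test] by simp
    have cL: "conv W k \<in> L2 \<mu>" using Ck_on_conv[OF W(1) k(1)] Ck_in_L2 by blast
    have "2 * \<bar>L2_inner \<mu> (\<lambda>x. g x - f x) (conv W k)\<bar>
        \<le> lam * L2_inner \<mu> (\<lambda>x. g x - f x) (\<lambda>x. g x - f x) + L2_inner \<mu> W W / lam"
      by (rule conv_Schur_bound[OF L2_diff[OF gL f] W(1) k lam])
    then have "\<bar>L2_inner \<mu> g (conv W k)\<bar> \<le> e"
      using E lamW f0 by (simp add: L2_inner_diff[OF gL f cL])
    moreover have "\<bar>L2_inner \<mu> g (conv W k) - L2_inner \<mu> g W\<bar> \<le> w * I"
      unfolding I_def
    proof (rule conv_test_function_bound[OF g W k])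
      show "x \<in> \<Omega>" if "y \<in> K" "k (x - y) \<noteq> 0" for x y
        using inside[OF that(1) k_supp[OF that(2)]] by simp
      show "\<bar>g x - g y\<bar> \<le> w" if "k (x - y) \<noteq> 0" for x y
      proof (rule small)
        have "norm (x - y) \<le> norm (x - y - z) + norm z" using norm_triangle_sub by (metis add.commute)
        then show "norm (x - y) \<le> d" using k_supp[OF that] z(1) s(3) by linarith
      qed
    qed
    ultimately show ?thesis using gW wI by linarith
  qed
  from this[of "e / 3" for e] have "\<bar>L2_inner \<mu> f W\<bar> \<le> 0 + e" if "e > 0" for e
    using that by simp
  then have "\<bar>L2_inner \<mu> f W\<bar> \<le> 0" by (rule field_le_epsilon)
  then show ?thesis by simp
qed

end

section \<open>Localisation near the boundary\<close>

text \<open>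
  The quotient \<open>A / (A + B)\<close> of two cutoffs, where \<open>A\<close> vanishes away from the ball, \<open>B\<close> vanishes on
  the smaller ball, and never both vanish.
\<close>

lemma smooth_step_exists:
  fixes x :: "'a::euclidean_space"
  assumes r: "r > 0"
  obtains \<psi> where "\<And>k. Ck_on k UNIV \<psi>" "\<And>y. y \<in> ball x (r / 2) \<Longrightarrow> \<psi> y = 1"
    "\<And>y. y \<notin> cball x r \<Longrightarrow> \<psi> y = 0"
proof -
  define A where "A y = cutoff (r\<^sup>2 - (norm (y - x))\<^sup>2)" for y
  define B where "B y = cutoff ((norm (y - x))\<^sup>2 - (r / 2)\<^sup>2)" for y
  have Ck: "Ck_on k UNIV A" "Ck_on k UNIV B" for k
    unfolding A_def B_def by (intro Ck_on_cutoff Ck_on_diff Ck_on_const Ck_on_norm_square)+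
  have nn: "0 \<le> A y" "0 \<le> B y" for y by (simp_all add: A_def B_def cutoff_nonneg)
  have "A y + B y \<noteq> 0" for y
  proof (cases "norm (y - x) < r")
    case True
    then have "(norm (y - x))\<^sup>2 < r\<^sup>2" by (intro power_strict_mono) auto
    then have "0 < A y" by (simp add: A_def cutoff_pos_iff)
    then show ?thesis using nn(2)[of y] by simp
  next
    case False
    then have "(r / 2)\<^sup>2 < (norm (y - x))\<^sup>2" using r by (intro power_strict_mono) auto
    then have "0 < B y" by (simp add: B_def cutoff_pos_iff)
    then show ?thesis using nn(1)[of y] by simp
  qed
  then have 1: "Ck_on k UNIV (\<lambda>y. A y * inverse (A y + B y))" for k
    by (intro Ck_on_mult Ck_on_inverse Ck_on_add Ck)
  show thesis
  proof (rule that[OF 1])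
    fix y assume "y \<in> ball x (r / 2)"
    then have "norm (y - x) < r / 2" by (simp add: dist_norm norm_minus_commute)
    then have "(norm (y - x))\<^sup>2 < (r / 2)\<^sup>2" by (intro power_strict_mono) auto
    then have "B y = 0" unfolding B_def by (intro cutoff_eq_0) simp
    then show "A y * inverse (A y + B y) = 1" using \<open>A y + B y \<noteq> 0\<close> by simp
  next
    fix y assume "y \<notin> cball x r"
    then have "r \<le> norm (y - x)" by (simp add: dist_norm norm_minus_commute)
    then have "r\<^sup>2 \<le> (norm (y - x))\<^sup>2" using r by (intro power_mono) auto
    then have "A y = 0" unfolding A_def by (intro cutoff_eq_0) simp
    then show "A y * inverse (A y + B y) = 0" by simp
  qed
qed

text \<open>
  The Leibniz rule, arranged so that \<open>\<phi>\<close> is differentiated only inside products.  Weak equations for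
  a function \<open>b\<close> can then be applied term by term to evaluate the pairing of \<open>\<eta> b\<close> with \<open>\<Delta>\<phi>\<close>.
\<close>

lemma Laplace_product_identity:
  assumes \<eta>: "Ck_on 2 UNIV \<eta>" and \<phi>: "Ck_on 2 UNIV \<phi>"
  shows "\<eta> x * classical_lap \<phi> x = classical_lap (\<lambda>x. \<eta> x * \<phi> x) x
    - 2 * (\<Sum>i\<in>Basis. partial i (\<lambda>x. \<phi> x * partial i \<eta> x) x) + \<phi> x * classical_lap \<eta> x"
proof -
  have 2: "2 = Suc 1" by simp
  have d: "\<eta> differentiable (at y)" "\<phi> differentiable (at y)" for y using \<eta> \<phi> by (simp_all add: 2)
  have "partial i (partial i (\<lambda>x. \<eta> x * \<phi> x)) x = \<eta> x * partial i (partial i \<phi>) x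
      + 2 * partial i (\<lambda>x. \<phi> x * partial i \<eta> x) x - \<phi> x * partial i (partial i \<eta>) x"
    if i: "i \<in> Basis" for i
  proof -
    have dp: "partial i \<eta> differentiable (at y)" "partial i \<phi> differentiable (at y)" for y
      using \<eta> \<phi> i by (simp_all add: 2)
    have "partial i (\<lambda>x. \<eta> x * \<phi> x) = (\<lambda>x. \<eta> x * partial i \<phi> x + partial i \<eta> x * \<phi> x)"
      by (rule ext) (rule partial_mult[OF d])
    then have "partial i (partial i (\<lambda>x. \<eta> x * \<phi> x)) x
        = partial i (\<lambda>x. \<eta> x * partial i \<phi> x) x + partial i (\<lambda>x. partial i \<eta> x * \<phi> x) x"
      using partial_add[of "\<lambda>x. \<eta> x * partial i \<phi> x" x "\<lambda>x. partial i \<eta> x * \<phi> x" i]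
      by (simp add: differentiable_mult d dp)
    then show ?thesis
      unfolding partial_mult[OF d(1) dp(2)] partial_mult[OF dp(1) d(2)] partial_mult[OF d(2) dp(1)]
      by (simp add: algebra_simps)
  qed
  then have "classical_lap (\<lambda>x. \<eta> x * \<phi> x) x = (\<Sum>i\<in>Basis. \<eta> x * partial i (partial i \<phi>) x
      + 2 * partial i (\<lambda>x. \<phi> x * partial i \<eta> x) x - \<phi> x * partial i (partial i \<eta>) x)"
    unfolding classical_lap_def by (intro sum.cong refl)
  also have "\<dots> = \<eta> x * classical_lap \<phi> x + 2 * (\<Sum>i\<in>Basis. partial i (\<lambda>x. \<phi> x * partial i \<eta> x) x)
      - \<phi> x * classical_lap \<eta> x"
    by (simp only: classical_lap_def sum.distrib sum_subtractf sum_distrib_left)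
  finally show ?thesis by simp
qed

lemma classical_lap_add:
  assumes "Ck_on 2 UNIV f" "Ck_on 2 UNIV g"
  shows "classical_lap (\<lambda>x. f x + g x) x = classical_lap f x + classical_lap g x"
proof -
  have 2: "2 = Suc 1" by simp
  have "partial i (partial i (\<lambda>x. f x + g x)) x = partial i (partial i f) x + partial i (partial i g) x"
    if i: "i \<in> Basis" for i
  proof -
    have d: "f differentiable (at y)" "g differentiable (at y)"
      "partial i f differentiable (at y)" "partial i g differentiable (at y)" for y
      using assms i by (simp_all add: 2)
    have "partial i (\<lambda>x. f x + g x) = (\<lambda>x. partial i f x + partial i g x)"
      by (rule ext) (rule partial_add[OF d(1,2)])
    then show ?thesis by (simp add: partial_add d(3,4))
  qed
  then have "classical_lap (\<lambda>x. f x + g x) x = (\<Sum>i\<in>Basis. partial i (partial i f) x + partial i (partial i g) x)"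
    unfolding classical_lap_def by (intro sum.cong refl)
  then show ?thesis by (simp only: classical_lap_def sum.distrib)
qed

context bounded_open
begin

text \<open>
  For \<open>\<Delta>b = f\<close> with \<open>\<nabla>b = G\<close> this is the Laplacian of the product \<open>\<eta> b\<close>.  The factor \<open>1\<close> gives
  it the form \<open>u + c v\<close> in which linearity of the inner product is stated.
\<close>

definition localised_lap :: "('a \<Rightarrow> real) \<Rightarrow> ('a \<Rightarrow> real) \<Rightarrow> ('a \<Rightarrow> 'a) \<Rightarrow> ('a \<Rightarrow> real) \<Rightarrow> 'a \<Rightarrow> real" where
  "localised_lap f b G \<eta> x =
     (f x * \<eta> x + 2 * (\<Sum>i\<in>Basis. (G x \<bullet> i) * partial i \<eta> x)) + 1 * (b x * classical_lap \<eta> x)"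

text \<open>
  The equations for \<open>b\<close> are assumed for smooth functions on the whole space, without a condition at
  the boundary: they say that the extension of \<open>b\<close> by zero has gradient \<open>G\<close> and Laplacian \<open>f\<close>
  across the boundary.  The product \<open>\<eta> b\<close> inherits this property.
\<close>

lemma localised_lap_weak_lap:
  assumes f: "f \<in> L2 \<mu>" and b: "b \<in> L2 \<mu>" and G: "\<And>i. i \<in> Basis \<Longrightarrow> (\<lambda>x. G x \<bullet> i) \<in> L2 \<mu>"
    and W1: "\<And>\<phi> i. (\<And>k. Ck_on k UNIV \<phi>) \<Longrightarrow> i \<in> Basis \<Longrightarrow>
      L2_inner \<mu> b (partial i \<phi>) = - L2_inner \<mu> (\<lambda>x. G x \<bullet> i) \<phi>"
    and W2: "\<And>\<phi>. (\<And>k. Ck_on k UNIV \<phi>) \<Longrightarrow> L2_inner \<mu> b (classical_lap \<phi>) = L2_inner \<mu> f \<phi>"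
    and \<eta>: "\<And>k. Ck_on k UNIV \<eta>"
  shows "localised_lap f b G \<eta> \<in> L2 \<mu>"
    and "(\<And>k. Ck_on k UNIV \<phi>) \<Longrightarrow>
      L2_inner \<mu> (\<lambda>x. b x * \<eta> x) (classical_lap \<phi>) = L2_inner \<mu> (localised_lap f b G \<eta>) \<phi>"
proof -
  have p\<eta>: "Ck_on k UNIV (partial i \<eta>)" if "i \<in> Basis" for i k
    using Ck_on_partial[OF \<eta>[of "Suc k"] that] .
  have l\<eta>: "Ck_on k UNIV (classical_lap \<eta>)" for k
    using Ck_on_classical_lap[OF \<eta>[of "Suc (Suc k)"]] .
  have m1: "(\<lambda>x. f x * \<eta> x) \<in> L2 \<mu>" by (rule L2_mult_continuous[OF f Ck_on_continuous[OF \<eta>]])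
  have m2: "(\<lambda>x. (G x \<bullet> i) * partial i \<eta> x) \<in> L2 \<mu>" if "i \<in> Basis" for i
    by (rule L2_mult_continuous[OF G[OF that] Ck_on_continuous[OF p\<eta>[OF that]]])
  have m3: "(\<lambda>x. b x * classical_lap \<eta> x) \<in> L2 \<mu>"
    by (rule L2_mult_continuous[OF b Ck_on_continuous[OF l\<eta>]])
  have m2s: "(\<lambda>x. \<Sum>i\<in>Basis. (G x \<bullet> i) * partial i \<eta> x) \<in> L2 \<mu>" by (rule L2_sum[OF m2])
  have m12: "(\<lambda>x. f x * \<eta> x + 2 * (\<Sum>i\<in>Basis. (G x \<bullet> i) * partial i \<eta> x)) \<in> L2 \<mu>"
    by (rule L2_axpy[OF m1 m2s])
  have eq: "localised_lap f b G \<eta> = (\<lambda>x. (f x * \<eta> x + 2 * (\<Sum>i\<in>Basis. (G x \<bullet> i) * partial i \<eta> x))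
      + 1 * (b x * classical_lap \<eta> x))"
    by (rule ext) (simp only: localised_lap_def)
  show "localised_lap f b G \<eta> \<in> L2 \<mu>"
    unfolding eq by (rule L2_axpy[OF m12 m3])
  assume \<phi>: "\<And>k. Ck_on k UNIV \<phi>"
  have \<phi>L: "\<phi> \<in> L2 \<mu>" by (rule Ck_in_L2[OF \<phi>])
  have c1: "Ck_on k UNIV (\<lambda>x. \<eta> x * \<phi> x)" for k by (rule Ck_on_mult[OF \<eta> \<phi>])
  have c2: "Ck_on k UNIV (\<lambda>x. \<phi> x * partial i \<eta> x)" if "i \<in> Basis" for i k
    by (rule Ck_on_mult[OF \<phi> p\<eta>[OF that]])
  have c3: "Ck_on k UNIV (\<lambda>x. \<phi> x * classical_lap \<eta> x)" for k by (rule Ck_on_mult[OF \<phi> l\<eta>])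
  have A: "classical_lap (\<lambda>x. \<eta> x * \<phi> x) \<in> L2 \<mu>" using Ck_in_L2[OF Ck_on_classical_lap[OF c1]] .
  have P: "partial i (\<lambda>x. \<phi> x * partial i \<eta> x) \<in> L2 \<mu>" if "i \<in> Basis" for i
    using Ck_in_L2[OF Ck_on_partial[OF c2[OF that] that]] .
  have Q: "(\<lambda>x. \<phi> x * classical_lap \<eta> x) \<in> L2 \<mu>" by (rule Ck_in_L2[OF c3])
  have Ps: "(\<lambda>x. \<Sum>i\<in>Basis. 1 * partial i (\<lambda>x. \<phi> x * partial i \<eta> x) x) \<in> L2 \<mu>"
    using L2_sum[OF P] by simp
  have AP: "(\<lambda>x. classical_lap (\<lambda>x. \<eta> x * \<phi> x) x + (-2) * (\<Sum>i\<in>Basis. 1 * partial i (\<lambda>x. \<phi> x * partial i \<eta> x) x)) \<in> L2 \<mu>"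
    by (rule L2_axpy[OF A Ps])
  have assoc: "L2_inner \<mu> (\<lambda>x. u x * v x) w = L2_inner \<mu> u (\<lambda>x. v x * w x)" for u v w :: "'a \<Rightarrow> real"
    by (simp add: L2_inner_def mult.assoc)
  have "L2_inner \<mu> (\<lambda>x. b x * \<eta> x) (classical_lap \<phi>) = L2_inner \<mu> b (\<lambda>x. \<eta> x * classical_lap \<phi> x)"
    by (rule assoc)
  also have "(\<lambda>x. \<eta> x * classical_lap \<phi> x) = (\<lambda>x. (classical_lap (\<lambda>x. \<eta> x * \<phi> x) x
      + (-2) * (\<Sum>i\<in>Basis. 1 * partial i (\<lambda>x. \<phi> x * partial i \<eta> x) x)) + 1 * (\<phi> x * classical_lap \<eta> x))"
    by (rule ext) (simp add: Laplace_product_identity[OF \<eta> \<phi>])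
  also have "L2_inner \<mu> b \<dots> = (L2_inner \<mu> b (classical_lap (\<lambda>x. \<eta> x * \<phi> x))
      + (-2) * L2_inner \<mu> b (\<lambda>x. \<Sum>i\<in>Basis. 1 * partial i (\<lambda>x. \<phi> x * partial i \<eta> x) x))
      + 1 * L2_inner \<mu> b (\<lambda>x. \<phi> x * classical_lap \<eta> x)"
    unfolding L2_inner_axpy_right[OF AP Q b] L2_inner_axpy_right[OF A Ps b] ..
  also have "L2_inner \<mu> b (classical_lap (\<lambda>x. \<eta> x * \<phi> x)) = L2_inner \<mu> (\<lambda>x. f x * \<eta> x) \<phi>"
    unfolding W2[OF c1] by (rule assoc[symmetric])
  also have "L2_inner \<mu> b (\<lambda>x. \<Sum>i\<in>Basis. 1 * partial i (\<lambda>x. \<phi> x * partial i \<eta> x) x)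
      = (\<Sum>i\<in>Basis. 1 * L2_inner \<mu> (partial i (\<lambda>x. \<phi> x * partial i \<eta> x)) b)"
    unfolding L2_inner_commute[of \<mu> b "\<lambda>x. \<Sum>i\<in>Basis. 1 * partial i (\<lambda>x. \<phi> x * partial i \<eta> x) x"]
    by (rule L2_inner_sum[OF P b])
  also have "\<dots> = (\<Sum>i\<in>Basis. - L2_inner \<mu> (\<lambda>x. (G x \<bullet> i) * partial i \<eta> x) \<phi>)"
  proof (rule sum.cong[OF refl])
    fix i :: 'a assume i: "i \<in> Basis"
    have "L2_inner \<mu> b (partial i (\<lambda>x. \<phi> x * partial i \<eta> x)) = - L2_inner \<mu> (\<lambda>x. G x \<bullet> i) (\<lambda>x. \<phi> x * partial i \<eta> x)"
      by (rule W1[OF c2[OF i] i])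
    then show "1 * L2_inner \<mu> (partial i (\<lambda>x. \<phi> x * partial i \<eta> x)) b = - L2_inner \<mu> (\<lambda>x. (G x \<bullet> i) * partial i \<eta> x) \<phi>"
      by (simp only: assoc L2_inner_commute[of \<mu> _ b] mult.commute[of "\<phi> _"] mult_1)
  qed
  also have "L2_inner \<mu> b (\<lambda>x. \<phi> x * classical_lap \<eta> x) = L2_inner \<mu> (\<lambda>x. b x * classical_lap \<eta> x) \<phi>"
    by (simp only: assoc mult.commute[of "\<phi> _"])
  finally have lhs: "L2_inner \<mu> (\<lambda>x. b x * \<eta> x) (classical_lap \<phi>) =
      (L2_inner \<mu> (\<lambda>x. f x * \<eta> x) \<phi> + (-2) * (\<Sum>i\<in>Basis. - L2_inner \<mu> (\<lambda>x. (G x \<bullet> i) * partial i \<eta> x) \<phi>))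
      + 1 * L2_inner \<mu> (\<lambda>x. b x * classical_lap \<eta> x) \<phi>" .
  have s: "L2_inner \<mu> (\<lambda>x. \<Sum>i\<in>Basis. (G x \<bullet> i) * partial i \<eta> x) \<phi>
      = (\<Sum>i\<in>Basis. L2_inner \<mu> (\<lambda>x. (G x \<bullet> i) * partial i \<eta> x) \<phi>)"
    using L2_inner_sum[OF m2 \<phi>L, where c="\<lambda>_. 1"] by simp
  show "L2_inner \<mu> (\<lambda>x. b x * \<eta> x) (classical_lap \<phi>) = L2_inner \<mu> (localised_lap f b G \<eta>) \<phi>"
    unfolding lhs eq L2_inner_axpy[OF m12 m3 \<phi>L] L2_inner_axpy[OF m1 m2s \<phi>L] s by (simp add: sum_negf)
qed

text \<open>
  The functional \<open>T(\<eta>) = \<langle>f, \<Delta>(\<eta> b)\<rangle>\<close> vanishes on functions with small support, and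
  \<open>T(1) = \<parallel>f\<parallel>\<^sup>2\<close>.  Since \<open>T(\<eta>) = T(\<eta> \<psi>) + T(\<eta> (1 - \<psi>))\<close>, factors \<open>1 - \<psi>\<close> with \<open>\<psi>\<close> a step
  function of small support may be inserted without changing the value, until the product vanishes
  near the whole domain; this replaces a partition of unity.
\<close>

lemma harmonic_with_zero_Cauchy_data:
  assumes f: "f \<in> L2 \<mu>" and harm: "\<And>\<phi>. \<phi> \<in> Cc_inf \<Omega> \<Longrightarrow> L2_inner \<mu> f (classical_lap \<phi>) = 0"
    and b: "b \<in> L2 \<mu>" and G: "\<And>i. i \<in> Basis \<Longrightarrow> (\<lambda>x. G x \<bullet> i) \<in> L2 \<mu>"
    and W1: "\<And>\<phi> i. (\<And>k. Ck_on k UNIV \<phi>) \<Longrightarrow> i \<in> Basis \<Longrightarrow>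
      L2_inner \<mu> b (partial i \<phi>) = - L2_inner \<mu> (\<lambda>x. G x \<bullet> i) \<phi>"
    and W2: "\<And>\<phi>. (\<And>k. Ck_on k UNIV \<phi>) \<Longrightarrow> L2_inner \<mu> b (classical_lap \<phi>) = L2_inner \<mu> f \<phi>"
    and shift: "\<And>x. x \<in> frontier \<Omega> \<Longrightarrow> \<exists>e r. norm e = 1 \<and> 0 < r \<and>
      (\<forall>y\<in>closure \<Omega> \<inter> ball x r. \<forall>t>0. y + t *\<^sub>R e \<in> ball x r \<longrightarrow> y + t *\<^sub>R e \<in> \<Omega>)"
  shows "L2_inner \<mu> f f = 0"
proof -
  define T where "T \<eta> = L2_inner \<mu> f (localised_lap f b G \<eta>)" for \<eta>
  have lap1: "localised_lap f b G \<eta> \<in> L2 \<mu>" if "\<And>k. Ck_on k UNIV \<eta>" for \<eta>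
    using f b G W1 W2 that by (rule localised_lap_weak_lap(1))
  have lap2: "L2_inner \<mu> (\<lambda>x. b x * \<eta> x) (classical_lap \<phi>) = L2_inner \<mu> (localised_lap f b G \<eta>) \<phi>"
    if "\<And>k. Ck_on k UNIV \<eta>" "\<And>k. Ck_on k UNIV \<phi>" for \<eta> \<phi>
    using f b G W1 W2 that by (rule localised_lap_weak_lap(2))
  have T_add: "T (\<lambda>x. \<eta> x + \<zeta> x) = T \<eta> + T \<zeta>"
    if \<eta>: "\<And>k. Ck_on k UNIV \<eta>" and \<zeta>: "\<And>k. Ck_on k UNIV \<zeta>" for \<eta> \<zeta>
  proof -
    have d: "\<eta> differentiable (at x)" "\<zeta> differentiable (at x)" for x
      using \<eta>[of 1] \<zeta>[of 1] by simp_all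
    have "localised_lap f b G (\<lambda>x. \<eta> x + \<zeta> x) = (\<lambda>x. localised_lap f b G \<eta> x + 1 * localised_lap f b G \<zeta> x)"
      unfolding localised_lap_def partial_add[OF d] classical_lap_add[OF \<eta> \<zeta>]
      by (rule ext) (simp only: distrib_left sum.distrib mult_1 add_ac)
    then show ?thesis
      unfolding T_def using L2_inner_axpy_right[OF lap1[OF \<eta>] lap1[OF \<zeta>] f, of 1] by (simp only: mult_1)
  qed
  have good: "\<exists>r>0. \<forall>d>0. \<exists>z. norm z < d \<and> (\<forall>y\<in>closure \<Omega> \<inter> cball x r. y + z \<in> \<Omega>)"
    if x: "x \<in> closure \<Omega>" for x
  proof (cases "x \<in> \<Omega>")
    case True
    then obtain r where "r > 0" "cball x r \<subseteq> \<Omega>" using open_dom open_contains_cball by blast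
    then show ?thesis by (intro exI[of _ r]) (auto intro!: exI[of _ 0])
  next
    case False
    then have "x \<in> frontier \<Omega>" using x open_dom by (simp add: frontier_def interior_open)
    then obtain e r where e: "norm e = 1" and r: "0 < r"
      and s: "\<And>y t. y \<in> closure \<Omega> \<Longrightarrow> y \<in> ball x r \<Longrightarrow> t > 0 \<Longrightarrow> y + t *\<^sub>R e \<in> ball x r \<Longrightarrow> y + t *\<^sub>R e \<in> \<Omega>"
      using shift by blast
    have "\<exists>z. norm z < d \<and> (\<forall>y\<in>closure \<Omega> \<inter> cball x (r / 2). y + z \<in> \<Omega>)" if d: "d > 0" for d
    proof -
      define t where "t = min (d / 2) (r / 4)"
      have t: "0 < t" "t < d" "t < r / 2" using d r by (auto simp: t_def)
      have "y + t *\<^sub>R e \<in> \<Omega>" if y: "y \<in> closure \<Omega>" "y \<in> cball x (r / 2)" for y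
      proof (rule s[OF y(1) _ t(1)])
        show "y \<in> ball x r" using y(2) r by simp
        have "dist x (y + t *\<^sub>R e) \<le> dist x y + dist y (y + t *\<^sub>R e)" by (rule dist_triangle)
        also have "dist y (y + t *\<^sub>R e) = t" using e t(1) by (simp add: dist_norm)
        finally show "y + t *\<^sub>R e \<in> ball x r" using y(2) t(3) by simp
      qed
      then show ?thesis using e t by (intro exI[of _ "t *\<^sub>R e"]) auto
    qed
    then show ?thesis using r by (intro exI[of _ "r / 2"]) auto
  qed
  then obtain \<rho> where \<rho>: "\<And>x. x \<in> closure \<Omega> \<Longrightarrow> \<rho> x > 0"
    and \<rho>s: "\<And>x d. x \<in> closure \<Omega> \<Longrightarrow> d > 0 \<Longrightarrow> \<exists>z. norm z < d \<and> (\<forall>y\<in>closure \<Omega> \<inter> cball x (\<rho> x). y + z \<in> \<Omega>)"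
    by metis
  have T_local: "T \<eta> = 0"
    if \<eta>: "\<And>k. Ck_on k UNIV \<eta>" and x: "x \<in> closure \<Omega>" and supp: "\<And>y. y \<notin> cball x (\<rho> x) \<Longrightarrow> \<eta> y = 0" for \<eta> x
    unfolding T_def
  proof (rule weakly_harmonic_orthogonal[OF f harm, where K="closure \<Omega> \<inter> cball x (\<rho> x)" and U="\<lambda>y. b y * \<eta> y"])
    show "(\<lambda>y. b y * \<eta> y) \<in> L2 \<mu>" by (rule L2_mult_continuous[OF b Ck_on_continuous[OF \<eta>]])
    show "localised_lap f b G \<eta> \<in> L2 \<mu>" by (rule lap1[OF \<eta>])
    show "L2_inner \<mu> (\<lambda>y. b y * \<eta> y) (classical_lap \<phi>) = L2_inner \<mu> (localised_lap f b G \<eta>) \<phi>"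
      if "\<phi> \<in> Cc_inf UNIV" for \<phi>
      by (rule lap2[OF \<eta> Cc_inf_Ck[OF that]])
    show "compact (closure \<Omega> \<inter> cball x (\<rho> x))" by (intro closed_Int_compact) auto
    show "\<exists>z. norm z < d \<and> (\<forall>y\<in>closure \<Omega> \<inter> cball x (\<rho> x). y + z \<in> \<Omega>)" if "d > 0" for d
      by (rule \<rho>s[OF x that])
    fix y assume "y \<in> \<Omega>" "y \<notin> closure \<Omega> \<inter> cball x (\<rho> x)"
    then have y: "y \<notin> cball x (\<rho> x)" using closure_subset by blast
    show "b y * \<eta> y = 0" using supp[OF y] by simp
    have "partial i \<eta> y = 0" for i using closed_cball supp y by (rule partial_zero_outside)
    moreover have "classical_lap \<eta> y = 0" using closed_cball supp y by (rule classical_lap_zero_outside)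
    ultimately show "localised_lap f b G \<eta> y = 0" using supp[OF y] by (simp add: localised_lap_def)
  qed
  have "\<exists>\<psi>. (\<forall>k. Ck_on k UNIV \<psi>) \<and> (\<forall>y\<in>ball x (\<rho> x / 2). \<psi> y = 1) \<and> (\<forall>y. y \<notin> cball x (\<rho> x) \<longrightarrow> \<psi> y = 0)"
    if "x \<in> closure \<Omega>" for x
    by (rule smooth_step_exists[OF \<rho>[OF that], of x]) blast
  then obtain \<psi> where \<psi>: "\<And>x k. x \<in> closure \<Omega> \<Longrightarrow> Ck_on k UNIV (\<psi> x)"
    "\<And>x y. x \<in> closure \<Omega> \<Longrightarrow> y \<in> ball x (\<rho> x / 2) \<Longrightarrow> \<psi> x y = 1"
    "\<And>x y. x \<in> closure \<Omega> \<Longrightarrow> y \<notin> cball x (\<rho> x) \<Longrightarrow> \<psi> x y = 0" by metis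
  have "compact (closure \<Omega>)" using bounded_dom by simp
  moreover have "closure \<Omega> \<subseteq> (\<Union>x\<in>closure \<Omega>. ball x (\<rho> x / 2))" using \<rho> by fastforce
  ultimately obtain S where S: "S \<subseteq> closure \<Omega>" "finite S" "closure \<Omega> \<subseteq> (\<Union>x\<in>S. ball x (\<rho> x / 2))"
    using compactE_image[of "closure \<Omega>" "closure \<Omega>" "\<lambda>x. ball x (\<rho> x / 2)"] by auto
  define Q where "Q F y = (\<Prod>x\<in>F. 1 - \<psi> x y)" for F y
  have Q: "Ck_on k UNIV (Q F)" if "F \<subseteq> closure \<Omega>" for F k
    unfolding Q_def using that by (intro Ck_on_prod Ck_on_diff Ck_on_const \<psi>(1)) auto
  have "T (Q {}) = T (Q F)" if "finite F" "F \<subseteq> closure \<Omega>" for F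
    using that
  proof (induction F)
    case (insert x F)
    then have x: "x \<in> closure \<Omega>" and F: "F \<subseteq> closure \<Omega>" by auto
    have "T (Q F) = T (\<lambda>y. Q F y * \<psi> x y + Q F y * (1 - \<psi> x y))"
      by (rule arg_cong[where f=T]) (rule ext, simp add: algebra_simps)
    also have "\<dots> = T (\<lambda>y. Q F y * \<psi> x y) + T (\<lambda>y. Q F y * (1 - \<psi> x y))"
      by (intro T_add Ck_on_mult Ck_on_diff Ck_on_const Q[OF F] \<psi>(1)[OF x])
    also have "T (\<lambda>y. Q F y * \<psi> x y) = 0"
    proof (rule T_local[OF Ck_on_mult[OF Q[OF F] \<psi>(1)[OF x]] x])
      show "Q F y * \<psi> x y = 0" if "y \<notin> cball x (\<rho> x)" for y
        using \<psi>(3)[OF x that] by simp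
    qed
    also have "(\<lambda>y. Q F y * (1 - \<psi> x y)) = Q (insert x F)"
      by (rule ext) (simp add: Q_def insert(1,2) mult.commute)
    finally show ?case using insert.IH[OF F] by simp
  qed simp
  from this[OF S(2,1)] have "T (Q {}) = T (Q S)" .
  moreover have "T (Q {}) = L2_inner \<mu> f f"
    by (simp add: T_def Q_def[abs_def] localised_lap_def[abs_def] classical_lap_def)
  moreover have "T (Q S) = 0"
  proof -
    have "localised_lap f b G (Q S) y = 0" if y: "y \<in> \<Omega>" for y
    proof -
      have "y \<in> closure \<Omega>" using y closure_subset by blast
      then obtain x where x: "x \<in> S" "y \<in> ball x (\<rho> x / 2)" using S(3) by blast
      then have xc: "x \<in> closure \<Omega>" using S(1) by blast
      have zero: "Q S u = 0" if "u \<notin> - ball x (\<rho> x / 2)" for u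
        unfolding Q_def using that \<psi>(2)[OF xc] x(1) S(2) by (intro prod_zero) auto
      have cl: "closed (- ball x (\<rho> x / 2))" by auto
      have y': "y \<notin> - ball x (\<rho> x / 2)" using x(2) by simp
      have "partial i (Q S) y = 0" for i using cl zero y' by (rule partial_zero_outside)
      moreover have "classical_lap (Q S) y = 0" using cl zero y' by (rule classical_lap_zero_outside)
      ultimately show ?thesis using zero[OF y'] by (simp add: localised_lap_def)
    qed
    then have "T (Q S) = (\<integral>x. 0 \<partial>\<mu>)"
      unfolding T_def L2_inner_def by (intro Bochner_Integration.integral_cong) auto
    then show ?thesis by simp
  qed
  ultimately show ?thesis by simp
qed

end

section \<open>The boundary\<close>

lemma sets_hausdorff_measure: "sets (hausdorff_measure s :: 'a::euclidean_space measure) = sets borel"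
  unfolding hausdorff_measure_def using sets.sigma_sets_eq[of "borel :: 'a measure"]
  by (simp add: sets_measure_of)

lemma finite_surface_measure:
  fixes \<Omega> :: "'a::euclidean_space set"
  assumes "B1 \<Omega>"
  shows "finite_measure (surface_measure \<Omega>)"
proof -
  let ?H = "hausdorff_measure (real DIM('a) - 1) :: 'a measure"
  obtain \<S> where S: "finite \<S>" "frontier \<Omega> = \<Union>\<S>"
    "\<And>S. S \<in> \<S> \<Longrightarrow> closed_lipschitz_surface \<Omega> S \<and> emeasure ?H S < \<infinity>"
    using assms unfolding B1_def by blast
  have sets: "\<S> \<subseteq> sets ?H"
    using S(3) by (auto simp: sets_hausdorff_measure closed_lipschitz_surface_def)
  have "emeasure ?H (\<Union>S\<in>\<S>. S) \<le> (\<Sum>S\<in>\<S>. emeasure ?H S)"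
    using sets by (intro emeasure_subadditive_finite S(1)) auto
  also have "\<dots> < \<infinity>" using S(1,3) by simp
  finally have fin: "emeasure ?H (frontier \<Omega>) < \<infinity>" using S(2) by simp
  have "frontier \<Omega> \<in> sets ?H" by (simp add: sets_hausdorff_measure)
  then show ?thesis
    unfolding surface_measure_def using fin
    by (intro finite_measureI) (simp add: emeasure_restrict_space space_restrict_space)
qed

lemma continuous_in_L2_surface:
  fixes \<phi> :: "'a::euclidean_space \<Rightarrow> real"
  assumes "B1 \<Omega>" "continuous_on UNIV \<phi>"
  shows "\<phi> \<in> L2 (surface_measure \<Omega>)"
proof -
  have "compact (\<phi> ` frontier \<Omega>)"
    using assms by (meson B1_def compact_continuous_image compact_frontier_bounded continuous_on_subset subset_UNIV)
  then obtain C where C: "\<And>y. y \<in> \<phi> ` frontier \<Omega> \<Longrightarrow> norm y \<le> C"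
    using compact_imp_bounded bounded_iff by metis
  have "\<phi> \<in> borel_measurable (hausdorff_measure (real DIM('a) - 1))"
    using borel_measurable_continuous_onI[OF assms(2)]
    by (simp cong: measurable_cong_sets add: sets_hausdorff_measure)
  then have "\<phi> \<in> borel_measurable (surface_measure \<Omega>)"
    unfolding surface_measure_def by (rule measurable_restrict_space1)
  then show ?thesis
    using C by (intro finite_measure.bounded_in_L2[OF finite_surface_measure[OF assms(1)]])
      (auto simp: surface_measure_def space_restrict_space)
qed

text \<open>
  Near a boundary point the closure of the domain lies on or above the graph, and moving in
  direction \<open>e\<close> leads strictly above it.
\<close>

lemma lipschitz_inward_shift:
  fixes \<Omega> :: "'a::euclidean_space set"
  assumes "B1 \<Omega>" "x \<in> frontier \<Omega>"
  shows "\<exists>e r. norm e = 1 \<and> 0 < r \<and>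
      (\<forall>y\<in>closure \<Omega> \<inter> ball x r. \<forall>t>0. y + t *\<^sub>R e \<in> ball x r \<longrightarrow> y + t *\<^sub>R e \<in> \<Omega>)"
proof -
  obtain S where S: "x \<in> S" "closed_lipschitz_surface \<Omega> S"
    using assms unfolding B1_def by blast
  from S(2)[unfolded closed_lipschitz_surface_def, THEN conjunct2, THEN conjunct2, THEN bspec, OF S(1)]
  obtain e L r and g :: "'a \<Rightarrow> real" where e: "norm e = 1"
    and g: "L-lipschitz_on {z. z \<bullet> e = 0} g" and r: "0 < r"
    and loc': "\<forall>y\<in>ball x r. (y \<in> S \<longleftrightarrow> y \<bullet> e = g (y - (y \<bullet> e) *\<^sub>R e)) \<and>
      (y \<in> \<Omega> \<longleftrightarrow> g (y - (y \<bullet> e) *\<^sub>R e) < y \<bullet> e)"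
    by (elim exE conjE) (rule that)
  have loc: "y \<in> \<Omega> \<longleftrightarrow> g (y - (y \<bullet> e) *\<^sub>R e) < y \<bullet> e" if "y \<in> ball x r" for y
    by (rule conjunct2[OF bspec[OF loc' that]])
  have ee: "e \<bullet> e = 1" using e by (simp add: norm_eq_1)
  have perp: "(y - (y \<bullet> e) *\<^sub>R e) \<bullet> e = 0" for y by (simp add: inner_diff_left ee)
  have "continuous_on UNIV (\<lambda>y. g (y - (y \<bullet> e) *\<^sub>R e))"
    by (rule continuous_on_compose2[OF lipschitz_on_continuous_on[OF g]]) (auto intro!: continuous_intros simp: perp)
  then have op: "open {y. y \<bullet> e < g (y - (y \<bullet> e) *\<^sub>R e)}"
    by (intro open_Collect_less continuous_intros)
  have "y + t *\<^sub>R e \<in> \<Omega>"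
    if y: "y \<in> closure \<Omega>" "y \<in> ball x r" and t: "t > 0" "y + t *\<^sub>R e \<in> ball x r" for y t
  proof -
    have "g (y - (y \<bullet> e) *\<^sub>R e) \<le> y \<bullet> e"
    proof (rule ccontr)
      assume "\<not> ?thesis"
      then have "y \<in> ball x r \<inter> {y. y \<bullet> e < g (y - (y \<bullet> e) *\<^sub>R e)}" using y(2) by simp
      moreover have "open (ball x r \<inter> {y. y \<bullet> e < g (y - (y \<bullet> e) *\<^sub>R e)})" using op by (intro open_Int) auto
      ultimately have "\<Omega> \<inter> (ball x r \<inter> {y. y \<bullet> e < g (y - (y \<bullet> e) *\<^sub>R e)}) \<noteq> {}"
        using y(1) open_Int_closure_eq_empty[of "ball x r \<inter> {y. y \<bullet> e < g (y - (y \<bullet> e) *\<^sub>R e)}" \<Omega>] by blast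
      then show False using loc by force
    qed
    moreover have te: "(y + t *\<^sub>R e) \<bullet> e = y \<bullet> e + t" by (simp add: inner_add_left ee)
    moreover have "(y + t *\<^sub>R e) - ((y + t *\<^sub>R e) \<bullet> e) *\<^sub>R e = y - (y \<bullet> e) *\<^sub>R e"
      unfolding te by (simp add: algebra_simps)
    ultimately show ?thesis using loc[OF t(2)] t(1) by (simp only: te)
  qed
  then show ?thesis using e r by blast
qed

context bounded_open
begin

section \<open>Normal derivatives\<close>

lemma smooth_is_trace:
  assumes "B1 \<Omega>" "\<And>k. Ck_on k UNIV \<phi>"
  shows "is_trace \<Omega> \<phi> \<phi>"
  unfolding is_trace_def
proof (intro exI[of _ "\<lambda>n. \<phi>"] conjI allI)
  show "smooth_on UNIV \<phi>" using assms(2) by (simp add: smooth_on_def)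
  show "H1_tendsto \<Omega> (\<lambda>n. \<phi>) \<phi>" by (rule H1_tendsto_const[OF Ck_in_H1[OF assms(2)]])
  have "\<phi> \<in> L2 (surface_measure \<Omega>)"
    by (rule continuous_in_L2_surface[OF assms(1) Ck_on_continuous[OF assms(2)]])
  then show "L2_tendsto (surface_measure \<Omega>) (\<lambda>n. \<phi>) \<phi>"
    by (simp add: L2_tendsto_iff L2_inner_def)
qed

text \<open>
  The functional that defines the normal derivative, computed from arbitrary representatives of the
  weak gradients and of the weak Laplacian.
\<close>

lemma Green_functional_eq:
  assumes G: "is_weak_grad \<Omega> u G" and f: "is_weak_lap \<Omega> u f"
    and v: "v \<in> L2 \<mu>" and H: "is_weak_grad \<Omega> v H"
  shows "(\<integral>x. weak_grad \<Omega> u x \<bullet> weak_grad \<Omega> v x + v x * weak_lap \<Omega> u x \<partial>\<mu>)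
    = (\<Sum>i\<in>Basis. L2_inner \<mu> (\<lambda>x. G x \<bullet> i) (\<lambda>x. H x \<bullet> i)) + L2_inner \<mu> v f"
proof -
  let ?u = "weak_grad \<Omega> u" and ?v = "weak_grad \<Omega> v"
  have uL: "(\<lambda>x. ?u x \<bullet> i) \<in> L2 \<mu>" and vL: "(\<lambda>x. ?v x \<bullet> i) \<in> L2 \<mu>"
    and GL: "(\<lambda>x. G x \<bullet> i) \<in> L2 \<mu>" and HL: "(\<lambda>x. H x \<bullet> i) \<in> L2 \<mu>" if "i \<in> Basis" for i
    using is_weak_grad_weak_grad[OF G] is_weak_grad_weak_grad[OF H] G H that
    unfolding is_weak_grad_def by blast+
  have lL: "weak_lap \<Omega> u \<in> L2 \<mu>" "f \<in> L2 \<mu>"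
    using is_weak_lap_weak_lap[OF f] f unfolding is_weak_lap_def by blast+
  have int: "integrable \<mu> (\<lambda>x. (?u x \<bullet> i) * (?v x \<bullet> i))" if "i \<in> Basis" for i
    by (rule L2_mult_integrable[OF uL[OF that] vL[OF that]])
  have "(\<integral>x. ?u x \<bullet> ?v x + v x * weak_lap \<Omega> u x \<partial>\<mu>)
      = (\<integral>x. (\<Sum>i\<in>Basis. (?u x \<bullet> i) * (?v x \<bullet> i)) + v x * weak_lap \<Omega> u x \<partial>\<mu>)"
    by (subst euclidean_inner) simp
  also have "\<dots> = (\<Sum>i\<in>Basis. L2_inner \<mu> (\<lambda>x. ?u x \<bullet> i) (\<lambda>x. ?v x \<bullet> i)) + L2_inner \<mu> v (weak_lap \<Omega> u)"
    unfolding L2_inner_def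
    by (subst Bochner_Integration.integral_add)
       (auto intro!: Bochner_Integration.integrable_sum int L2_mult_integrable[OF v lL(1)] Bochner_Integration.integral_sum)
  also have "(\<Sum>i\<in>Basis. L2_inner \<mu> (\<lambda>x. ?u x \<bullet> i) (\<lambda>x. ?v x \<bullet> i))
      = (\<Sum>i\<in>Basis. L2_inner \<mu> (\<lambda>x. G x \<bullet> i) (\<lambda>x. H x \<bullet> i))"
  proof (intro sum.cong refl L2_inner_cong_AE)
    fix i :: 'a assume i: "i \<in> Basis"
    show "AE x in \<mu>. ?u x \<bullet> i = G x \<bullet> i" using weak_grad_AE[OF G] by eventually_elim simp
    show "AE x in \<mu>. ?v x \<bullet> i = H x \<bullet> i" using weak_grad_AE[OF H] by eventually_elim simp
  qed (use uL vL GL HL L2_measurable in blast)+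
  also have "L2_inner \<mu> v (weak_lap \<Omega> u) = L2_inner \<mu> v f"
    by (intro L2_inner_cong_AE L2_measurable v lL weak_lap_AE[OF f]) simp
  finally show ?thesis .
qed

text \<open>
  The normal derivatives of a test function are the functions orthogonal to all traces, whatever
  the test function is.  So the same representative is chosen for all of them, and a term that is
  linear in the test function can be compared with its value at \<open>0\<close>.
\<close>

lemma normal_deriv_Cc_inf:
  assumes \<phi>: "\<phi> \<in> Cc_inf \<Omega>"
  shows "normal_deriv \<Omega> \<phi> = normal_deriv \<Omega> (\<lambda>x. 0)"
proof -
  have "is_normal_deriv \<Omega> \<phi> w \<longleftrightarrow> w \<in> L2 (surface_measure \<Omega>) \<and>
      (\<forall>v\<in>H1 \<Omega>. \<forall>g. is_trace \<Omega> v g \<longrightarrow> (\<integral>x. g x * w x \<partial>surface_measure \<Omega>) = 0)"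
    if \<phi>: "\<phi> \<in> Cc_inf \<Omega>" for \<phi> w
  proof -
    have "(\<integral>x. weak_grad \<Omega> \<phi> x \<bullet> weak_grad \<Omega> v x + v x * weak_lap \<Omega> \<phi> x \<partial>\<mu>) = 0" if v: "v \<in> H1 \<Omega>" for v
    proof -
      obtain H where vL: "v \<in> L2 \<mu>" and H: "is_weak_grad \<Omega> v H" using v unfolding H1_def by blast
      have "L2_inner \<mu> v (classical_lap \<phi>) = (\<Sum>i\<in>Basis. L2_inner \<mu> v (partial i (partial i \<phi>)))"
        by (rule L2_inner_classical_lap[OF vL Cc_inf_Ck[OF \<phi>]])
      also have "\<dots> = (\<Sum>i\<in>Basis. - L2_inner \<mu> (\<lambda>x. gradient \<phi> x \<bullet> i) (\<lambda>x. H x \<bullet> i))"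
      proof (rule sum.cong[OF refl])
        fix i :: 'a assume i: "i \<in> Basis"
        have "(\<integral>x. v x * partial i (partial i \<phi>) x \<partial>\<mu>) = - (\<integral>x. (H x \<bullet> i) * partial i \<phi> x \<partial>\<mu>)"
          using H i Cc_inf_partial[OF \<phi> i] unfolding is_weak_grad_def by blast
        then show "L2_inner \<mu> v (partial i (partial i \<phi>)) = - L2_inner \<mu> (\<lambda>x. gradient \<phi> x \<bullet> i) (\<lambda>x. H x \<bullet> i)"
          by (simp add: L2_inner_def gradient_inner[OF i] mult.commute)
      qed
      finally show ?thesis
        using Green_functional_eq[OF is_weak_grad_gradient[OF Cc_inf_Ck[OF \<phi>]] is_weak_lap_Cc_inf[OF \<phi>] vL H]
        by (simp add: sum_negf)
    qed
    then show ?thesis unfolding is_normal_deriv_def by auto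
  qed
  from this[OF \<phi>] this[OF Cc_inf_zero] have "is_normal_deriv \<Omega> \<phi> = is_normal_deriv \<Omega> (\<lambda>x. 0)"
    by (intro ext) blast
  then show ?thesis unfolding normal_deriv_def by simp
qed

text \<open>
  A twice continuously differentiable \<open>v\<close> with compact support in the domain is a case of
  \<open>weakly_harmonic_orthogonal\<close> with translation \<open>0\<close>, so that orthogonality to Laplacians of smooth
  test functions extends to \<open>\<Delta>v\<close>.
\<close>

lemma L2H_iff_Cc_inf:
  "u \<in> L2H \<Omega> \<longleftrightarrow> u \<in> L2 \<mu> \<and> (\<forall>\<phi>\<in>Cc_inf \<Omega>. L2_inner \<mu> u (classical_lap \<phi>) = 0)"
proof
  assume "u \<in> L2H \<Omega>"
  then show "u \<in> L2 \<mu> \<and> (\<forall>\<phi>\<in>Cc_inf \<Omega>. L2_inner \<mu> u (classical_lap \<phi>) = 0)"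
    using Cc_inf_subset_Cck[of \<Omega> 2] by (auto simp: L2H_def L2_inner_def)
next
  assume u: "u \<in> L2 \<mu> \<and> (\<forall>\<phi>\<in>Cc_inf \<Omega>. L2_inner \<mu> u (classical_lap \<phi>) = 0)"
  have "L2_inner \<mu> u (classical_lap v) = 0" if "v \<in> Cck 2 \<Omega>" for v
  proof -
    obtain K where v: "Ck_on 2 UNIV v" and K: "compact K" "K \<subseteq> \<Omega>" "\<And>x. x \<notin> K \<Longrightarrow> v x = 0"
      using \<open>v \<in> Cck 2 \<Omega>\<close> unfolding Cck_iff by blast
    have lv: "Ck_on 0 UNIV (classical_lap v)"
      by (rule Ck_on_classical_lap) (use v in \<open>simp add: numeral_2_eq_2 del: Ck_on.simps\<close>)
    show ?thesis
    proof (rule weakly_harmonic_orthogonal[where U=v and K=K])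
      show "classical_lap v y = 0" if "y \<notin> K" for y
        using compact_imp_closed[OF K(1)] K(3) that by (rule classical_lap_zero_outside)
      show "L2_inner \<mu> v (classical_lap \<phi>) = L2_inner \<mu> (classical_lap v) \<phi>" if "\<phi> \<in> Cc_inf UNIV" for \<phi>
        by (rule Green_compact_support[OF v K Cc_inf_Ck[OF that]])
      show "\<exists>z. norm z < d \<and> (\<forall>x\<in>K. x + z \<in> \<Omega>)" if "d > 0" for d
        using that K(2) by (intro exI[of _ 0]) auto
    qed (use u K Ck_in_L2[OF v] Ck_in_L2[OF lv] in auto)
  qed
  then show "u \<in> L2H \<Omega>" using u by (simp add: L2H_def L2_inner_def)
qed

text \<open>
  The boundary integral in the eigenvalue equation takes the same value for a test function \<open>\<phi>\<close> and
  for \<open>0\<close>, where the other side of the equation is \<open>0\<close>.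
\<close>

lemma eigenfunction_lap_in_L2H:
  assumes "DBS_eigenfunction \<Omega> b"
  shows "weak_lap \<Omega> b \<in> L2H \<Omega>"
proof -
  obtain q where b: "b \<in> H0_lap \<Omega>"
    and q: "\<And>v. v \<in> H0_lap \<Omega> \<Longrightarrow> L2_inner \<mu> (weak_lap \<Omega> b) (weak_lap \<Omega> v) =
        q * (\<integral>x. normal_deriv \<Omega> b x * normal_deriv \<Omega> v x \<partial>surface_measure \<Omega>)"
    using assms unfolding DBS_eigenfunction_def DBS_eigenpair_def L2_inner_def by blast
  have bL: "weak_lap \<Omega> b \<in> L2 \<mu>" by (rule weak_lap_in_L2[OF b])
  have lap: "L2_inner \<mu> (weak_lap \<Omega> b) (weak_lap \<Omega> \<phi>) = L2_inner \<mu> (weak_lap \<Omega> b) (classical_lap \<phi>)"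
    if "\<phi> \<in> Cc_inf \<Omega>" for \<phi>
  proof (rule L2_inner_cong_AE)
    show "weak_lap \<Omega> \<phi> \<in> borel_measurable \<mu>"
      by (rule L2_measurable[OF weak_lap_in_L2[OF Cc_inf_in_H0_lap[OF that]]])
    show "classical_lap \<phi> \<in> borel_measurable \<mu>"
      by (rule L2_measurable[OF Cc_inf_in_L2[OF Cc_inf_lap[OF that]]])
    show "AE x in \<mu>. weak_lap \<Omega> \<phi> x = classical_lap \<phi> x"
      by (rule weak_lap_AE[OF is_weak_lap_Cc_inf[OF that]])
  qed (use L2_measurable[OF bL] in simp_all)
  have "L2_inner \<mu> (weak_lap \<Omega> b) (classical_lap \<phi>) = 0" if \<phi>: "\<phi> \<in> Cc_inf \<Omega>" for \<phi>
  proof -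
    have "L2_inner \<mu> (weak_lap \<Omega> b) (classical_lap \<phi>) = L2_inner \<mu> (weak_lap \<Omega> b) (classical_lap (\<lambda>x. 0))"
      unfolding lap[OF \<phi>, symmetric] lap[OF Cc_inf_zero, symmetric]
        q[OF Cc_inf_in_H0_lap[OF \<phi>]] q[OF Cc_inf_in_H0_lap[OF Cc_inf_zero]] normal_deriv_Cc_inf[OF \<phi>] ..
    also have "\<dots> = 0" by (simp add: L2_inner_def classical_lap_def)
    finally show ?thesis .
  qed
  then show ?thesis using bL by (simp add: L2H_iff_Cc_inf)
qed

section \<open>Completeness of the Laplacians of the eigenfunctions\<close>

text \<open>
  Approximation by test functions expresses the boundary condition \<open>b = 0\<close>, and Green's formula for
  functions smooth on the whole space expresses \<open>D\<^sub>\<nu>b = 0\<close>.  Together they are the two weak equations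
  across the boundary.
\<close>

lemma zero_normal_derivative_imp_zero:
  assumes B1: "B1 \<Omega>" and f: "f \<in> L2H \<Omega>" and b: "is_weak_lap \<Omega> b f" "is_weak_grad \<Omega> b G"
    and v: "\<And>n. v n \<in> Cc_inf \<Omega>" "L2_tendsto \<mu> v b"
      "\<And>i. i \<in> Basis \<Longrightarrow> L2_tendsto \<mu> (\<lambda>n. partial i (v n)) (\<lambda>x. G x \<bullet> i)"
    and w: "is_normal_deriv \<Omega> b w" "AE x in surface_measure \<Omega>. w x = 0"
  shows "L2_inner \<mu> f f = 0"
proof (rule harmonic_with_zero_Cauchy_data)
  have fL: "f \<in> L2 \<mu>" using f by (simp add: L2H_def)
  have bL: "b \<in> L2 \<mu>" using v(2) by (simp add: L2_tendsto_def)
  have GL: "(\<lambda>x. G x \<bullet> i) \<in> L2 \<mu>" if "i \<in> Basis" for i using v(3)[OF that] by (simp add: L2_tendsto_def)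
  show "f \<in> L2 \<mu>" by (rule fL)
  show "b \<in> L2 \<mu>" by (rule bL)
  show "(\<lambda>x. G x \<bullet> i) \<in> L2 \<mu>" if "i \<in> Basis" for i by (rule GL[OF that])
  show "L2_inner \<mu> f (classical_lap \<phi>) = 0" if "\<phi> \<in> Cc_inf \<Omega>" for \<phi>
    using f that by (simp add: L2H_iff_Cc_inf)
  have W1: "L2_inner \<mu> b (partial i \<phi>) = - L2_inner \<mu> (\<lambda>x. G x \<bullet> i) \<phi>"
    if \<phi>: "\<And>k. Ck_on k UNIV \<phi>" and i: "i \<in> Basis" for \<phi> i
  proof (rule LIMSEQ_unique)
    show "(\<lambda>n. L2_inner \<mu> (v n) (partial i \<phi>)) \<longlonglongrightarrow> L2_inner \<mu> b (partial i \<phi>)"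
      by (rule L2_tendsto_inner[OF v(2) Ck_in_L2[OF Ck_on_partial[OF \<phi> i]]])
    have "(\<lambda>n. - L2_inner \<mu> (partial i (v n)) \<phi>) \<longlonglongrightarrow> - L2_inner \<mu> (\<lambda>x. G x \<bullet> i) \<phi>"
      by (intro tendsto_minus L2_tendsto_inner[OF v(3)[OF i] Ck_in_L2[OF \<phi>]])
    moreover have "- L2_inner \<mu> (partial i (v n)) \<phi> = L2_inner \<mu> (v n) (partial i \<phi>)" for n
      using by_parts_Cc_inf[OF \<phi> v(1) i, of n] by (simp add: L2_inner_commute[of \<mu> "v n"] L2_inner_commute[of \<mu> \<phi>])
    ultimately show "(\<lambda>n. L2_inner \<mu> (v n) (partial i \<phi>)) \<longlonglongrightarrow> - L2_inner \<mu> (\<lambda>x. G x \<bullet> i) \<phi>" by simp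
  qed
  then show "L2_inner \<mu> b (partial i \<phi>) = - L2_inner \<mu> (\<lambda>x. G x \<bullet> i) \<phi>"
    if "\<And>k. Ck_on k UNIV \<phi>" "i \<in> Basis" for \<phi> i using that by blast
  show "L2_inner \<mu> b (classical_lap \<phi>) = L2_inner \<mu> f \<phi>" if \<phi>: "\<And>k. Ck_on k UNIV \<phi>" for \<phi>
  proof -
    have "(\<integral>x. \<phi> x * w x \<partial>surface_measure \<Omega>) =
        (\<integral>x. weak_grad \<Omega> b x \<bullet> weak_grad \<Omega> \<phi> x + \<phi> x * weak_lap \<Omega> b x \<partial>\<mu>)"
      using w(1) Ck_in_H1[OF \<phi>] smooth_is_trace[OF B1 \<phi>] unfolding is_normal_deriv_def by blast
    moreover have "(\<integral>x. \<phi> x * w x \<partial>surface_measure \<Omega>) = 0"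
      by (rule integral_eq_zero_AE) (use w(2) in \<open>eventually_elim, simp\<close>)
    ultimately have "(\<Sum>i\<in>Basis. L2_inner \<mu> (\<lambda>x. G x \<bullet> i) (\<lambda>x. gradient \<phi> x \<bullet> i)) + L2_inner \<mu> \<phi> f = 0"
      using Green_functional_eq[OF b(2,1) Ck_in_L2[OF \<phi>] is_weak_grad_gradient[OF \<phi>]] by simp
    moreover have "L2_inner \<mu> b (classical_lap \<phi>) = (\<Sum>i\<in>Basis. L2_inner \<mu> b (partial i (partial i \<phi>)))"
      by (rule L2_inner_classical_lap[OF bL \<phi>])
    moreover have "(\<Sum>i\<in>Basis. L2_inner \<mu> b (partial i (partial i \<phi>)))
        = (\<Sum>i\<in>Basis. - L2_inner \<mu> (\<lambda>x. G x \<bullet> i) (\<lambda>x. gradient \<phi> x \<bullet> i))"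
    proof (rule sum.cong[OF refl])
      fix i :: 'a assume i: "i \<in> Basis"
      show "L2_inner \<mu> b (partial i (partial i \<phi>)) = - L2_inner \<mu> (\<lambda>x. G x \<bullet> i) (\<lambda>x. gradient \<phi> x \<bullet> i)"
        using W1[OF Ck_on_partial[OF \<phi> i] i] by (simp add: gradient_inner i)
    qed
    ultimately show ?thesis by (simp add: sum_negf L2_inner_commute[of \<mu> \<phi>])
  qed
  show "\<exists>e r. norm e = 1 \<and> 0 < r \<and> (\<forall>y\<in>closure \<Omega> \<inter> ball x r. \<forall>t>0. y + t *\<^sub>R e \<in> ball x r \<longrightarrow> y + t *\<^sub>R e \<in> \<Omega>)"
    if "x \<in> frontier \<Omega>" for x
    by (rule lipschitz_inward_shift[OF B1 that])
qed

text \<open>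
  By the eigenvalue equation the normal derivatives of the \<open>b\<^sub>k\<close> are orthogonal; their squared norms
  are the boundary energies.  If these stayed above a positive bound, no subsequence could be Cauchy,
  contradicting compactness.
\<close>

lemma boundary_energy_bound_nonpos:
  assumes B2: "B2 \<Omega>" and on: "lap_orthonormal \<Omega> b" and eig: "\<And>j. j \<ge> 1 \<Longrightarrow> DBS_eigenfunction \<Omega> (b j)"
    and m: "\<And>k. k \<ge> 1 \<Longrightarrow> m \<le> boundary_energy \<Omega> (b k)"
  shows "m \<le> 0"
proof -
  let ?S = "surface_measure \<Omega>"
  define D where "D n = normal_deriv \<Omega> (b (Suc n))" for n
  have b: "b j \<in> H0_lap \<Omega>" if "j \<ge> 1" for j
    using eig[OF that] by (auto simp: DBS_eigenfunction_def DBS_eigenpair_def)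
  have "\<forall>n. b (Suc n) \<in> H0_lap \<Omega>" using b by simp
  moreover have "\<forall>n. lap_norm \<Omega> (b (Suc n)) \<le> 1"
    using on by (simp add: lap_orthonormal_def lap_norm_def)
  ultimately have "\<exists>r w. strict_mono (r :: nat \<Rightarrow> nat) \<and>
      L2_tendsto ?S (\<lambda>n. normal_deriv \<Omega> (b (Suc (r n)))) w"
    by (intro B2[unfolded B2_def, THEN conjunct2, THEN conjunct2, rule_format, of "\<lambda>n. b (Suc n)"] conjI) blast+
  then obtain r w where r: "strict_mono (r :: nat \<Rightarrow> nat)"
    and w': "L2_tendsto ?S (\<lambda>n. normal_deriv \<Omega> (b (Suc (r n)))) w" by blast
  then have w: "L2_tendsto ?S (\<lambda>n. D (r n)) w" by (simp add: D_def)
  have DL: "D (r n) \<in> L2 ?S" and wL: "w \<in> L2 ?S" for n using w by (auto simp: L2_tendsto_def)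
  have orth: "L2_inner ?S (D i) (D j) = 0" if "i \<noteq> j" for i j
  proof -
    obtain q where q: "\<And>v. v \<in> H0_lap \<Omega> \<Longrightarrow> lap_inner \<Omega> (b (Suc i)) v = q * L2_inner ?S (D i) (normal_deriv \<Omega> v)"
      using eig[of "Suc i"] unfolding DBS_eigenfunction_def DBS_eigenpair_def lap_inner_def L2_inner_def D_def by auto
    have "1 = q * L2_inner ?S (D i) (D i)"
      using q[OF b[of "Suc i"]] on by (simp add: lap_orthonormal_def D_def)
    then have "q \<noteq> 0" by auto
    moreover have "0 = q * L2_inner ?S (D i) (D j)"
      using q[OF b[of "Suc j"]] on that by (simp add: lap_orthonormal_def D_def)
    ultimately show ?thesis by simp
  qed
  have mD: "m \<le> L2_inner ?S (D i) (D i)" for i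
    using m[of "Suc i"] by (simp add: boundary_energy_def L2_inner_def D_def power2_eq_square)
  define A where "A n = L2_inner ?S (\<lambda>x. D (r n) x - w x) (\<lambda>x. D (r n) x - w x)" for n
  have "2 * m \<le> 2 * A n + 2 * A (Suc n)" for n
  proof -
    have ne: "r n \<noteq> r (Suc n)" using r by (metis less_irrefl lessI strict_mono_less)
    have "2 * m \<le> L2_inner ?S (\<lambda>x. D (r n) x - D (r (Suc n)) x) (\<lambda>x. D (r n) x - D (r (Suc n)) x)"
      using L2_inner_diff_self[OF DL DL, of n "Suc n"] orth[OF ne] mD[of "r n"] mD[of "r (Suc n)"] by simp
    also have "(\<lambda>x. D (r n) x - D (r (Suc n)) x) = (\<lambda>x. (D (r n) x - w x) + (w x - D (r (Suc n)) x))" by simp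
    also have "L2_inner ?S \<dots> \<dots> \<le> 2 * A n + 2 * L2_inner ?S (\<lambda>x. w x - D (r (Suc n)) x) (\<lambda>x. w x - D (r (Suc n)) x)"
      unfolding A_def by (rule L2_inner_add_self_le[OF L2_diff[OF DL wL] L2_diff[OF wL DL]])
    also have "L2_inner ?S (\<lambda>x. w x - D (r (Suc n)) x) (\<lambda>x. w x - D (r (Suc n)) x) = A (Suc n)"
      unfolding A_def L2_inner_def by (intro Bochner_Integration.integral_cong refl) (simp add: algebra_simps)
    finally show ?thesis .
  qed
  moreover have A0: "A \<longlonglongrightarrow> 0" unfolding A_def using w by (simp add: L2_tendsto_iff)
  then have "(\<lambda>n. 2 * A n + 2 * A (Suc n)) \<longlonglongrightarrow> 2 * 0 + 2 * 0"
    by (intro tendsto_intros LIMSEQ_Suc)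
  ultimately have "2 * m \<le> 2 * 0 + 2 * 0" by (intro LIMSEQ_le_const) auto
  then show ?thesis by simp
qed

text \<open>
  Normalising \<open>f\<close> makes the solution \<open>u\<close> of \<open>\<Delta>u = f\<close> a competitor in every constraint set, because
  \<open>a(u, b\<^sub>j)\<close> is the inner product of \<open>f\<close> with \<open>\<Delta>b\<^sub>j\<close>.  Its boundary energy is therefore a lower bound
  for all the maxima and has to vanish, and with it the normal derivative of \<open>u\<close>.
\<close>

theorem DBS_laplacians_complete:
  assumes B2: "B2 \<Omega>" and con: "DBS_construction \<Omega> b" and on: "lap_orthonormal \<Omega> b"
    and eig: "\<And>j. j \<ge> 1 \<Longrightarrow> DBS_eigenfunction \<Omega> (b j)"
    and f: "f \<in> L2H \<Omega>" and orth: "\<And>j. j \<ge> 1 \<Longrightarrow> L2_inner \<mu> f (weak_lap \<Omega> (b j)) = 0"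
  shows "AE x in \<mu>. f x = 0"
proof (rule L2_inner_self_eq_0)
  have B1: "B1 \<Omega>" using B2 by (simp add: B2_def)
  show fL: "f \<in> L2 \<mu>" using f by (simp add: L2H_def)
  show "L2_inner \<mu> f f = 0"
  proof (rule ccontr)
    assume ne: "L2_inner \<mu> f f \<noteq> 0"
    define c where "c = 1 / sqrt (L2_inner \<mu> f f)"
    have c: "c\<^sup>2 * L2_inner \<mu> f f = 1"
      using ne L2_inner_self_nonneg[of \<mu> f] by (simp add: c_def power_divide)
    define f1 where "f1 x = c * f x" for x
    have f1_inner: "L2_inner \<mu> f1 k = c * L2_inner \<mu> f k" for k
      by (simp add: f1_def L2_inner_def mult.assoc)
    have f1L: "f1 \<in> L2 \<mu>" unfolding f1_def by (rule L2_cmult[OF fL])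
    have f1H: "f1 \<in> L2H \<Omega>" using f f1L by (simp add: L2H_iff_Cc_inf f1_inner)
    have f1_norm: "L2_inner \<mu> f1 f1 = 1"
      using c by (simp add: f1_inner L2_inner_commute[of \<mu> f f1] power2_eq_square mult.assoc)
    obtain u G v where u: "u \<in> H0_lap \<Omega>" "is_weak_lap \<Omega> u f1" "is_weak_grad \<Omega> u G"
      and v: "\<And>n. v n \<in> Cc_inf \<Omega>" "L2_tendsto \<mu> v u"
        "\<And>i. i \<in> Basis \<Longrightarrow> L2_tendsto \<mu> (\<lambda>n. partial i (v n)) (\<lambda>x. G x \<bullet> i)"
      by (rule Dirichlet_problem_solvable[OF f1L]) (rule that)
    have uL: "weak_lap \<Omega> u \<in> L2 \<mu>" by (rule weak_lap_in_L2[OF u(1)])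
    have u_inner: "L2_inner \<mu> (weak_lap \<Omega> u) k = L2_inner \<mu> f1 k" if "k \<in> L2 \<mu>" for k
      using uL f1L that weak_lap_AE[OF u(2)] by (intro L2_inner_cong_AE) (auto intro: L2_measurable)
    have lap_inner_eq: "lap_inner \<Omega> u w = L2_inner \<mu> (weak_lap \<Omega> u) (weak_lap \<Omega> w)" for w
      by (simp only: lap_inner_def L2_inner_def)
    have "lap_inner \<Omega> u u = L2_inner \<mu> f1 (weak_lap \<Omega> u)"
      unfolding lap_inner_eq by (rule u_inner[OF uL])
    also have "\<dots> = 1"
      unfolding L2_inner_commute[of \<mu> f1 "weak_lap \<Omega> u"] u_inner[OF f1L] by (rule f1_norm)
    finally have "lap_inner \<Omega> u u = 1" .
    moreover have "lap_inner \<Omega> u (b j) = 0" if j: "j \<ge> 1" for j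
    proof -
      have "b j \<in> H0_lap \<Omega>"
        using eig[OF j] by (auto simp: DBS_eigenfunction_def DBS_eigenpair_def)
      then show ?thesis
        unfolding lap_inner_eq u_inner[OF weak_lap_in_L2[OF \<open>b j \<in> H0_lap \<Omega>\<close>]] f1_inner using orth[OF j] by simp
    qed
    ultimately have "u \<in> constraint_set \<Omega> b k" for k
      using u(1) by (simp add: constraint_set_def lap_norm_def)
    then have "boundary_energy \<Omega> u \<le> boundary_energy \<Omega> (b k)" if "k \<ge> 1" for k
      using con that unfolding DBS_construction_def by blast
    with B2 on eig have e: "boundary_energy \<Omega> u \<le> 0"
      by (rule boundary_energy_bound_nonpos)
    obtain w where "is_normal_deriv \<Omega> u w" using B2 u(1) unfolding B2_def by blast
    then have n: "is_normal_deriv \<Omega> u (normal_deriv \<Omega> u)"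
      unfolding normal_deriv_def by (rule someI[of "is_normal_deriv \<Omega> u"])
    then have "normal_deriv \<Omega> u \<in> L2 (surface_measure \<Omega>)" by (simp add: is_normal_deriv_def)
    moreover have "L2_inner (surface_measure \<Omega>) (normal_deriv \<Omega> u) (normal_deriv \<Omega> u) = 0"
    proof (rule antisym[OF _ L2_inner_self_nonneg])
      show "L2_inner (surface_measure \<Omega>) (normal_deriv \<Omega> u) (normal_deriv \<Omega> u) \<le> 0"
        using e by (simp add: boundary_energy_def L2_inner_def power2_eq_square)
    qed
    ultimately have "AE x in surface_measure \<Omega>. normal_deriv \<Omega> u x = 0" by (rule L2_inner_self_eq_0)
    from zero_normal_derivative_imp_zero[OF B1 f1H u(2,3) v n this] show False using f1_norm by simp
  qed
qed

end

section \<open>Orthonormal expansions\<close>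

text \<open>
  By Bessel's inequality the sums of the squared coefficients converge, and their increments are the
  squared distances of the partial sums, which therefore form a Cauchy sequence.
\<close>

lemma orthonormal_expansion_converges:
  assumes f: "f \<in> L2 M" and h: "\<And>j. j \<ge> 1 \<Longrightarrow> h j \<in> L2 M"
    and on: "\<And>i j. i \<ge> 1 \<Longrightarrow> j \<ge> 1 \<Longrightarrow> L2_inner M (h i) (h j) = (if i = j then 1 else 0)"
  obtains p where "L2_tendsto M (\<lambda>n x. \<Sum>j=1..n. L2_inner M f (h j) * h j x) p"
    "\<And>j. j \<ge> 1 \<Longrightarrow> L2_inner M p (h j) = L2_inner M f (h j)"
proof -
  define c where "c j = L2_inner M f (h j)" for j
  define s where "s n x = (\<Sum>j=1..n. c j * h j x)" for n :: nat and x
  have part: "(\<lambda>x. \<Sum>j\<in>I. c j * h j x) \<in> L2 M" if "I \<subseteq> {1..}" for I :: "nat set"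
    using that by (intro L2_sum L2_cmult h) auto
  have sL: "s n \<in> L2 M" for n using part[of "{1..n}"] by (simp add: s_def[abs_def])
  have fin_h: "L2_inner M (\<lambda>x. \<Sum>j\<in>I. c j * h j x) (h i) = (if i \<in> I then c i else 0)"
    if "I \<subseteq> {1..}" "finite I" "i \<ge> 1" for I i
  proof -
    have "L2_inner M (\<lambda>x. \<Sum>j\<in>I. c j * h j x) (h i) = (\<Sum>j\<in>I. c j * L2_inner M (h j) (h i))"
      using that by (intro L2_inner_sum h) auto
    also have "\<dots> = (\<Sum>j\<in>I. if j = i then c j else 0)"
      using that on by (intro sum.cong) auto
    finally show ?thesis using that(2) by simp
  qed
  have fin_self: "L2_inner M (\<lambda>x. \<Sum>j\<in>I. c j * h j x) (\<lambda>x. \<Sum>j\<in>I. c j * h j x) = (\<Sum>j\<in>I. (c j)\<^sup>2)"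
    if I: "I \<subseteq> {1..}" "finite I" for I
  proof -
    have "L2_inner M (\<lambda>x. \<Sum>j\<in>I. c j * h j x) (\<lambda>x. \<Sum>j\<in>I. c j * h j x)
        = (\<Sum>j\<in>I. c j * L2_inner M (h j) (\<lambda>x. \<Sum>j\<in>I. c j * h j x))"
      using I by (intro L2_inner_sum h part) auto
    also have "\<dots> = (\<Sum>j\<in>I. c j * c j)"
    proof (rule sum.cong[OF refl])
      fix j assume j: "j \<in> I"
      then have "j \<ge> 1" using I by auto
      from fin_h[OF I this] show "c j * L2_inner M (h j) (\<lambda>x. \<Sum>j\<in>I. c j * h j x) = c j * c j"
        using j by (simp add: L2_inner_commute[of M "h j"])
    qed
    finally show ?thesis by (simp add: power2_eq_square)
  qed
  have bessel: "(\<Sum>j=1..n. (c j)\<^sup>2) \<le> L2_inner M f f" for n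
  proof -
    have "L2_inner M (s n) f = (\<Sum>j=1..n. c j * L2_inner M (h j) f)"
      unfolding s_def[abs_def] using f by (intro L2_inner_sum h) auto
    then have "L2_inner M f (s n) = (\<Sum>j=1..n. (c j)\<^sup>2)"
      by (simp add: L2_inner_commute[of M f] c_def power2_eq_square)
    moreover have "L2_inner M (s n) (s n) = (\<Sum>j=1..n. (c j)\<^sup>2)"
      unfolding s_def[abs_def] by (rule fin_self) auto
    moreover have "0 \<le> L2_inner M (\<lambda>x. f x - s n x) (\<lambda>x. f x - s n x)" by (rule L2_inner_self_nonneg)
    ultimately show ?thesis using L2_inner_diff_self[OF f sL, of n] by simp
  qed
  define a where "a n = (\<Sum>j=1..n. (c j)\<^sup>2)" for n
  have "convergent a"
  proof (rule Bseq_mono_convergent)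
    show "Bseq a" using bessel by (intro BseqI'[where K="L2_inner M f f"]) (simp add: a_def sum_nonneg)
    show "\<forall>m n. m \<le> n \<longrightarrow> a m \<le> a n" unfolding a_def by (auto intro!: sum_mono2)
  qed
  then have aC: "Cauchy a" by (rule convergent_Cauchy)
  have diff: "L2_inner M (\<lambda>x. s n x - s m x) (\<lambda>x. s n x - s m x) = a n - a m" if mn: "m \<le> n" for m n
  proof -
    have un: "{1..n} = {1..m} \<union> {m<..n}" using mn by auto
    have "s n x - s m x = (\<Sum>j\<in>{m<..n}. c j * h j x)" for x
      unfolding s_def un by (subst sum.union_disjoint) auto
    moreover have "a n - a m = (\<Sum>j\<in>{m<..n}. (c j)\<^sup>2)"
      unfolding a_def un by (subst sum.union_disjoint) auto
    ultimately show ?thesis using fin_self[of "{m<..n}"] by (simp add: subset_iff)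
  qed
  have "L2_Cauchy M s"
    unfolding L2_Cauchy_def
  proof (intro conjI allI impI sL)
    fix e :: real assume "e > 0"
    then obtain N where N: "\<And>m n. m \<ge> N \<Longrightarrow> n \<ge> N \<Longrightarrow> norm (a m - a n) < e"
      using CauchyD[OF aC] by blast
    have "L2_inner M (\<lambda>x. s m x - s n x) (\<lambda>x. s m x - s n x) < e" if "m \<ge> N" "n \<ge> N" for m n
    proof (cases "n \<le> m")
      case True
      then show ?thesis using diff[OF True] N[OF that] by simp
    next
      case False
      have "L2_inner M (\<lambda>x. s m x - s n x) (\<lambda>x. s m x - s n x) = L2_inner M (\<lambda>x. s n x - s m x) (\<lambda>x. s n x - s m x)"
        unfolding L2_inner_def by (intro Bochner_Integration.integral_cong refl) (simp add: algebra_simps)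
      then show ?thesis using diff[of m n] False N[OF that(2,1)] by simp
    qed
    then show "\<exists>N. \<forall>m\<ge>N. \<forall>n\<ge>N. L2_inner M (\<lambda>x. s m x - s n x) (\<lambda>x. s m x - s n x) < e" by blast
  qed
  then obtain p where p: "L2_tendsto M s p" by (rule L2_complete)
  have "L2_inner M p (h j) = L2_inner M f (h j)" if j: "j \<ge> 1" for j
  proof (rule LIMSEQ_unique)
    show "(\<lambda>n. L2_inner M (s n) (h j)) \<longlonglongrightarrow> L2_inner M p (h j)" by (rule L2_tendsto_inner[OF p h[OF j]])
    show "(\<lambda>n. L2_inner M (s n) (h j)) \<longlonglongrightarrow> L2_inner M f (h j)"
    proof (rule tendsto_eventually)
      show "\<forall>\<^sub>F n in sequentially. L2_inner M (s n) (h j) = L2_inner M f (h j)"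
        using eventually_ge_at_top[of j]
      proof eventually_elim
        case (elim n)
        then show ?case using fin_h[of "{1..n}" j] j by (simp add: s_def[abs_def] c_def)
      qed
    qed
  qed
  then show thesis using p that by (simp add: s_def[abs_def] c_def)
qed

text \<open>
  Let \<open>p\<close> be the limit of the partial sums for \<open>f\<close>.  The remainder of the expansion of any \<open>v \<in> V\<close> is
  orthogonal to \<open>h\<close> and lies in \<open>V\<close>, so \<open>v\<close> is itself a limit of linear combinations of \<open>h\<close>, to which
  \<open>f - p\<close> is orthogonal.  Hence \<open>p\<close> is a projection of \<open>f\<close>, and the chosen one agrees with it almost
  everywhere.
\<close>

lemma orth_proj_expansion:
  assumes V: "V \<subseteq> L2 M"
    and V_diff: "\<And>u v. u \<in> V \<Longrightarrow> v \<in> V \<Longrightarrow> (\<lambda>x. u x - v x) \<in> V"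
    and V_lim: "\<And>F u. (\<And>n. F n \<in> V) \<Longrightarrow> L2_tendsto M F u \<Longrightarrow> u \<in> V"
    and V_sum: "\<And>(c :: nat \<Rightarrow> real) n. (\<lambda>x. \<Sum>j=1..n. c j * h j x) \<in> V"
    and h: "\<And>j. j \<ge> 1 \<Longrightarrow> h j \<in> V"
    and on: "\<And>i j. i \<ge> 1 \<Longrightarrow> j \<ge> 1 \<Longrightarrow> L2_inner M (h i) (h j) = (if i = j then 1 else 0)"
    and complete: "\<And>v. v \<in> V \<Longrightarrow> (\<And>j. j \<ge> 1 \<Longrightarrow> L2_inner M v (h j) = 0) \<Longrightarrow> AE x in M. v x = 0"
    and f: "f \<in> L2 M"
  shows "L2_tendsto M (\<lambda>n x. \<Sum>j=1..n. L2_inner M f (h j) * h j x) (orth_proj M V f)"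
proof -
  have hL: "h j \<in> L2 M" if "j \<ge> 1" for j using h[OF that] V by blast
  obtain p where p: "L2_tendsto M (\<lambda>n x. \<Sum>j=1..n. L2_inner M f (h j) * h j x) p"
    and ph: "\<And>j. j \<ge> 1 \<Longrightarrow> L2_inner M p (h j) = L2_inner M f (h j)"
    using orthonormal_expansion_converges[OF f hL on] by blast
  have pV: "p \<in> V" by (rule V_lim[OF V_sum p])
  have pL: "p \<in> L2 M" using pV V by blast
  have fpL: "(\<lambda>x. f x - p x) \<in> L2 M" by (rule L2_diff[OF f pL])
  have fp: "L2_inner M (\<lambda>x. f x - p x) v = 0" if v: "v \<in> V" for v
  proof -
    have vL: "v \<in> L2 M" using v V by blast
    obtain q where q: "L2_tendsto M (\<lambda>n x. \<Sum>j=1..n. L2_inner M v (h j) * h j x) q"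
      and qh: "\<And>j. j \<ge> 1 \<Longrightarrow> L2_inner M q (h j) = L2_inner M v (h j)"
      using orthonormal_expansion_converges[OF vL hL on] by blast
    have qV: "q \<in> V" by (rule V_lim[OF V_sum q])
    have qL: "q \<in> L2 M" using qV V by blast
    have "AE x in M. v x - q x = 0"
    proof (rule complete[OF V_diff[OF v qV]])
      show "L2_inner M (\<lambda>x. v x - q x) (h j) = 0" if "j \<ge> 1" for j
        unfolding L2_inner_diff[OF vL qL hL[OF that]] qh[OF that] by simp
    qed
    then have vq: "AE x in M. v x = q x" by eventually_elim simp
    have "L2_inner M (\<lambda>x. \<Sum>j=1..n. L2_inner M v (h j) * h j x) (\<lambda>x. f x - p x) = 0" for n
    proof -
      have "L2_inner M (\<lambda>x. \<Sum>j=1..n. L2_inner M v (h j) * h j x) (\<lambda>x. f x - p x)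
          = (\<Sum>j=1..n. L2_inner M v (h j) * L2_inner M (h j) (\<lambda>x. f x - p x))"
        using hL fpL by (intro L2_inner_sum) auto
      also have "\<dots> = (\<Sum>j=1..n. 0)"
      proof (rule sum.cong[OF refl])
        fix j assume "j \<in> {1..n}"
        then have j: "j \<ge> 1" by simp
        show "L2_inner M v (h j) * L2_inner M (h j) (\<lambda>x. f x - p x) = 0"
          unfolding L2_inner_diff_right[OF f pL hL[OF j]] using ph[OF j]
          by (simp add: L2_inner_commute[of M "h j"])
      qed
      finally show ?thesis by simp
    qed
    then have "(\<lambda>n. 0) \<longlonglongrightarrow> L2_inner M q (\<lambda>x. f x - p x)"
      using L2_tendsto_inner[OF q fpL] by simp
    then have "L2_inner M q (\<lambda>x. f x - p x) = 0" by (simp add: LIMSEQ_const_iff)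
    moreover have "L2_inner M (\<lambda>x. f x - p x) v = L2_inner M (\<lambda>x. f x - p x) q"
      using L2_measurable[OF fpL] L2_measurable[OF vL] L2_measurable[OF qL] vq by (intro L2_inner_cong_AE) auto
    ultimately show ?thesis by (simp add: L2_inner_commute[of M q])
  qed
  define P where "P = orth_proj M V f"
  have "P \<in> V \<and> (\<forall>v\<in>V. L2_inner M (\<lambda>x. f x - P x) v = 0)"
    unfolding P_def orth_proj_def by (rule someI[of _ p]) (use pV fp in blast)
  then have PV: "P \<in> V" and fP: "\<And>v. v \<in> V \<Longrightarrow> L2_inner M (\<lambda>x. f x - P x) v = 0" by auto
  have PL: "P \<in> L2 M" using PV V by blast
  have "AE x in M. P x - p x = 0"
  proof (rule complete[OF V_diff[OF PV pV]])
    fix j :: nat assume j: "j \<ge> 1"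
    show "L2_inner M (\<lambda>x. P x - p x) (h j) = 0"
      using fp[OF h[OF j]] fP[OF h[OF j]] L2_inner_diff[OF f pL hL[OF j]] L2_inner_diff[OF f PL hL[OF j]]
        L2_inner_diff[OF PL pL hL[OF j]] by simp
  qed
  then have Pp: "AE x in M. P x = p x" by eventually_elim simp
  let ?s = "\<lambda>n x. \<Sum>j=1..n. L2_inner M f (h j) * h j x"
  have sL: "?s n \<in> L2 M" for n by (rule subsetD[OF V V_sum])
  have "L2_inner M (\<lambda>x. ?s n x - P x) (\<lambda>x. ?s n x - P x) = L2_inner M (\<lambda>x. ?s n x - p x) (\<lambda>x. ?s n x - p x)" for n
  proof (rule L2_inner_cong_AE)
    show "AE x in M. ?s n x - P x = ?s n x - p x" "AE x in M. ?s n x - P x = ?s n x - p x"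
      using Pp by (eventually_elim, simp)+
  qed (rule L2_measurable[OF L2_diff[OF sL PL]] L2_measurable[OF L2_diff[OF sL pL]])+
  then have "L2_tendsto M ?s P"
    using p PL by (simp add: L2_tendsto_iff)
  then show ?thesis unfolding P_def .
qed

section \<open>The harmonic Bergman space\<close>

theorem theorem6p2:
  fixes \<Omega> :: "'a::euclidean_space set"
    and b h :: "nat \<Rightarrow> 'a \<Rightarrow> real"
  assumes "DIM('a) \<ge> 2"
    and "region \<Omega>"
    and "B2 \<Omega>"
    and "DBS_construction \<Omega> b"
    and "lap_orthonormal \<Omega> b"
    and "\<And>j. j \<ge> 1 \<Longrightarrow> DBS_eigenfunction \<Omega> (b j)"
    and "\<And>j. j \<ge> 1 \<Longrightarrow> smooth_on \<Omega> (h j) \<and> (AE x in lebesgue_on \<Omega>. h j x = weak_lap \<Omega> (b j) x)"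
  shows "maximal_orthonormal_set (lebesgue_on \<Omega>) (L2H \<Omega>) (h ` {1..}) \<and>
    (\<forall>f\<in>L2 (lebesgue_on \<Omega>).
       L2_tendsto (lebesgue_on \<Omega>) (\<lambda>M. H_operator \<Omega> h M f) (harmonic_proj \<Omega> f) \<and>
       L2_tendsto (lebesgue_on \<Omega>)
         (\<lambda>M x. \<Sum>j=1..M. L2_inner (lebesgue_on \<Omega>) f (h j) * h j x) (harmonic_proj \<Omega> f))"
proof -
  interpret bounded_open \<Omega>
    using assms(2,3) by unfold_locales (auto simp: region_def B2_def B1_def)
  have bH: "b j \<in> H0_lap \<Omega>" if "j \<ge> 1" for j
    using assms(6)[OF that] by (auto simp: DBS_eigenfunction_def DBS_eigenpair_def)
  have wL: "weak_lap \<Omega> (b j) \<in> L2 \<mu>" if "j \<ge> 1" for j by (rule weak_lap_in_L2[OF bH[OF that]])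
  have h_AE: "AE x in \<mu>. h j x = weak_lap \<Omega> (b j) x" if "j \<ge> 1" for j using assms(7)[OF that] by blast
  have h_meas: "h j \<in> borel_measurable \<mu>" if j: "j \<ge> 1" for j
  proof -
    have "continuous_on \<Omega> (h j)"
      using assms(7)[OF j] unfolding smooth_on_def by (metis Ck_on.simps(1))
    then show ?thesis by (rule continuous_imp_measurable_on_sets_lebesgue[OF _ dom_sets])
  qed
  have hL: "h j \<in> L2 \<mu>" if "j \<ge> 1" for j
    by (rule L2_cong_AE[OF wL[OF that] h_meas[OF that] h_AE[OF that]])
  have h_inner: "L2_inner \<mu> (h j) k = L2_inner \<mu> (weak_lap \<Omega> (b j)) k" if "j \<ge> 1" "k \<in> L2 \<mu>" for j k
    using hL[OF that(1)] wL[OF that(1)] that(2) h_AE[OF that(1)]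
    by (intro L2_inner_cong_AE) (auto intro: L2_measurable)
  have on: "L2_inner \<mu> (h i) (h j) = (if i = j then 1 else 0)" if "i \<ge> 1" "j \<ge> 1" for i j
  proof -
    have "L2_inner \<mu> (h i) (h j) = L2_inner \<mu> (weak_lap \<Omega> (b i)) (weak_lap \<Omega> (b j))"
      using h_inner[OF that(1) hL[OF that(2)]] h_inner[OF that(2) wL[OF that(1)]]
      by (simp add: L2_inner_commute[of \<mu> "weak_lap \<Omega> (b i)"])
    then show ?thesis using assms(5) that by (simp add: lap_orthonormal_def lap_inner_def L2_inner_def)
  qed
  have hH: "h j \<in> L2H \<Omega>" if j: "j \<ge> 1" for j
    using eigenfunction_lap_in_L2H[OF assms(6)[OF j]] hL[OF j]
    by (simp add: L2H_iff_Cc_inf h_inner[OF j] Cc_inf_in_L2[OF Cc_inf_lap])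
  have V_sum: "(\<lambda>x. \<Sum>j=1..n. c j * h j x) \<in> L2H \<Omega>" for c and n :: nat
  proof -
    have "L2_inner \<mu> (\<lambda>x. \<Sum>j=1..n. c j * h j x) (classical_lap \<phi>) = 0" if \<phi>: "\<phi> \<in> Cc_inf \<Omega>" for \<phi>
    proof -
      have "L2_inner \<mu> (\<lambda>x. \<Sum>j=1..n. c j * h j x) (classical_lap \<phi>)
          = (\<Sum>j=1..n. c j * L2_inner \<mu> (h j) (classical_lap \<phi>))"
        using hL Cc_inf_in_L2[OF Cc_inf_lap[OF \<phi>]] by (intro L2_inner_sum) auto
      also have "\<dots> = (\<Sum>j=1..n. 0)"
        using hH \<phi> by (intro sum.cong) (auto simp: L2H_iff_Cc_inf)
      finally show ?thesis by simp
    qed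
    moreover have "(\<lambda>x. \<Sum>j=1..n. c j * h j x) \<in> L2 \<mu>" using hL by (intro L2_sum L2_cmult) auto
    ultimately show ?thesis by (simp add: L2H_iff_Cc_inf)
  qed
  have complete: "AE x in \<mu>. v x = 0" if v: "v \<in> L2H \<Omega>" and "\<And>j. j \<ge> 1 \<Longrightarrow> L2_inner \<mu> v (h j) = 0" for v
    using assms(3,4,5,6) v
  proof (rule DBS_laplacians_complete)
    show "L2_inner \<mu> v (weak_lap \<Omega> (b j)) = 0" if j: "j \<ge> 1" for j
      using h_inner[OF j, of v] v \<open>\<And>j. j \<ge> 1 \<Longrightarrow> L2_inner \<mu> v (h j) = 0\<close>[OF j]
      by (simp add: L2H_def L2_inner_commute[of \<mu> v])
  qed
  have exp: "L2_tendsto \<mu> (\<lambda>M x. \<Sum>j=1..M. L2_inner \<mu> f (h j) * h j x) (harmonic_proj \<Omega> f)"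
    if f: "f \<in> L2 \<mu>" for f
    unfolding harmonic_proj_def
  proof (rule orth_proj_expansion)
    show "L2H \<Omega> \<subseteq> L2 \<mu>" by (auto simp: L2H_def)
    show "(\<lambda>x. u x - v x) \<in> L2H \<Omega>" if u: "u \<in> L2H \<Omega>" and v: "v \<in> L2H \<Omega>" for u v
    proof -
      have L: "u \<in> L2 \<mu>" "v \<in> L2 \<mu>" using u v by (simp_all add: L2H_iff_Cc_inf)
      then show ?thesis
        using u v by (simp add: L2H_iff_Cc_inf L2_diff L2_inner_diff[OF L Cc_inf_in_L2[OF Cc_inf_lap]])
    qed
    show "u \<in> L2H \<Omega>" if F: "\<And>n. F n \<in> L2H \<Omega>" and lim: "L2_tendsto \<mu> F u" for F u
    proof -
      have "L2_inner \<mu> u (classical_lap \<phi>) = 0" if \<phi>: "\<phi> \<in> Cc_inf \<Omega>" for \<phi>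
      proof -
        have "L2_inner \<mu> (F n) (classical_lap \<phi>) = 0" for n
          using F[of n] \<phi> unfolding L2H_iff_Cc_inf by blast
        then have "(\<lambda>n. 0) \<longlonglongrightarrow> L2_inner \<mu> u (classical_lap \<phi>)"
          using L2_tendsto_inner[OF lim Cc_inf_in_L2[OF Cc_inf_lap[OF \<phi>]]] by simp
        then show ?thesis by (simp add: LIMSEQ_const_iff)
      qed
      then show ?thesis using lim by (simp add: L2H_iff_Cc_inf L2_tendsto_def)
    qed
  qed (use V_sum hH on complete f in auto)
  have op: "H_operator \<Omega> h M f = (\<lambda>x. \<Sum>j=1..M. L2_inner \<mu> f (h j) * h j x)" if f: "f \<in> L2 \<mu>" for f M
  proof
    fix x
    have "(\<lambda>y. H_kernel h M x y * f y) = (\<lambda>y. (\<Sum>j=1..M. h j x * h j y) * f y)"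
      by (simp add: H_kernel_def)
    then have "H_operator \<Omega> h M f x = L2_inner \<mu> (\<lambda>y. \<Sum>j=1..M. h j x * h j y) f"
      by (simp add: H_operator_def L2_inner_def)
    also have "\<dots> = (\<Sum>j=1..M. h j x * L2_inner \<mu> (h j) f)"
      using hL f by (intro L2_inner_sum) auto
    finally show "H_operator \<Omega> h M f x = (\<Sum>j=1..M. L2_inner \<mu> f (h j) * h j x)"
      by (simp add: L2_inner_commute[of \<mu> f] mult.commute)
  qed
  have "maximal_orthonormal_set \<mu> (L2H \<Omega>) (h ` {1..})"
    unfolding maximal_orthonormal_set_def
  proof (intro conjI allI impI)
    have "L2_inner \<mu> (h i) (h j) = (if h i = h j then 1 else 0)" if "i \<ge> 1" "j \<ge> 1" for i j
      using on[OF that] on[OF that(1) that(1)] by (cases "i = j") auto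
    then show "orthonormal_set \<mu> (h ` {1..})"
      unfolding orthonormal_set_def using hL by auto
    show "h ` {1..} \<subseteq> L2H \<Omega>" using hH by auto
    fix C assume C: "orthonormal_set \<mu> C \<and> h ` {1..} \<subseteq> C \<and> C \<subseteq> L2H \<Omega>"
    show "C = h ` {1..}"
    proof (rule ccontr)
      assume "C \<noteq> h ` {1..}"
      then obtain v where v: "v \<in> C" "v \<notin> h ` {1..}" using C by blast
      have "L2_inner \<mu> v (h j) = 0" if "j \<ge> 1" for j
      proof -
        have "h j \<in> C" "v \<noteq> h j" using C v that by auto
        then show ?thesis using C v(1) unfolding orthonormal_set_def by simp
      qed
      moreover have "v \<in> L2H \<Omega>" using C v by blast
      ultimately have "AE x in \<mu>. v x = 0" using complete by blast
      then have "L2_inner \<mu> v v = 0"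
        unfolding L2_inner_def by (intro integral_eq_zero_AE) (auto elim: eventually_mono)
      moreover have "L2_inner \<mu> v v = 1" using C v(1) unfolding orthonormal_set_def by simp
      ultimately show False by simp
    qed
  qed
  then show ?thesis using exp op by simp
qed

end
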